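(* Let $\mu$ be the self-similar probability measure satisfying $\mu=\sum_{i=0}^7 p_i\,\mu\circ S_i^{-1}$, where $S_i(x)=x/4+d_i/12$ with $d_i=i$ for $i=0,\dots,5$, $d_6=8$, $d_7=9$, and $p_0=1/2$, $p_i=1/14$ for $i=1,\dots,7$. With the terminology of the context, the set of triples $$\mathcal L=\{[2,7,6],[4,5,6],[5,6,2],[7,6,2]\}$$ is a maximal loop class of triples, different from the essential triple class $\{[4,4,4]\}$. For the points $x\in[0,1]$ in the loop class $\mathcal L$: (i) the set of lower local dimensions $\{\underline{\dim}_{loc}\mu(x): x\text{ in }\mathcal L\}$ is the interval $\left[\frac12,\frac{\log14}{\log4}\right]$; (ii) the set of upper local dimensions $\{\overline{\dim}_{loc}\mu(x): x\text{ in }\mathcal L\}$ is $\left\{\frac12\right\}\cup\left[\frac{\log7}{\log4},\frac{\log14}{\log4}\right]$; in particular it is not an interval.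
   Context: $\overline{\dim}_{loc}\mu(x)=\limsup_{r\to0^+}\frac{\log\mu([x-r,x+r])}{\log r}$ and $\underline{\dim}_{loc}\mu(x)$ is the corresponding $\liminf$. The support of $\mu$ is $K=[0,1]$. Net intervals. Let $\varrho=1/4$, $\mathcal A=\{0,\dots,7\}$, $S_\sigma=S_{j_1}\circ\cdots\circ S_{j_n}$ for $\sigma\in\mathcal A^n$. Let $h_1<\dots<h_{s_n}$ be the elements of $\{S_\sigma(0),S_\sigma(1):\sigma\in\mathcal A^n\}$; the net intervals of level $n$ are the intervals $[h_j,h_{j+1}]$ with $(h_j,h_{j+1})\cap K\ne\emptyset$ (level $0$: $[0,1]$). Each net interval of level $n\ge1$ is contained in a unique net interval of level $n-1$, its parent, of which it is a child. The reduced characteristic vector of a level $n$ net interval $\Delta=[a,b]$ is $(\ell,V)$ with $\ell=\varrho^{-n}(b-a)$ and $V$ the increasingly ordered tuple of the distinct elements of $\{\varrho^{-n}(a-S_\sigma(0)):\sigma\in\mathcal A^n,\Delta\subseteq S_\sigma[0,1]\}$. The reduced characteristic vectors that occur are numbered: $1=(1,(0))$, $2=(1/3,(0))$, $3=(1/3,(0,1/3))$, $4=(1/3,(0,1/3,2/3))$, $5=(1/3,(1/3,2/3))$, $6=(1/3,(2/3))$, $7=(2/3,(0,1/3))$. Triples. The triple of a level $n$ net interval $\Delta$ is $[u,v,w]$, where $v$ is the number of the reduced characteristic vector of $\Delta$, and $u,w$ are the numbers for the level $n$ net intervals immediately to the left and to the right of $\Delta$ ($X$ if there is none). Put a directed edge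 from triple $t$ to triple $t'$ if some net interval with triple $t$ has a child with triple $t'$. A loop class of triples is a non-empty set of triples in which any triple can be reached from any triple by a directed path within the set; it is maximal if not properly contained in another loop class; it is essential if it is closed under taking children. A point $x$ is in the loop class $\mathcal L$ if there is a nested sequence of net intervals $\Delta_0\supseteq\Delta_1\supseteq\cdots$, with $\Delta_n$ of level $n$, containing $x$, such that the triple of $\Delta_n$ belongs to $\mathcal L$ for all sufficiently large $n$. *)

theory Defs
  imports "HOL-Probability.Probability"
begin

definition d :: "nat \<Rightarrow> real" where
  "d i = [0, 1, 2, 3, 4, 5, 8, 9] ! i"

definition S :: "nat \<Rightarrow> real \<Rightarrow> real" where
  "S i x = x / 4 + d i / 12"

definition p :: "nat \<Rightarrow> real" where
  "p i = (if i = 0 then 1 / 2 else 1 / 14)"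

definition self_similar_measure :: "real measure \<Rightarrow> bool" where
  "self_similar_measure \<mu> \<longleftrightarrow>
     prob_space \<mu> \<and> sets \<mu> = sets borel \<and>
     (\<forall>A\<in>sets borel. measure \<mu> A = (\<Sum>i<8. p i * measure \<mu> (S i -` A)))"

definition K :: "real set" where
  "K = {0..1}"

(* At points of the support of the measure all the balls below have positive measure, so the
   library convention for ln 0 plays no role there. *)
definition upper_local_dim :: "real measure \<Rightarrow> real \<Rightarrow> ereal" where
  "upper_local_dim \<mu> x =
     Limsup (at_right 0) (\<lambda>r. ereal (ln (measure \<mu> {x - r..x + r}) / ln r))"

definition lower_local_dim :: "real measure \<Rightarrow> real \<Rightarrow> ereal" where
  "lower_local_dim \<mu> x =
     Liminf (at_right 0) (\<lambda>r. ereal (ln (measure \<mu> {x - r..x + r}) / ln r))"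

definition words :: "nat \<Rightarrow> nat list set" where
  "words n = {\<sigma>. length \<sigma> = n \<and> set \<sigma> \<subseteq> {0..7}}"

definition S_word :: "nat list \<Rightarrow> real \<Rightarrow> real" where
  "S_word \<sigma> = foldr S \<sigma>"

definition endpoints :: "nat \<Rightarrow> real list" where
  "endpoints n = sorted_list_of_set (\<Union>\<sigma>\<in>words n. {S_word \<sigma> 0, S_word \<sigma> 1})"

(* A net interval [a, b] is represented by the pair (a, b). *)
definition net_intervals :: "nat \<Rightarrow> (real \<times> real) set" where
  "net_intervals n =
     {(endpoints n ! j, endpoints n ! Suc j) | j.
        Suc j < length (endpoints n) \<and>
        {endpoints n ! j<..<endpoints n ! Suc j} \<inter> K \<noteq> {}}"

definition interval_of :: "real \<times> real \<Rightarrow> real set" where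
  "interval_of \<Delta> = {fst \<Delta>..snd \<Delta>}"

definition is_child :: "nat \<Rightarrow> real \<times> real \<Rightarrow> real \<times> real \<Rightarrow> bool" where
  "is_child n \<Delta> \<Delta>' \<longleftrightarrow>
     \<Delta> \<in> net_intervals n \<and> \<Delta>' \<in> net_intervals (Suc n) \<and> interval_of \<Delta>' \<subseteq> interval_of \<Delta>"

definition reduced_vector :: "nat \<Rightarrow> real \<times> real \<Rightarrow> real \<times> real list" where
  "reduced_vector n \<Delta> =
     (4 ^ n * (snd \<Delta> - fst \<Delta>),
      sorted_list_of_set
        {4 ^ n * (fst \<Delta> - S_word \<sigma> 0) | \<sigma>.
           \<sigma> \<in> words n \<and> interval_of \<Delta> \<subseteq> S_word \<sigma> ` {0..1}})"

definition vector_table :: "(real \<times> real list) list" where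
  "vector_table =
     [(1, [0]), (1/3, [0]), (1/3, [0, 1/3]), (1/3, [0, 1/3, 2/3]),
      (1/3, [1/3, 2/3]), (1/3, [2/3]), (2/3, [0, 1/3])]"

definition vector_number :: "real \<times> real list \<Rightarrow> nat" where
  "vector_number v = (THE k. k \<in> {1..7} \<and> vector_table ! (k - 1) = v)"

definition number_of :: "nat \<Rightarrow> real \<times> real \<Rightarrow> nat" where
  "number_of n \<Delta> = vector_number (reduced_vector n \<Delta>)"

(* The symbol X (no neighbour) is None. As the net intervals of a fixed level tile K = [0, 1],
   immediate neighbours are those sharing an endpoint. *)
type_synonym triple = "nat option \<times> nat \<times> nat option"

definition left_number :: "nat \<Rightarrow> real \<times> real \<Rightarrow> nat option" where
  "left_number n \<Delta> =
     (if \<exists>c. (c, fst \<Delta>) \<in> net_intervals n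
      then Some (number_of n (THE \<Delta>'. \<Delta>' \<in> net_intervals n \<and> snd \<Delta>' = fst \<Delta>))
      else None)"

definition right_number :: "nat \<Rightarrow> real \<times> real \<Rightarrow> nat option" where
  "right_number n \<Delta> =
     (if \<exists>c. (snd \<Delta>, c) \<in> net_intervals n
      then Some (number_of n (THE \<Delta>'. \<Delta>' \<in> net_intervals n \<and> fst \<Delta>' = snd \<Delta>))
      else None)"

definition triple_of :: "nat \<Rightarrow> real \<times> real \<Rightarrow> triple" where
  "triple_of n \<Delta> = (left_number n \<Delta>, number_of n \<Delta>, right_number n \<Delta>)"

definition triple_edge :: "triple \<Rightarrow> triple \<Rightarrow> bool" where
  "triple_edge t t' \<longleftrightarrow>
     (\<exists>n \<Delta> \<Delta>'. is_child n \<Delta> \<Delta>' \<and> triple_of n \<Delta> = t \<and> triple_of (Suc n) \<Delta>' = t')"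

(* Paths have at least one edge; in particular all members of a loop class are triples that
   occur. *)
definition loop_class :: "triple set \<Rightarrow> bool" where
  "loop_class L \<longleftrightarrow>
     L \<noteq> {} \<and>
     (\<forall>t\<in>L. \<forall>t'\<in>L. (\<lambda>s s'. s \<in> L \<and> s' \<in> L \<and> triple_edge s s')\<^sup>+\<^sup>+ t t')"

definition maximal_loop_class :: "triple set \<Rightarrow> bool" where
  "maximal_loop_class L \<longleftrightarrow> loop_class L \<and> (\<forall>L'. loop_class L' \<longrightarrow> \<not> L \<subset> L')"

definition essential_loop_class :: "triple set \<Rightarrow> bool" where
  "essential_loop_class L \<longleftrightarrow>
     loop_class L \<and> (\<forall>t\<in>L. \<forall>t'. triple_edge t t' \<longrightarrow> t' \<in> L)"

definition in_loop_class :: "real \<Rightarrow> triple set \<Rightarrow> bool" where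
  "in_loop_class x L \<longleftrightarrow>
     (\<exists>\<Delta> :: nat \<Rightarrow> real \<times> real.
        (\<forall>n. \<Delta> n \<in> net_intervals n \<and> x \<in> interval_of (\<Delta> n) \<and>
             interval_of (\<Delta> (Suc n)) \<subseteq> interval_of (\<Delta> n)) \<and>
        (\<forall>\<^sub>F n in sequentially. triple_of n (\<Delta> n) \<in> L))"

definition LL :: "triple set" where
  "LL = {(Some 2, 7, Some 6), (Some 4, 5, Some 6), (Some 5, 6, Some 2), (Some 7, 6, Some 2)}"

end

theory Submission
  imports Defs "HOL-Real_Asymp.Real_Asymp"
begin

text \<open>
  In units of \<open>4 ^ (-n) / 3\<close> every level \<open>n\<close> cylinder is \<open>[e, e + 3]\<close> for an integer code \<open>e\<close>, and
  \<open>m\<close> is a code of level \<open>n + 1\<close> iff \<open>m mod 4 < 2\<close> or \<open>m div 4\<close> is a code of level \<open>n\<close>. Hence the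
  children of a unit cell \<open>[c, c + 1]\<close>, and their neighbours, depend only on whether \<open>c\<close> and
  \<open>c - 1\<close> are codes, and a triple lies in the loop class iff the last unit cell of the interval is not
  a code and is not the last cell of \<open>[0, 1]\<close>. The points in the loop class are thus those whose
  base 4 digits, after the integer part of \<open>3 x\<close>, are all 2 or 3.

  Up to bounded changes of the radius and the factor \<open>14 ^ (-n)\<close>, the mass of a ball of radius
  \<open>4 ^ (-n)\<close> around such a point is \<open>Q + R\<close>, where \<open>Q\<close>, the mass of the cell of the point, doubles at
  every digit 2 and is unchanged at a digit 3, while \<open>R\<close>, coming from the right neighbour, is reset to
  0 at a digit 2 and grows by the factor 7 along a run of 3s (the heavy weight \<open>p 0\<close> acts there). So the
  mass is about \<open>2 ^ a * 7 ^ j / 14 ^ n\<close>, with \<open>a\<close> the number of digits 2 among the first \<open>n\<close> and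
  \<open>j\<close> the length of the final run of 3s. If there are infinitely many digits 2, then \<open>j = 0\<close>
  infinitely often, which forces the upper dimension to be at least \<open>ln 7 / ln 4\<close>; otherwise both
  dimensions are \<open>1 / 2\<close>.
\<close>

text \<open>The recursion for codes comes from sorting the translations by residue mod 4: residue 0
  is produced by 0, 4, 8 from the cells c, c - 1, c - 2, residue 1 by 1, 5, 9, but residues 2 and 3
  only by 2 and 3 from c itself. One of c, c - 1, c - 2 is always a code, so residues 0 and 1 never
  fail, and a non-code has non-code children exactly at the digits 2 and 3. The obstacle is that the
  net interval of a point does not determine the mass of a ball: the cylinder that starts just to
  the right of the cell, reinforced by 14 * \<open>p 0\<close> = 7, may dominate. The left side is
  harmless, because a digit 2 or 3 puts the point in the right half of its cell. Values strictly
  between 1/2 and ln 7 / ln 4 are missing from the upper dimensions, so no point with equal lower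
  and upper dimension can realise them. As lower dimensions they need runs of 3 whose length is
  proportional to the level, whereas a fixed frequency of digits 2 with short runs of 3 covers the
  range from ln 7 / ln 4 on.\<close>

section \<open>Exponents along a geometric scale\<close>

lemma Liminf_le_filterlim:
  fixes g :: "'b \<Rightarrow> 'c::complete_linorder"
  assumes "filterlim f G F"
  shows "Liminf G g \<le> Liminf F (\<lambda>x. g (f x))"
  unfolding le_Liminf_iff
proof (intro allI impI)
  fix y assume "y < Liminf G g"
  from eventually_compose_filterlim[OF less_LiminfD[OF this] assms]
  show "\<forall>\<^sub>F x in F. y < g (f x)" .
qed

lemma Limsup_ge_filterlim:
  fixes g :: "'b \<Rightarrow> 'c::complete_linorder"
  assumes "filterlim f G F"
  shows "Limsup F (\<lambda>x. g (f x)) \<le> Limsup G g"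
  unfolding Limsup_le_iff
proof (intro allI impI)
  fix y assume "Limsup G g < y"
  from eventually_compose_filterlim[OF Limsup_lessD[OF this] assms]
  show "\<forall>\<^sub>F x in F. g (f x) < y" .
qed

text \<open>Radii matter only up to a bounded power of 4: the two radii that enclose
  \<open>f n\<close> are a factor 16 apart, and a bounded shift of the level disappears after
  division by \<open>n * ln 4\<close>. As \<open>ln r\<close> is negative, larger masses give
  smaller exponents, so the bounds swap sides.\<close>

lemma scale_exponents:
  fixes M :: "real \<Rightarrow> real" and f :: "nat \<Rightarrow> real"
  assumes mono: "\<And>r s. r \<le> s \<Longrightarrow> M r \<le> M s" and le1: "\<And>r. M r \<le> 1"
    and pos: "\<And>n. n \<ge> N \<Longrightarrow> 0 < f n"
    and upper: "\<And>n. n \<ge> N \<Longrightarrow> M (1 / (3 * 4 ^ Suc n)) \<le> f n"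
    and lower: "\<And>n. n \<ge> N \<Longrightarrow> f n \<le> M (4 / (3 * 4 ^ n))"
  defines "G \<equiv> \<lambda>n. - ln (f n) / (real n * ln 4)"
  shows "Liminf (at_right 0) (\<lambda>r. ereal (ln (M r) / ln r)) = liminf (\<lambda>n. ereal (G n))"
    "Limsup (at_right 0) (\<lambda>r. ereal (ln (M r) / ln r)) = limsup (\<lambda>n. ereal (G n))"
proof -
  define h where "h r = ln (M r) / ln r" for r
  have f1: "f n \<le> 1" if "n \<ge> N" for n using lower[OF that] le1 order_trans by blast
  have ln_scale: "ln (1 / (3 * 4 ^ j)) = - (ln 3 + real j * ln (4::real))" for j
    by (simp add: ln_div ln_mult ln_realpow)
  have den: "0 < ln 3 + real j * ln (4::real)" for j by (intro add_pos_nonneg) simp_all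
  have Mpos: "0 < M r" if "0 < r" for r
  proof -
    obtain n where n: "n \<ge> N" "4 / (3 * 4 ^ n) \<le> r"
    proof -
      have "(\<lambda>n. 4 / (3 * 4 ^ n) :: real) \<longlonglongrightarrow> 0" by real_asymp
      then have "\<forall>\<^sub>F n in sequentially. 4 / (3 * 4 ^ n) < r" using \<open>0 < r\<close> by (rule order_tendstoD)
      then have "\<forall>\<^sub>F n in sequentially. n \<ge> N \<and> 4 / (3 * 4 ^ n) < r"
        using eventually_ge_at_top[of N] by eventually_elim simp
      then show thesis using that by (metis (mono_tags, lifting) eventually_sequentially less_imp_le order_refl)
    qed
    have "0 < f n" using pos n by simp
    also have "f n \<le> M r" using lower[OF n(1)] mono[OF n(2)] by simp
    finally show ?thesis .
  qed
  have h_ge: "- ln (f n) / (ln 3 + real j * ln 4) \<le> h r"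
    if "n \<ge> N" "M r \<le> f n" "1 / (3 * 4 ^ j) \<le> r" "r < 1" for n j r
  proof -
    have r0: "0 < r" by (rule less_le_trans[OF _ that(3)]) simp
    have "ln (1 / (3 * 4 ^ j)) \<le> ln r" using that(3) by (intro ln_mono) auto
    then have l: "- ln r \<le> ln 3 + real j * ln 4" unfolding ln_scale by simp
    have "ln (M r) \<le> ln (f n)" using that(2) Mpos[OF r0] by (intro ln_mono) auto
    moreover have "ln (f n) \<le> 0" using f1[OF that(1)] pos[OF that(1)] by simp
    moreover have "ln r < 0" using r0 that(4) by simp
    ultimately have "- ln (f n) / (ln 3 + real j * ln 4) \<le> - ln (M r) / - ln r"
      using l by (intro frac_le) auto
    then show ?thesis by (simp add: h_def)
  qed
  have h_le: "h r \<le> - ln (f n) / (ln 3 + real j * ln 4)"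
    if "n \<ge> N" "f n \<le> M r" "r \<le> 1 / (3 * 4 ^ j)" "0 < r" for n j r
  proof -
    have "ln r \<le> ln (1 / (3 * 4 ^ j))" using that(3,4) by (intro ln_mono) auto
    then have l: "ln 3 + real j * ln 4 \<le> - ln r" unfolding ln_scale by simp
    have "ln (f n) \<le> ln (M r)" using that(2) pos[OF that(1)] by (intro ln_mono) auto
    moreover have "ln (M r) \<le> 0" using Mpos[OF that(4)] le1[of r] by simp
    ultimately have "- ln (M r) / - ln r \<le> - ln (f n) / (ln 3 + real j * ln 4)"
      using l den[of j] by (intro frac_le) auto
    then show ?thesis by (simp add: h_def)
  qed
  \<comment> \<open>The level \<open>k r\<close> is chosen so that \<open>r\<close> lies between
    \<open>1 / (3 * 4 ^ (k r + 2))\<close> and \<open>1 / (3 * 4 ^ (k r + 1))\<close>. The larger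
    one is the radius of \<open>upper\<close> at \<open>k r\<close>, the smaller one the radius of
    \<open>lower\<close> at \<open>k r + 3\<close>.\<close>
  define k where "k r = nat \<lfloor>log 4 (1 / (12 * r))\<rfloor>" for r :: real
  have k_lim: "filterlim k at_top (at_right 0)"
  proof -
    have "filterlim (\<lambda>r::real. log 4 (1 / (12 * r))) at_top (at_right 0)" by real_asymp
    then show ?thesis unfolding k_def
      by (intro filterlim_compose[OF filterlim_nat_sequentially]
          filterlim_compose[OF filterlim_floor_sequentially])
  qed
  have small: "\<forall>\<^sub>F r in at_right 0. 0 < r \<and> r < (1/12 :: real)"
    by (simp add: eventually_at_right_field) (rule exI[of _ "1/12"], simp)
  have kN: "\<forall>\<^sub>F r in at_right 0. N \<le> k r"
    using k_lim eventually_ge_at_top[of N] by (rule eventually_compose_filterlim[rotated])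
  have k_bounds: "1 / (3 * 4 ^ (k r + 2)) \<le> r" "r \<le> 1 / (3 * 4 ^ (k r + 1))" if "0 < r" "r < 1/12" for r
  proof -
    define z t where "z = 1 / (12 * r)" and "t = (4::real) ^ k r"
    have z: "1 \<le> z" "0 < z" using that by (simp_all add: z_def)
    have t: "0 < t" by (simp add: t_def)
    have "0 \<le> log 4 z" using z by simp
    then have k: "real (k r) \<le> log 4 z" "log 4 z \<le> real (k r + 1)"
      unfolding k_def z_def[symmetric] by linarith+
    from k(1) have "t \<le> z" using z by (simp add: le_log_iff powr_realpow t_def)
    then have "r \<le> 1 / (12 * t)" using t that by (simp add: z_def field_simps)
    from k(2) have "z \<le> 4 powr real (k r + 1)" using z by (subst (asm) log_le_iff) simp_all
    then have "z \<le> 4 * t" by (simp only: powr_realpow zero_less_numeral) (simp add: t_def)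
    then have "1 / (48 * t) \<le> r" using t that by (simp add: z_def field_simps)
    with \<open>r \<le> 1 / (12 * t)\<close> show "1 / (3 * 4 ^ (k r + 2)) \<le> r" "r \<le> 1 / (3 * 4 ^ (k r + 1))"
      by (simp_all add: t_def power_add)
  qed
  have G_eq: "- ln (f n) / (ln 3 + real j * ln 4) = (real n * ln 4 / (ln 3 + real j * ln 4)) * G n"
    if "n > 0" for n j
    using that by (simp add: G_def)
  \<comment> \<open>All bounds on \<open>h\<close> carry an index shifted by a constant. The shift
    multiplies the exponent by a factor tending to 1, so it changes neither limit; the subtraction
    on nat is exact once \<open>n\<close> reaches \<open>j\<close>.\<close>
  have liminf_scaled: "liminf (\<lambda>n. ereal (- ln (f n) / (ln 3 + real (n + i - j) * ln 4))) = liminf (\<lambda>n. ereal (G n))"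
    and limsup_scaled: "limsup (\<lambda>n. ereal (- ln (f n) / (ln 3 + real (n + i - j) * ln 4))) = limsup (\<lambda>n. ereal (G n))"
    for i j :: nat
  proof -
    define u where "u n = real n * ln 4 / (ln 3 + real (n + i - j) * ln 4)" for n
    have "(\<lambda>n. real n * ln 4 / (ln 3 + (real n + real i - real j) * ln 4)) \<longlonglongrightarrow> 1"
      by real_asymp
    moreover have "\<forall>\<^sub>F n in sequentially. real n * ln 4 / (ln 3 + (real n + real i - real j) * ln 4) = u n"
      using eventually_ge_at_top[of j] by eventually_elim (simp add: u_def of_nat_diff)
    ultimately have u: "u \<longlonglongrightarrow> 1" by (rule Lim_transform_eventually)
    have ev: "\<forall>\<^sub>F n in sequentially. ereal (- ln (f n) / (ln 3 + real (n + i - j) * ln 4)) = ereal (u n) * ereal (G n)"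
      using eventually_gt_at_top[of 0] by eventually_elim (simp add: G_def u_def)
    have lim: "(\<lambda>n. ereal (u n)) \<longlonglongrightarrow> 1" using u by (simp add: one_ereal_def)
    show "liminf (\<lambda>n. ereal (- ln (f n) / (ln 3 + real (n + i - j) * ln 4))) = liminf (\<lambda>n. ereal (G n))"
      using Liminf_eq[OF ev] ereal_liminf_lim_mult[OF lim, of "\<lambda>n. ereal (G n)"] by simp
    show "limsup (\<lambda>n. ereal (- ln (f n) / (ln 3 + real (n + i - j) * ln 4))) = limsup (\<lambda>n. ereal (G n))"
      using Limsup_eq[OF ev] ereal_limsup_lim_mult[OF lim, of "\<lambda>n. ereal (G n)"] by simp
  qed
  have lo: "\<forall>\<^sub>F r in at_right 0. ereal (- ln (f (k r)) / (ln 3 + real (k r + 2 - 0) * ln 4)) \<le> ereal (h r)"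
    using small kN
  proof eventually_elim
    case (elim r)
    then have r: "1 / (3 * 4 ^ (k r + 2)) \<le> r" "r \<le> 1 / (3 * 4 ^ Suc (k r))" "r < 1"
      using k_bounds[of r] by simp_all
    have "M r \<le> f (k r)" using order_trans[OF mono[OF r(2)] upper[OF elim(2)]] .
    from h_ge[OF elim(2) this r(1,3)] show ?case by (simp only: ereal_less_eq diff_zero)
  qed
  have up: "\<forall>\<^sub>F r in at_right 0. ereal (h r) \<le> ereal (- ln (f (k r + 3)) / (ln 3 + real (k r + 3 + 0 - 2) * ln 4))"
    using small kN
  proof eventually_elim
    case (elim r)
    have "4 / (3 * 4 ^ (k r + 3)) = 1 / (3 * 4 ^ (k r + 2) :: real)" by (simp add: power_add)
    then have r: "4 / (3 * 4 ^ (k r + 3)) \<le> r" "r \<le> 1 / (3 * 4 ^ (k r + 1))" "0 < r"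
      using k_bounds[of r] elim by simp_all
    have N: "N \<le> k r + 3" using elim by simp
    have "f (k r + 3) \<le> M r" using order_trans[OF lower[OF N] mono[OF r(1)]] .
    from h_le[OF N this r(2,3)] show ?case by (simp add: add.commute)
  qed
  \<comment> \<open>For the two remaining inequalities the radii of \<open>upper\<close> and
    \<open>lower\<close> themselves serve as test sequences tending to 0.\<close>
  define r1 where "r1 n = (1 / (3 * 4 ^ Suc n) :: real)" for n :: nat
  define r2 where "r2 n = (4 / (3 * 4 ^ n) :: real)" for n :: nat
  have r1: "filterlim r1 (at_right 0) sequentially" unfolding r1_def by real_asymp
  have r2: "filterlim r2 (at_right 0) sequentially" unfolding r2_def by real_asymp
  have h1: "\<forall>\<^sub>F n in sequentially. ereal (- ln (f n) / (ln 3 + real (n + 1 - 0) * ln 4)) \<le> ereal (h (r1 n))"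
    using eventually_ge_at_top[of N]
  proof eventually_elim
    case (elim n)
    have "(1::real) \<le> 4 ^ n" by simp
    then have "1 < 12 * (4::real) ^ n" by linarith
    then have "r1 n < 1" by (simp add: r1_def)
    then show ?case using h_ge[of n "r1 n" "n + 1"] upper elim by (simp add: r1_def)
  qed
  have h2: "\<forall>\<^sub>F n in sequentially. ereal (h (r2 n)) \<le> ereal (- ln (f n) / (ln 3 + real (n + 0 - 1) * ln 4))"
    using eventually_ge_at_top[of N] eventually_gt_at_top[of 0]
  proof eventually_elim
    case (elim n)
    then have "r2 n \<le> 1 / (3 * 4 ^ (n - 1))" unfolding r2_def by (cases n) simp_all
    moreover have "0 < r2 n" by (simp add: r2_def)
    moreover have "f n \<le> M (r2 n)" using lower[OF elim(1)] by (simp add: r2_def)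
    ultimately have "h (r2 n) \<le> - ln (f n) / (ln 3 + real (n - 1) * ln 4)"
      using h_le[OF elim(1)] by blast
    then show ?case by simp
  qed
  have k3: "filterlim (\<lambda>r. k r + 3) sequentially (at_right 0)"
    using k_lim by (rule filterlim_at_top_mono) simp
  show "Liminf (at_right 0) (\<lambda>r. ereal (ln (M r) / ln r)) = liminf (\<lambda>n. ereal (G n))"
  proof (rule antisym)
    have "Liminf (at_right 0) (\<lambda>r. ereal (h r)) \<le> liminf (\<lambda>n. ereal (h (r2 n)))"
      by (rule Liminf_le_filterlim[OF r2])
    also have "\<dots> \<le> liminf (\<lambda>n. ereal (G n))"
      using Liminf_mono[OF h2] unfolding liminf_scaled .
    finally show "Liminf (at_right 0) (\<lambda>r. ereal (ln (M r) / ln r)) \<le> liminf (\<lambda>n. ereal (G n))"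
      unfolding h_def .
    have "liminf (\<lambda>n. ereal (G n)) \<le>
        Liminf (at_right 0) (\<lambda>r. ereal (- ln (f (k r)) / (ln 3 + real (k r + 2 - 0) * ln 4)))"
      using Liminf_le_filterlim[OF k_lim, of "\<lambda>n. ereal (- ln (f n) / (ln 3 + real (n + 2 - 0) * ln 4))"]
      unfolding liminf_scaled .
    also have "\<dots> \<le> Liminf (at_right 0) (\<lambda>r. ereal (h r))" by (rule Liminf_mono[OF lo])
    finally show "liminf (\<lambda>n. ereal (G n)) \<le> Liminf (at_right 0) (\<lambda>r. ereal (ln (M r) / ln r))"
      unfolding h_def .
  qed
  show "Limsup (at_right 0) (\<lambda>r. ereal (ln (M r) / ln r)) = limsup (\<lambda>n. ereal (G n))"
  proof (rule antisym)
    have "limsup (\<lambda>n. ereal (G n)) \<le> limsup (\<lambda>n. ereal (h (r1 n)))"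
      using Limsup_mono[OF h1] unfolding limsup_scaled .
    also have "\<dots> \<le> Limsup (at_right 0) (\<lambda>r. ereal (h r))"
      by (rule Limsup_ge_filterlim[OF r1])
    finally show "limsup (\<lambda>n. ereal (G n)) \<le> Limsup (at_right 0) (\<lambda>r. ereal (ln (M r) / ln r))"
      unfolding h_def .
    have "Limsup (at_right 0) (\<lambda>r. ereal (h r)) \<le>
        Limsup (at_right 0) (\<lambda>r. ereal (- ln (f (k r + 3)) / (ln 3 + real (k r + 3 + 0 - 2) * ln 4)))"
      by (rule Limsup_mono[OF up])
    also have "\<dots> \<le> limsup (\<lambda>n. ereal (G n))"
      using Limsup_ge_filterlim[OF k3, of "\<lambda>n. ereal (- ln (f n) / (ln 3 + real (n + 0 - 2) * ln 4))"]
      unfolding limsup_scaled .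
    finally show "Limsup (at_right 0) (\<lambda>r. ereal (ln (M r) / ln r)) \<le> limsup (\<lambda>n. ereal (G n))"
      unfolding h_def .
  qed
qed

section \<open>Codes and net intervals\<close>

definition D :: "nat \<Rightarrow> int" where
  "D i = [0, 1, 2, 3, 4, 5, 8, 9] ! i"

text \<open>For a word of length \<open>n\<close>, \<open>code \<sigma> / (3 * 4 ^ n)\<close> is the
  left end of its cylinder, see \<open>S_word_eq\<close>. The left fold makes appending a letter,
  that is, passing to a subcylinder, the recursion step.\<close>

definition code :: "nat list \<Rightarrow> int" where
  "code \<sigma> = foldl (\<lambda>c i. 4 * c + D i) 0 \<sigma>"

definition pt :: "nat \<Rightarrow> int \<Rightarrow> real" where
  "pt n m = of_int m / (3 * 4 ^ n)"

lemma atMost7_cases: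
  "i \<in> {0..7::nat} \<longleftrightarrow> i = 0 \<or> i = 1 \<or> i = 2 \<or> i = 3 \<or> i = 4 \<or> i = 5 \<or> i = 6 \<or> i = 7"
  by auto

lemma d_eq_D: "i \<in> {0..7} \<Longrightarrow> d i = of_int (D i)"
  unfolding atMost7_cases d_def D_def by (elim disjE) simp_all

lemma code_snoc: "code (\<sigma> @ [i]) = 4 * code \<sigma> + D i"
  by (simp add: code_def)

lemma words_0: "words 0 = {[]}"
  by (auto simp: words_def)

lemma words_Suc: "words (Suc n) = (\<lambda>(\<sigma>, i). \<sigma> @ [i]) ` (words n \<times> {0..7})"
proof (intro set_eqI iffI)
  fix \<sigma> assume "\<sigma> \<in> words (Suc n)"
  then have "length \<sigma> = Suc n" "set \<sigma> \<subseteq> {0..7}" by (auto simp: words_def)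
  then show "\<sigma> \<in> (\<lambda>(\<sigma>, i). \<sigma> @ [i]) ` (words n \<times> {0..7})"
    by (cases \<sigma> rule: rev_cases) (auto simp: words_def image_iff)
qed (auto simp: words_def)

lemma finite_words [simp]: "finite (words n)"
  by (induction n) (auto simp: words_0 words_Suc)

lemma S_word_eq: "\<sigma> \<in> words n \<Longrightarrow> S_word \<sigma> x = (3 * x + of_int (code \<sigma>)) / (3 * 4 ^ n)"
proof (induction n arbitrary: \<sigma> x)
  case 0
  then show ?case by (simp add: words_0 S_word_def code_def)
next
  case (Suc n)
  then obtain \<tau> i where \<tau>: "\<sigma> = \<tau> @ [i]" "\<tau> \<in> words n" "i \<in> {0..7}"
    by (auto simp: words_Suc)
  have "S_word \<sigma> x = S_word \<tau> (S i x)" by (simp add: \<tau>(1) S_word_def)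
  then show ?case
    using Suc.IH[OF \<tau>(2)] d_eq_D[OF \<tau>(3)]
    by (simp add: \<tau>(1) code_snoc S_def field_simps)
qed

lemma S_word_0: "\<sigma> \<in> words n \<Longrightarrow> S_word \<sigma> 0 = pt n (code \<sigma>)"
  and S_word_1: "\<sigma> \<in> words n \<Longrightarrow> S_word \<sigma> 1 = pt n (code \<sigma> + 3)"
  by (simp_all add: S_word_eq pt_def add.commute)

text \<open>The set of codes of level \<open>n\<close>, described without words;
  \<open>code_image\<close> shows the agreement. In this form membership of \<open>m\<close> depends
  only on its last base 4 digit and on its parent cell \<open>m div 4\<close>.\<close>

fun E :: "nat \<Rightarrow> int set" where
  "E 0 = {0}"
| "E (Suc n) = {m. 0 \<le> m \<and> m < 12 * 4 ^ n \<and> (m mod 4 < 2 \<or> m div 4 \<in> E n)}"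

declare E.simps(2) [simp del]

lemma E_Suc_iff:
  assumes "0 \<le> c" "c < 3 * 4 ^ n"
  shows "4 * c \<in> E (Suc n)" "4 * c + 1 \<in> E (Suc n)"
    "4 * c + 2 \<in> E (Suc n) \<longleftrightarrow> c \<in> E n" "4 * c + 3 \<in> E (Suc n) \<longleftrightarrow> c \<in> E n"
proof -
  have "4 * c + 1 < 12 * 4 ^ n" "4 * c < 12 * 4 ^ n" "4 * c + 2 < 12 * 4 ^ n" "4 * c + 3 < 12 * 4 ^ n"
    using assms by simp_all
  moreover have "(4 * c + 1) mod 4 = 1" "(4 * c + 2) mod 4 = 2" "(4 * c + 3) mod 4 = 3"
    "(4 * c + 2) div 4 = c" "(4 * c + 3) div 4 = c" by presburger+
  ultimately show "4 * c \<in> E (Suc n)" "4 * c + 1 \<in> E (Suc n)"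
    "4 * c + 2 \<in> E (Suc n) \<longleftrightarrow> c \<in> E n" "4 * c + 3 \<in> E (Suc n) \<longleftrightarrow> c \<in> E n"
    using assms by (simp_all add: E.simps(2))
qed

lemma E_range: "m \<in> E n \<Longrightarrow> 0 \<le> m \<and> m \<le> 3 * 4 ^ n - 3"
proof (induction n arbitrary: m)
  case (Suc n)
  define t where "t = (4::int) ^ n"
  from Suc.prems have m: "0 \<le> m" "m < 12 * t" "m mod 4 < 2 \<or> m div 4 \<in> E n"
    by (auto simp: t_def E.simps(2))
  from m(3) have "m \<le> 12 * t - 3"
  proof
    assume "m mod 4 < 2" with m(2) show ?thesis by presburger
  next
    assume "m div 4 \<in> E n"
    from Suc.IH[OF this] show ?thesis unfolding t_def[symmetric] by presburger
  qed
  with m(1) show ?case by (simp add: t_def)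
qed simp

lemma div4_range:
  fixes m :: int
  assumes "0 \<le> m" "m < 12 * 4 ^ n"
  shows "0 \<le> m div 4" "m div 4 < 3 * 4 ^ n"
proof -
  define t where "t = (4::int) ^ n"
  show "0 \<le> m div 4" "m div 4 < 3 * 4 ^ n"
    using assms unfolding t_def[symmetric] by presburger+
qed

text \<open>In geometric terms, every unit cell of [0, 1] lies in some cylinder. At positive levels
  this holds because cells of residue 0 or 1 mod 4 are always codes, and going back at most two
  cells reaches one.\<close>

lemma E_cover:
  assumes "0 \<le> m" "m < 3 * 4 ^ n"
  shows "m \<in> E n \<or> m - 1 \<in> E n \<or> m - 2 \<in> E n"
proof (cases n)
  case 0
  with assms show ?thesis by auto
next
  case (Suc k)
  define c where "c = m div 4"
  have c: "0 \<le> c" "c < 3 * 4 ^ k" using assms div4_range[of m k] by (simp_all add: c_def Suc)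
  have "m = 4 * c \<or> m = 4 * c + 1 \<or> m = 4 * c + 2 \<or> m = 4 * c + 3"
    unfolding c_def by presburger
  then show ?thesis
    using E_Suc_iff(1,2)[OF c] by (elim disjE) (simp_all add: Suc add.commute)
qed

lemma code_image: "code ` words n = E n"
proof (induction n)
  case 0
  then show ?case by (simp add: words_0 code_def)
next
  case (Suc n)
  define X where "X = {4 * c + D i |c i. c \<in> E n \<and> i \<in> {0..7}}"
  have "code ` words (Suc n) = X" unfolding X_def
    by (force simp: words_Suc code_snoc Suc[symmetric])
  also have "\<dots> = E (Suc n)"
  proof (intro set_eqI iffI)
    fix m assume "m \<in> X"
    then obtain c i where c: "m = 4 * c + D i" "c \<in> E n" "i \<in> {0..7}" unfolding X_def by blast
    define t where "t = (4::int) ^ n"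
    have r: "0 \<le> c" "c \<le> 3 * t - 3" using E_range[OF c(2)] by (auto simp: t_def)
    have D: "D i \<in> {0,1,2,3,4,5,8,9}"
      using c(3) unfolding atMost7_cases D_def by (elim disjE) simp_all
    have "0 \<le> m" "m < 12 * t" using D r c(1) by auto
    moreover have "m mod 4 < 2 \<or> m div 4 = c" using D c(1) by auto
    ultimately show "m \<in> E (Suc n)" using c(2) by (auto simp: t_def E.simps(2))
  next
    fix m assume m: "m \<in> E (Suc n)"
    define a where "a = m div 4"
    from m have a: "0 \<le> a" "a < 3 * 4 ^ n" using div4_range[of m n] by (simp_all add: a_def E.simps(2))
    from m have alt: "m mod 4 < 2 \<or> a \<in> E n" by (auto simp: a_def E.simps(2))
    have ex: "m \<in> X" if "c \<in> E n" "m = 4 * c + D i" "i \<in> {0..7}" for c i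
      unfolding X_def using that by blast
    have m4: "m = 4 * a \<or> m = 4 * a + 1 \<or> m = 4 * a + 2 \<or> m = 4 * a + 3"
      unfolding a_def by presburger
    show "m \<in> X"
    proof (cases "a \<in> E n")
      case True
      show ?thesis using m4 ex[OF True, of 0] ex[OF True, of 1] ex[OF True, of 2] ex[OF True, of 3]
        by (auto simp: D_def)
    next
      case False
      \<comment> \<open>Here \<open>E_cover\<close> supplies a parent to the left:
        \<open>a - 1\<close> with the translations 4, 5 (letters 4, 5) or \<open>a - 2\<close> with
        the translations 8, 9 (letters 6, 7).\<close>
      then have "m = 4 * a \<or> m = 4 * a + 1" using alt m4 by auto
      moreover have "a - 1 \<in> E n \<or> a - 2 \<in> E n" using E_cover[OF a] False by simp
      ultimately show ?thesis
        using ex[of "a - 1" 4] ex[of "a - 1" 5] ex[of "a - 2" 6] ex[of "a - 2" 7]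
        by (auto simp: D_def add.commute)
    qed
  qed
  finally show ?case .
qed

section \<open>Endpoints and net intervals in integer coordinates\<close>

definition P :: "nat \<Rightarrow> int set" where
  "P n = E n \<union> (\<lambda>e. e + 3) ` E n"

lemma P_iff: "m \<in> P n \<longleftrightarrow> m \<in> E n \<or> m - 3 \<in> E n"
  unfolding P_def by force

lemma finite_E [simp]: "finite (E n)"
  by (simp flip: code_image)

lemma finite_P [simp]: "finite (P n)"
  by (simp add: P_def)

lemma endpoints_eq: "endpoints n = sorted_list_of_set (pt n ` P n)"
proof -
  have "(\<Union>\<sigma>\<in>words n. {S_word \<sigma> 0, S_word \<sigma> 1}) = pt n ` P n"
    unfolding P_def by (force simp: S_word_0 S_word_1 simp flip: code_image)
  then show ?thesis by (simp add: endpoints_def)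
qed

lemma pt_less [simp]: "pt n a < pt n b \<longleftrightarrow> a < b"
  and pt_le [simp]: "pt n a \<le> pt n b \<longleftrightarrow> a \<le> b"
  and pt_eq [simp]: "pt n a = pt n b \<longleftrightarrow> a = b"
  by (simp_all add: pt_def divide_less_cancel divide_le_cancel)

lemma pt_Suc: "pt (Suc n) (4 * m) = pt n m"
  by (simp add: pt_def)

lemma consecutive_sorted_list_of_set:
  fixes A :: "'a::linorder set"
  assumes "finite A"
  shows "(\<exists>j. a = sorted_list_of_set A ! j \<and> b = sorted_list_of_set A ! Suc j
            \<and> Suc j < length (sorted_list_of_set A)) \<longleftrightarrow>
    a \<in> A \<and> b \<in> A \<and> a < b \<and> (\<forall>c\<in>A. \<not> (a < c \<and> c < b))" (is "?L \<longleftrightarrow> ?R")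
proof -
  define xs where "xs = sorted_list_of_set A"
  have xs: "set xs = A" "sorted_wrt (<) xs"
    using assms by (simp_all add: xs_def)
  have mono: "xs ! i < xs ! j \<longleftrightarrow> i < j" if "i < length xs" "j < length xs" for i j
    using sorted_wrt_nth_less[OF xs(2)] that
    by (metis less_asym linorder_neqE_nat order_less_irrefl)
  show ?thesis
  proof
    assume ?L
    then obtain j where j: "a = xs ! j" "b = xs ! Suc j" "Suc j < length xs"
      unfolding xs_def by blast
    have "\<not> (a < c \<and> c < b)" if "c \<in> A" for c
    proof -
      obtain i where "i < length xs" "c = xs ! i"
        using \<open>c \<in> A\<close> unfolding xs(1)[symmetric] in_set_conv_nth by blast
      then show ?thesis using mono[of j i] mono[of i "Suc j"] j by auto
    qed
    moreover have "a \<in> A" "b \<in> A" using j xs(1) by (metis Suc_lessD nth_mem)+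
    ultimately show ?R using mono[of j "Suc j"] j by auto
  next
    assume R: ?R
    then obtain i k where i: "i < length xs" "a = xs ! i" and k: "k < length xs" "b = xs ! k"
      unfolding xs(1)[symmetric] in_set_conv_nth by blast
    have "i < k" using R mono i k by auto
    moreover have "\<not> Suc i < k"
    proof
      assume "Suc i < k"
      then have "xs ! Suc i \<in> A" "a < xs ! Suc i" "xs ! Suc i < b"
        using mono i k by (auto simp flip: xs(1))
      with R show False by blast
    qed
    ultimately have "k = Suc i" by simp
    then show ?L using i k unfolding xs_def by blast
  qed
qed

definition NI :: "nat \<Rightarrow> int \<Rightarrow> int \<Rightarrow> bool" where
  "NI n a b \<longleftrightarrow> a \<in> P n \<and> b \<in> P n \<and> a < b \<and> (\<forall>c. a < c \<and> c < b \<longrightarrow> c \<notin> P n)"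

lemma P_range: "m \<in> P n \<Longrightarrow> 0 \<le> m \<and> m \<le> 3 * 4 ^ n"
  using E_range[of m n] E_range[of "m - 3" n] by (auto simp: P_iff)

lemma pt_unit: "m \<in> P n \<Longrightarrow> 0 \<le> pt n m \<and> pt n m \<le> 1"
proof -
  assume "m \<in> P n"
  from P_range[OF this] have "0 \<le> m" "real_of_int m \<le> real_of_int (3 * 4 ^ n)"
    by linarith+
  then show ?thesis by (simp add: pt_def)
qed

lemma net_intervals_eq: "net_intervals n = {(pt n a, pt n b) |a b. NI n a b}"
proof -
  define xs where "xs = sorted_list_of_set (pt n ` P n)"
  have ix: "(x, y) \<in> net_intervals n \<longleftrightarrow>
     ((\<exists>j. x = xs ! j \<and> y = xs ! Suc j \<and> Suc j < length xs) \<and> {x<..<y} \<inter> K \<noteq> {})" for x y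
    unfolding net_intervals_def endpoints_eq xs_def by blast
  have "(x, y) \<in> net_intervals n \<longleftrightarrow> (\<exists>a b. x = pt n a \<and> y = pt n b \<and> NI n a b)" for x y
  proof -
    have K: "{pt n a<..<pt n b} \<inter> K \<noteq> {}" if "NI n a b" for a b
    proof -
      have "0 \<le> pt n a" "pt n b \<le> 1" "pt n a < pt n b" "0 \<le> pt n b" "pt n a \<le> 1"
        using that pt_unit[of a n] pt_unit[of b n] by (auto simp: NI_def)
      then have "(pt n a + pt n b) / 2 \<in> {pt n a<..<pt n b} \<inter> K" by (simp add: K_def del: pt_less pt_le)
      then show ?thesis by blast
    qed
    have "(\<exists>j. x = xs ! j \<and> y = xs ! Suc j \<and> Suc j < length xs) \<longleftrightarrow>
        (\<exists>a b. x = pt n a \<and> y = pt n b \<and> NI n a b)"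
      unfolding xs_def consecutive_sorted_list_of_set[OF finite_imageI[OF finite_P]] NI_def
      by auto
    then show ?thesis using K by (auto simp: ix)
  qed
  then show ?thesis by auto
qed

lemma net_intervals_iff [simp]: "(pt n a, pt n b) \<in> net_intervals n \<longleftrightarrow> NI n a b"
  by (auto simp: net_intervals_eq)

lemma negative_not_code: "m < 0 \<Longrightarrow> m \<notin> E n"
  using E_range[of m n] by linarith

text \<open>The two cells left of \<open>4 * c\<close> are the digits 2 and 3 below the cell
  \<open>c - 1\<close>. For \<open>c = 0\<close> all of these numbers are negative and no
  codes.\<close>

lemma E_Suc_pred:
  assumes "0 \<le> c" "c < 3 * 4 ^ n"
  shows "4 * c - 1 \<in> E (Suc n) \<longleftrightarrow> c - 1 \<in> E n" "4 * c - 2 \<in> E (Suc n) \<longleftrightarrow> c - 1 \<in> E n"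
proof -
  have "(4 * c - 1 \<in> E (Suc n) \<longleftrightarrow> c - 1 \<in> E n) \<and> (4 * c - 2 \<in> E (Suc n) \<longleftrightarrow> c - 1 \<in> E n)"
  proof (cases "c = 0")
    case True
    then show ?thesis by (simp add: negative_not_code)
  next
    case False
    then have "4 * (c - 1) + 2 \<in> E (Suc n) \<longleftrightarrow> c - 1 \<in> E n"
      "4 * (c - 1) + 3 \<in> E (Suc n) \<longleftrightarrow> c - 1 \<in> E n"
      using E_Suc_iff(3,4)[of "c - 1" n] assms by simp_all
    moreover have "4 * (c - 1) + 2 = 4 * c - 2" "4 * (c - 1) + 3 = 4 * c - 1" by simp_all
    ultimately show ?thesis by metis
  qed
  then show "4 * c - 1 \<in> E (Suc n) \<longleftrightarrow> c - 1 \<in> E n" "4 * c - 2 \<in> E (Suc n) \<longleftrightarrow> c - 1 \<in> E n"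
    by simp_all
qed

text \<open>The midpoint \<open>4 * c + 2\<close> is the only grid point that can fail to be an
  endpoint: it is a left end iff \<open>c\<close> is a code, and a right end iff
  \<open>4 * c - 1\<close> is a code, which goes back to \<open>c - 1\<close>. When it is missing,
  the two middle quarters of the cell merge; this is where the vector of length 2/3 comes
  from.\<close>

lemma P_Suc_iff:
  assumes "0 \<le> c" "c < 3 * 4 ^ n"
  shows "4 * c \<in> P (Suc n)" "4 * c + 1 \<in> P (Suc n)"
    "4 * c + 2 \<in> P (Suc n) \<longleftrightarrow> c \<in> E n \<or> c - 1 \<in> E n" "4 * c + 3 \<in> P (Suc n)"
    "4 * c + 4 \<in> P (Suc n)"
proof -
  have "4 * c + 2 - 3 = 4 * c - 1" "4 * c + 3 - 3 = 4 * c" "4 * c + 4 - 3 = 4 * c + 1"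
    by simp_all
  then show "4 * c \<in> P (Suc n)" "4 * c + 1 \<in> P (Suc n)"
    "4 * c + 2 \<in> P (Suc n) \<longleftrightarrow> c \<in> E n \<or> c - 1 \<in> E n" "4 * c + 3 \<in> P (Suc n)"
    "4 * c + 4 \<in> P (Suc n)"
    unfolding P_iff using E_Suc_iff[OF assms] E_Suc_pred(1)[OF assms] by metis+
qed

lemma NI_unit: "a \<in> P n \<Longrightarrow> a + 1 \<in> P n \<Longrightarrow> NI n a (a + 1)"
  by (auto simp: NI_def)

lemma NI_double:
  assumes "a \<in> P n" "a + 1 \<notin> P n" "a + 2 \<in> P n"
  shows "NI n a (a + 2)"
proof -
  have "c = a + 1" if "a < c \<and> c < a + 2" for c using that by simp
  with assms show ?thesis unfolding NI_def by (metis less_add_same_cancel1 zero_less_numeral)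
qed

lemma NI_children:
  assumes "0 \<le> c" "c < 3 * 4 ^ n"
  shows "NI (Suc n) (4 * c) (4 * c + 1)" "NI (Suc n) (4 * c + 3) (4 * c + 4)"
    "c \<in> E n \<or> c - 1 \<in> E n \<Longrightarrow> NI (Suc n) (4 * c + 1) (4 * c + 2)"
    "c \<in> E n \<or> c - 1 \<in> E n \<Longrightarrow> NI (Suc n) (4 * c + 2) (4 * c + 3)"
    "c \<notin> E n \<Longrightarrow> c - 1 \<notin> E n \<Longrightarrow> NI (Suc n) (4 * c + 1) (4 * c + 3)"
proof -
  have eqs: "4 * c + 1 + 1 = 4 * c + 2" "4 * c + 2 + 1 = 4 * c + 3" "4 * c + 3 + 1 = 4 * c + 4"
    "4 * c + 1 + 2 = 4 * c + 3" by simp_all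
  note Pc = P_Suc_iff[OF assms]
  show "NI (Suc n) (4 * c) (4 * c + 1)" "NI (Suc n) (4 * c + 3) (4 * c + 4)"
    "c \<in> E n \<or> c - 1 \<in> E n \<Longrightarrow> NI (Suc n) (4 * c + 1) (4 * c + 2)"
    "c \<in> E n \<or> c - 1 \<in> E n \<Longrightarrow> NI (Suc n) (4 * c + 2) (4 * c + 3)"
    using NI_unit Pc eqs by metis+
  show "c \<notin> E n \<Longrightarrow> c - 1 \<notin> E n \<Longrightarrow> NI (Suc n) (4 * c + 1) (4 * c + 3)"
    using NI_double[of "4 * c + 1" "Suc n"] Pc unfolding eqs by simp
qed

lemma NI_unique_left: "NI n a b \<Longrightarrow> NI n a' b \<Longrightarrow> a' = a"
  unfolding NI_def by (metis linorder_neqE)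

lemma NI_unique_right: "NI n a b \<Longrightarrow> NI n a b' \<Longrightarrow> b' = b"
  unfolding NI_def by (metis linorder_neqE)

text \<open>Converse of \<open>NI_children\<close>: every net interval of positive level sits inside
  one unit cell \<open>c\<close> of the previous level. The later case distinctions on net intervals
  go back to this disjunction.\<close>

lemma NI_cases:
  assumes "NI (Suc n) a b"
  obtains c where "0 \<le> c" "c < 3 * 4 ^ n"
    "(a = 4 * c \<and> b = 4 * c + 1) \<or> (a = 4 * c + 3 \<and> b = 4 * c + 4) \<or>
     ((c \<in> E n \<or> c - 1 \<in> E n) \<and> a = 4 * c + 1 \<and> b = 4 * c + 2) \<or>
     ((c \<in> E n \<or> c - 1 \<in> E n) \<and> a = 4 * c + 2 \<and> b = 4 * c + 3) \<or>
     (c \<notin> E n \<and> c - 1 \<notin> E n \<and> a = 4 * c + 1 \<and> b = 4 * c + 3)"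
proof -
  define c where "c = a div 4"
  have ab: "a \<in> P (Suc n)" "b \<in> P (Suc n)" "a < b" using assms by (auto simp: NI_def)
  with P_range[of a "Suc n"] P_range[of b "Suc n"] have r: "0 \<le> a" "a < 12 * 4 ^ n" by auto
  then have c: "0 \<le> c" "c < 3 * 4 ^ n" using div4_range[of a n] by (simp_all add: c_def)
  have "a = 4 * c \<or> a = 4 * c + 1 \<or> a = 4 * c + 2 \<or> a = 4 * c + 3"
    unfolding c_def by presburger
  moreover have "c \<in> E n \<or> c - 1 \<in> E n" if "a = 4 * c + 2"
    using that ab(1) P_Suc_iff(3)[OF c] by simp
  ultimately show thesis
    using NI_children[OF c] NI_unique_right[OF assms] by (intro that[OF c]) metis
qed

section \<open>Reduced characteristic vectors and neighbours\<close>

lemma interval_of_subset_iff: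
  "a < b \<Longrightarrow> interval_of (pt n a, pt n b) \<subseteq> {pt n c..pt n e} \<longleftrightarrow> c \<le> a \<and> b \<le> e"
  by (simp add: interval_of_def)

text \<open>The cylinder \<open>[e, e + 3]\<close> contains \<open>[a, b]\<close> iff
  \<open>b - 3 \<le> e\<close> and \<open>e \<le> a\<close>, and its normalised offset is
  \<open>(a - e) / 3\<close>.\<close>

lemma reduced_vector_eq:
  assumes "a < b"
  shows "reduced_vector n (pt n a, pt n b) =
    (of_int (b - a) / 3,
     sorted_list_of_set ((\<lambda>e. of_int (a - e) / 3) ` {e \<in> E n. b - 3 \<le> e \<and> e \<le> a}))"
proof -
  have img: "S_word \<sigma> ` {0..1} = {pt n (code \<sigma>)..pt n (code \<sigma> + 3)}" if "\<sigma> \<in> words n" for \<sigma>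
  proof -
    have "S_word \<sigma> = (\<lambda>x. (1 / 4 ^ n) * x + pt n (code \<sigma>))"
      by (rule ext) (simp add: S_word_eq[OF that] pt_def field_simps)
    then have "S_word \<sigma> ` {0..1} = {pt n (code \<sigma>)..1 / 4 ^ n + pt n (code \<sigma>)}"
      using image_affinity_atLeastAtMost[of "1 / 4 ^ n" "pt n (code \<sigma>)" 0 1] by simp
    also have "1 / 4 ^ n + pt n (code \<sigma>) = pt n (code \<sigma> + 3)"
      by (simp add: pt_def field_simps)
    finally show ?thesis .
  qed
  have diff: "4 ^ n * (pt n k - pt n l) = of_int (k - l) / 3" for k l
    by (simp add: pt_def field_simps)
  have "{4 ^ n * (fst (pt n a, pt n b) - S_word \<sigma> 0) |\<sigma>. \<sigma> \<in> words n \<and>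
      interval_of (pt n a, pt n b) \<subseteq> S_word \<sigma> ` {0..1}} =
    (\<lambda>e. of_int (a - e) / 3) ` {e \<in> code ` words n. b - 3 \<le> e \<and> e \<le> a}"
    (is "?A = ?B")
  proof -
    have "?A = (\<lambda>\<sigma>. of_int (a - code \<sigma>) / 3) ` {\<sigma> \<in> words n. b - 3 \<le> code \<sigma> \<and> code \<sigma> \<le> a}"
    proof -
      have iff: "\<sigma> \<in> words n \<and> interval_of (pt n a, pt n b) \<subseteq> S_word \<sigma> ` {0..1} \<longleftrightarrow>
        \<sigma> \<in> words n \<and> b - 3 \<le> code \<sigma> \<and> code \<sigma> \<le> a" for \<sigma>
      proof (cases "\<sigma> \<in> words n")
        case True
        show ?thesis unfolding img[OF True] interval_of_subset_iff[OF assms] by auto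
      qed simp
      show ?thesis
        unfolding iff setcompr_eq_image
        by (rule image_cong[OF refl]) (metis S_word_0 diff fst_conv mem_Collect_eq)
    qed
    also have "\<dots> = ?B" by auto
    finally show ?thesis .
  qed
  then show ?thesis
    unfolding reduced_vector_def by (simp only: code_image diff fst_conv snd_conv)
qed

lemma vector_number_table:
  assumes "k \<in> {1..7}"
  shows "vector_number (vector_table ! (k - 1)) = k"
proof -
  have "\<exists>!l. l \<in> {1..7} \<and> vector_table ! (l - 1) = vector_table ! (k - 1)"
  proof (rule ex1I[of _ k])
    fix l assume l: "l \<in> {1..7} \<and> vector_table ! (l - 1) = vector_table ! (k - 1)"
    have "distinct vector_table" by (simp add: vector_table_def)
    moreover have "l - 1 < length vector_table" "k - 1 < length vector_table"
      using l assms by (auto simp: vector_table_def)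
    ultimately have "l - 1 = k - 1" using l by (simp add: nth_eq_iff_index_eq)
    then show "l = k" using l assms by auto
  qed (use assms in simp)
  then show ?thesis
    unfolding vector_number_def by (rule the1_equality) (use assms in simp)
qed

lemma number_of_eqI:
  assumes "k \<in> {1..7}" "a < b" "vector_table ! (k - 1) = (l, vs)"
    "of_int (b - a) / 3 = l" "sorted_wrt (<) vs"
    "{e \<in> E n. b - 3 \<le> e \<and> e \<le> a} = A" "(\<lambda>e. of_int (a - e) / 3) ` A = set vs"
  shows "number_of n (pt n a, pt n b) = k"
proof -
  have "sorted_list_of_set (set vs) = vs"
    using assms(5) by (metis sorted_list_of_set.idem_if_sorted_distinct strict_sorted_iff)
  then have "reduced_vector n (pt n a, pt n b) = vector_table ! (k - 1)"
    using assms by (simp add: reduced_vector_eq)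
  then show ?thesis using vector_number_table[OF assms(1)] by (simp add: number_of_def)
qed

lemma number_of_level_0: "number_of 0 (pt 0 0, pt 0 3) = 1"
  by (rule number_of_eqI[where l = 1 and vs = "[0]" and A = "{0}"])
    (auto simp: vector_table_def)

lemma number_of_unitI:
  assumes "k \<in> {1..7}" "vector_table ! (k - 1) = (1 / 3, vs)" "sorted_wrt (<) vs"
    "{e. (e = a \<or> e = a - 1 \<or> e = a - 2) \<and> e \<in> E n} = A"
    "(\<lambda>e. of_int (a - e) / 3) ` A = set vs"
  shows "number_of n (pt n a, pt n (a + 1)) = k"
proof (rule number_of_eqI[OF assms(1) _ assms(2) _ assms(3) _ assms(5)])
  show "{e \<in> E n. a + 1 - 3 \<le> e \<and> e \<le> a} = A"
    unfolding assms(4)[symmetric] by auto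
qed simp_all

text \<open>Only the cylinders with codes \<open>a\<close>, \<open>a - 1\<close>,
  \<open>a - 2\<close> can cover the cell \<open>a\<close>. The five patterns treated are the ones
  that occur among children, as \<open>number_of_children\<close> shows.\<close>

lemma number_of_unit:
  fixes n a
  defines "N \<equiv> number_of n (pt n a, pt n (a + 1))"
  shows "a \<in> E n \<Longrightarrow> a - 1 \<notin> E n \<Longrightarrow> a - 2 \<notin> E n \<Longrightarrow> N = 2"
    "a \<in> E n \<Longrightarrow> a - 1 \<in> E n \<Longrightarrow> a - 2 \<notin> E n \<Longrightarrow> N = 3"
    "a \<in> E n \<Longrightarrow> a - 1 \<in> E n \<Longrightarrow> a - 2 \<in> E n \<Longrightarrow> N = 4"
    "a \<notin> E n \<Longrightarrow> a - 1 \<in> E n \<Longrightarrow> a - 2 \<in> E n \<Longrightarrow> N = 5"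
    "a \<notin> E n \<Longrightarrow> a - 1 \<notin> E n \<Longrightarrow> a - 2 \<in> E n \<Longrightarrow> N = 6"
proof -
  show "N = 2" if "a \<in> E n" "a - 1 \<notin> E n" "a - 2 \<notin> E n"
    unfolding N_def
    by (rule number_of_unitI[where vs = "[0]" and A = "{a}"])
      (use that in \<open>auto simp: vector_table_def\<close>)
  show "N = 3" if "a \<in> E n" "a - 1 \<in> E n" "a - 2 \<notin> E n"
    unfolding N_def
    by (rule number_of_unitI[where vs = "[0, 1/3]" and A = "{a, a - 1}"])
      (use that in \<open>auto simp: vector_table_def\<close>)
  show "N = 4" if "a \<in> E n" "a - 1 \<in> E n" "a - 2 \<in> E n"
    unfolding N_def
    by (rule number_of_unitI[where vs = "[0, 1/3, 2/3]" and A = "{a, a - 1, a - 2}"])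
      (use that in \<open>auto simp: vector_table_def\<close>)
  show "N = 5" if "a \<notin> E n" "a - 1 \<in> E n" "a - 2 \<in> E n"
    unfolding N_def
    by (rule number_of_unitI[where vs = "[1/3, 2/3]" and A = "{a - 1, a - 2}"])
      (use that in \<open>auto simp: vector_table_def\<close>)
  show "N = 6" if "a \<notin> E n" "a - 1 \<notin> E n" "a - 2 \<in> E n"
    unfolding N_def
    by (rule number_of_unitI[where vs = "[2/3]" and A = "{a - 2}"])
      (use that in \<open>auto simp: vector_table_def\<close>)
qed

lemma number_of_double:
  assumes "a \<in> E n" "a - 1 \<in> E n"
  shows "number_of n (pt n a, pt n (a + 2)) = 7"
  by (rule number_of_eqI[where l = "2/3" and vs = "[0,1/3]" and A = "{a, a - 1}"])
    (use assms in \<open>auto simp: vector_table_def\<close>)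

text \<open>\<open>number_of\<close> makes sense for any pair of grid points, so these formulas hold
  without asking whether the pair is a net interval; that question is answered by
  \<open>NI_children\<close>.\<close>

lemma number_of_children:
  assumes "0 \<le> c" "c < 3 * 4 ^ n"
  shows "number_of (Suc n) (pt (Suc n) (4 * c), pt (Suc n) (4 * c + 1)) =
      (if c - 1 \<in> E n then 4 else 2)"
    "number_of (Suc n) (pt (Suc n) (4 * c + 1), pt (Suc n) (4 * c + 2)) =
      (if c - 1 \<in> E n then 4 else 3)"
    "number_of (Suc n) (pt (Suc n) (4 * c + 2), pt (Suc n) (4 * c + 3)) =
      (if c \<in> E n then 4 else 5)"
    "number_of (Suc n) (pt (Suc n) (4 * c + 3), pt (Suc n) (4 * c + 4)) =
      (if c \<in> E n then 4 else 6)"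
    "number_of (Suc n) (pt (Suc n) (4 * c + 1), pt (Suc n) (4 * c + 3)) = 7"
proof -
  have eqs: "4 * c + 1 + 1 = 4 * c + 2" "4 * c + 2 + 1 = 4 * c + 3" "4 * c + 3 + 1 = 4 * c + 4"
    "4 * c + 1 + 2 = 4 * c + 3" "4 * c + 1 - 1 = 4 * c" "4 * c + 1 - 2 = 4 * c - 1"
    "4 * c + 2 - 1 = 4 * c + 1" "4 * c + 2 - 2 = 4 * c"
    "4 * c + 3 - 1 = 4 * c + 2" "4 * c + 3 - 2 = 4 * c + 1"
    by simp_all
  note E = E_Suc_iff[OF assms] E_Suc_pred[OF assms]
  show "number_of (Suc n) (pt (Suc n) (4 * c), pt (Suc n) (4 * c + 1)) =
      (if c - 1 \<in> E n then 4 else 2)"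
    using number_of_unit(1,3)[of "4 * c" "Suc n"] E unfolding eqs by simp
  show "number_of (Suc n) (pt (Suc n) (4 * c + 1), pt (Suc n) (4 * c + 2)) =
      (if c - 1 \<in> E n then 4 else 3)"
    using number_of_unit(2,3)[of "4 * c + 1" "Suc n"] E unfolding eqs by simp
  show "number_of (Suc n) (pt (Suc n) (4 * c + 2), pt (Suc n) (4 * c + 3)) =
      (if c \<in> E n then 4 else 5)"
    using number_of_unit(3,4)[of "4 * c + 2" "Suc n"] E unfolding eqs by simp
  show "number_of (Suc n) (pt (Suc n) (4 * c + 3), pt (Suc n) (4 * c + 4)) =
      (if c \<in> E n then 4 else 6)"
    using number_of_unit(3,5)[of "4 * c + 3" "Suc n"] E unfolding eqs by simp
  show "number_of (Suc n) (pt (Suc n) (4 * c + 1), pt (Suc n) (4 * c + 3)) = 7"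
    using number_of_double[of "4 * c + 1" "Suc n"] E unfolding eqs by simp
qed

lemma left_number_eq:
  assumes "NI n a0 a"
  shows "left_number n (pt n a, y) = Some (number_of n (pt n a0, pt n a))"
proof -
  have "(THE \<Delta>. \<Delta> \<in> net_intervals n \<and> snd \<Delta> = pt n a) = (pt n a0, pt n a)"
  proof (rule the_equality)
    fix \<Delta> assume \<Delta>: "\<Delta> \<in> net_intervals n \<and> snd \<Delta> = pt n a"
    then obtain a1 b1 where "\<Delta> = (pt n a1, pt n b1)" "NI n a1 b1"
      unfolding net_intervals_eq by blast
    with \<Delta> show "\<Delta> = (pt n a0, pt n a)" using NI_unique_left[OF assms, of a1] by simp
  qed (simp add: assms)
  moreover have "\<exists>c. (c, pt n a) \<in> net_intervals n" using assms net_intervals_iff by blast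
  ultimately show ?thesis by (simp add: left_number_def)
qed

lemma right_number_eq:
  assumes "NI n b b0"
  shows "right_number n (x, pt n b) = Some (number_of n (pt n b, pt n b0))"
proof -
  have "(THE \<Delta>. \<Delta> \<in> net_intervals n \<and> fst \<Delta> = pt n b) = (pt n b, pt n b0)"
  proof (rule the_equality)
    fix \<Delta> assume \<Delta>: "\<Delta> \<in> net_intervals n \<and> fst \<Delta> = pt n b"
    then obtain a1 b1 where "\<Delta> = (pt n a1, pt n b1)" "NI n a1 b1"
      unfolding net_intervals_eq by blast
    with \<Delta> show "\<Delta> = (pt n b, pt n b0)" using NI_unique_right[OF assms, of b1] by simp
  qed (simp add: assms)
  moreover have "\<exists>c. (pt n b, c) \<in> net_intervals n" using assms net_intervals_iff by blast
  ultimately show ?thesis by (simp add: right_number_def)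
qed

lemma left_number_None: "left_number n (pt n 0, y) = None"
proof -
  have "\<not> NI n a 0" for a using P_range[of a n] unfolding NI_def by linarith
  then have "(c, pt n 0) \<notin> net_intervals n" for c
    by (auto simp only: net_intervals_eq mem_Collect_eq prod.inject pt_eq)
  then show ?thesis by (simp add: left_number_def)
qed

lemma right_number_None: "right_number n (x, pt n (3 * 4 ^ n)) = None"
proof -
  have "\<not> NI n (3 * 4 ^ n) b" for b using P_range[of b n] unfolding NI_def by linarith
  then have "(pt n (3 * 4 ^ n), c) \<notin> net_intervals n" for c
    by (auto simp only: net_intervals_eq mem_Collect_eq prod.inject pt_eq)
  then show ?thesis by (simp add: right_number_def)
qed

section \<open>Triples and loop classes\<close>

text \<open>The neighbour is the last child of the cell \<open>c - 1\<close>, which is a unit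
  interval in every case, so that only the code status of \<open>c - 1\<close> enters.\<close>

lemma left_number_first_child:
  assumes "0 \<le> c" "c < 3 * 4 ^ n"
  shows "left_number (Suc n) (pt (Suc n) (4 * c), y) =
    (if c = 0 then None else if c - 1 \<in> E n then Some 4 else Some 6)"
proof (cases "c = 0")
  case True
  then show ?thesis using left_number_None[of "Suc n"] by simp
next
  case False
  with assms have c: "0 \<le> c - 1" "c - 1 < 3 * 4 ^ n" by simp_all
  have eq: "4 * (c - 1) + 4 = 4 * c" by simp
  show ?thesis
    using left_number_eq[OF NI_children(2)[OF c]] number_of_children(4)[OF c] False
    unfolding eq by simp
qed

lemma right_number_last_child:
  assumes "0 \<le> c" "c < 3 * 4 ^ n"
  shows "right_number (Suc n) (x, pt (Suc n) (4 * c + 4)) =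
    (if c + 1 = 3 * 4 ^ n then None else if c \<in> E n then Some 4 else Some 2)"
proof (cases "c + 1 = 3 * 4 ^ n")
  case True
  then have eq: "4 * c + 4 = 3 * 4 ^ Suc n" by simp
  show ?thesis unfolding eq right_number_None using True by simp
next
  case False
  with assms have c: "0 \<le> c + 1" "c + 1 < 3 * 4 ^ n" by simp_all
  have eq: "4 * (c + 1) = 4 * c + 4" "c + 1 - 1 = c" by simp_all
  show ?thesis
    using right_number_eq[OF NI_children(1)[OF c]] number_of_children(1)[OF c] False
    unfolding eq by simp
qed

text \<open>If \<open>c\<close> and \<open>c - 1\<close> are codes, all four children carry the
  essential triple. If \<open>c\<close> is not a code, the children that end in a non-code cell
  carry the four triples of \<open>LL\<close>, except that \<open>R\<close> is \<open>None\<close>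
  at the right end of [0, 1].\<close>

lemma triple_of_children:
  assumes "0 \<le> c" "c < 3 * 4 ^ n"
  defines "L \<equiv> (if c = 0 then None else if c - 1 \<in> E n then Some 4 else Some 6) :: nat option"
    and "R \<equiv> (if c + 1 = 3 * 4 ^ n then None else if c \<in> E n then Some 4 else Some 2) :: nat option"
    and "T \<equiv> \<lambda>a b. triple_of (Suc n) (pt (Suc n) a, pt (Suc n) b)"
  shows "c \<in> E n \<Longrightarrow> c - 1 \<in> E n \<Longrightarrow> T (4 * c) (4 * c + 1) = (Some 4, 4, Some 4)"
    "c \<in> E n \<Longrightarrow> c - 1 \<in> E n \<Longrightarrow> T (4 * c + 1) (4 * c + 2) = (Some 4, 4, Some 4)"
    "c \<in> E n \<Longrightarrow> c - 1 \<in> E n \<Longrightarrow> T (4 * c + 2) (4 * c + 3) = (Some 4, 4, Some 4)"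
    "c \<in> E n \<Longrightarrow> c - 1 \<in> E n \<Longrightarrow> T (4 * c + 3) (4 * c + 4) = (Some 4, 4, Some 4)"
    "c \<notin> E n \<Longrightarrow> c - 1 \<in> E n \<Longrightarrow> T (4 * c + 2) (4 * c + 3) = (Some 4, 5, Some 6)"
    "c \<notin> E n \<Longrightarrow> c - 1 \<in> E n \<Longrightarrow> T (4 * c + 3) (4 * c + 4) = (Some 5, 6, R)"
    "c \<notin> E n \<Longrightarrow> c - 1 \<notin> E n \<Longrightarrow> T (4 * c + 1) (4 * c + 3) = (Some 2, 7, Some 6)"
    "c \<notin> E n \<Longrightarrow> c - 1 \<notin> E n \<Longrightarrow> T (4 * c + 3) (4 * c + 4) = (Some 7, 6, R)"
proof -
  note N = number_of_children[OF assms(1,2)] and NI = NI_children[OF assms(1,2)]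
  note F = left_number_first_child[OF assms(1,2), folded L_def]
    and G = right_number_last_child[OF assms(1,2), folded R_def]
  have L4: "L = Some 4" if "c - 1 \<in> E n" using that negative_not_code[of "c - 1" n] by (auto simp: L_def)
  have R4: "R = Some 4" if "c \<in> E n" using that E_range[of c n] by (auto simp: R_def)
  note defs = T_def triple_of_def
  {
    assume c: "c \<in> E n" "c - 1 \<in> E n"
    note NI' = NI(1,2) NI(3,4)[OF disjI1[OF c(1)]]
    show "T (4 * c) (4 * c + 1) = (Some 4, 4, Some 4)"
      unfolding defs F right_number_eq[OF NI'(3)] N using c L4 by simp
    show "T (4 * c + 1) (4 * c + 2) = (Some 4, 4, Some 4)"
      unfolding defs left_number_eq[OF NI'(1)] right_number_eq[OF NI'(4)] N using c by simp
    show "T (4 * c + 2) (4 * c + 3) = (Some 4, 4, Some 4)"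
      unfolding defs left_number_eq[OF NI'(3)] right_number_eq[OF NI'(2)] N using c by simp
    show "T (4 * c + 3) (4 * c + 4) = (Some 4, 4, Some 4)"
      unfolding defs left_number_eq[OF NI'(4)] G N using c R4 by simp
  }
  {
    assume c: "c \<notin> E n" "c - 1 \<in> E n"
    note NI' = NI(1,2) NI(3,4)[OF disjI2[OF c(2)]]
    show "T (4 * c + 2) (4 * c + 3) = (Some 4, 5, Some 6)"
      unfolding defs left_number_eq[OF NI'(3)] right_number_eq[OF NI'(2)] N using c by simp
    show "T (4 * c + 3) (4 * c + 4) = (Some 5, 6, R)"
      unfolding defs left_number_eq[OF NI'(4)] G N using c by simp
  }
  {
    assume c: "c \<notin> E n" "c - 1 \<notin> E n"
    note NI' = NI(1,2) NI(5)[OF c]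
    show "T (4 * c + 1) (4 * c + 3) = (Some 2, 7, Some 6)"
      unfolding defs left_number_eq[OF NI'(1)] right_number_eq[OF NI'(2)] N using c by simp
    show "T (4 * c + 3) (4 * c + 4) = (Some 7, 6, R)"
      unfolding defs left_number_eq[OF NI'(3)] G N using c by simp
  }
qed

lemma triple_of_simps [simp]:
  "fst (triple_of n \<Delta>) = left_number n \<Delta>"
  "fst (snd (triple_of n \<Delta>)) = number_of n \<Delta>"
  "snd (snd (triple_of n \<Delta>)) = right_number n \<Delta>"
  by (simp_all add: triple_of_def)

text \<open>The last unit cell \<open>b - 1\<close> is decisive, and not the first one: an interval
  of two units starts with the code \<open>4 * c + 1\<close> and ends with the non-code
  \<open>4 * c + 2\<close>.\<close>

lemma NI_mem_cases:
  assumes "NI (Suc n) a b"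
  obtains
    (code) "b - 1 \<in> E (Suc n)" "a = b - 1" "number_of (Suc n) (pt (Suc n) a, pt (Suc n) b) \<in> {2, 3, 4}"
  | (gap) "b - 1 \<notin> E (Suc n)" "b < 3 * 4 ^ Suc n" "triple_of (Suc n) (pt (Suc n) a, pt (Suc n) b) \<in> LL"
  | (last) "b - 1 \<notin> E (Suc n)" "b = 3 * 4 ^ Suc n" "right_number (Suc n) (pt (Suc n) a, pt (Suc n) b) = None"
      "number_of (Suc n) (pt (Suc n) a, pt (Suc n) b) \<notin> {2, 3, 4}"
proof -
  obtain c where c: "0 \<le> c" "c < 3 * 4 ^ n" and alt:
    "(a = 4 * c \<and> b = 4 * c + 1) \<or> (a = 4 * c + 3 \<and> b = 4 * c + 4) \<or>
     ((c \<in> E n \<or> c - 1 \<in> E n) \<and> a = 4 * c + 1 \<and> b = 4 * c + 2) \<or>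
     ((c \<in> E n \<or> c - 1 \<in> E n) \<and> a = 4 * c + 2 \<and> b = 4 * c + 3) \<or>
     (c \<notin> E n \<and> c - 1 \<notin> E n \<and> a = 4 * c + 1 \<and> b = 4 * c + 3)"
    using assms by (rule NI_cases)
  note N = number_of_children[OF c] and T = triple_of_children[OF c] and E = E_Suc_iff[OF c]
  have eqs: "4 * c + 1 - 1 = 4 * c" "4 * c + 2 - 1 = 4 * c + 1" "4 * c + 3 - 1 = 4 * c + 2"
    "4 * c + 4 - 1 = 4 * c + 3" by simp_all
  have lt: "4 * c + 3 < 3 * 4 ^ Suc n" "4 * c + 4 \<le> 3 * 4 ^ Suc n"
    "4 * c + 4 = 3 * 4 ^ Suc n \<longleftrightarrow> c + 1 = 3 * 4 ^ n" using c by auto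
  from alt consider
      "a = 4 * c" "b = 4 * c + 1" | "a = 4 * c + 3" "b = 4 * c + 4" "c \<in> E n"
    | "a = 4 * c + 3" "b = 4 * c + 4" "c \<notin> E n" "c + 1 \<noteq> 3 * 4 ^ n"
    | "a = 4 * c + 3" "b = 4 * c + 4" "c \<notin> E n" "c + 1 = 3 * 4 ^ n"
    | "a = 4 * c + 1" "b = 4 * c + 2"
    | "a = 4 * c + 2" "b = 4 * c + 3" "c \<in> E n"
    | "a = 4 * c + 2" "b = 4 * c + 3" "c \<notin> E n" "c - 1 \<in> E n"
    | "c \<notin> E n" "c - 1 \<notin> E n" "a = 4 * c + 1" "b = 4 * c + 3"
    by (atomize_elim, sat)
  then show thesis
  proof cases
    case 1
    with N E show ?thesis by (intro code) auto
  next
    case 2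
    with N(4) E(4) eqs(4) show ?thesis by (intro code) (auto simp: add.commute)
  next
    case 3
    have "triple_of (Suc n) (pt (Suc n) a, pt (Suc n) b) \<in> LL"
      using T(6,8) 3 by (cases "c - 1 \<in> E n") (simp_all add: LL_def)
    with E(4) lt 3 show ?thesis unfolding 3(2) eqs by (intro gap) (auto simp: 3(2) eqs)
  next
    case 4
    have "b - 1 \<notin> E (Suc n)" using E(4) 4 unfolding 4(2) eqs by simp
    moreover have "b = 3 * 4 ^ Suc n" using lt 4 by simp
    moreover have "right_number (Suc n) (pt (Suc n) a, pt (Suc n) b) = None"
      using right_number_last_child[OF c] 4 by simp
    ultimately show ?thesis using N(4) 4(1-3) by (intro last) (simp_all add: add.commute)
  next
    case 5
    with N(2) E(2) eqs(2) show ?thesis by (intro code) (auto simp: add.commute)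
  next
    case 6
    with N(3) E(3) eqs(3) show ?thesis by (intro code) (auto simp: add.commute)
  next
    case 7
    then have "triple_of (Suc n) (pt (Suc n) a, pt (Suc n) b) \<in> LL"
      using T(5) by (simp add: LL_def)
    with E(3) lt 7 show ?thesis by (intro gap) (auto simp: 7(2) eqs)
  next
    case 8
    then have "triple_of (Suc n) (pt (Suc n) a, pt (Suc n) b) \<in> LL"
      using T(7) by (simp add: LL_def)
    with E(3) lt 8 show ?thesis by (intro gap) (auto simp: 8(4) eqs)
  qed
qed

lemma NI_0_iff: "NI 0 a b \<longleftrightarrow> a = 0 \<and> b = 3"
  by (auto simp: NI_def P_iff)

lemma number_of_LL: "triple_of n \<Delta> \<in> LL \<Longrightarrow> number_of n \<Delta> \<in> {5, 6, 7}"
  and right_number_LL: "triple_of n \<Delta> \<in> LL \<Longrightarrow> right_number n \<Delta> \<noteq> None"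
  by (auto simp: LL_def triple_of_def)

lemma triple_LL_iff:
  assumes "NI (Suc n) a b"
  shows "triple_of (Suc n) (pt (Suc n) a, pt (Suc n) b) \<in> LL \<longleftrightarrow>
    b - 1 \<notin> E (Suc n) \<and> b < 3 * 4 ^ Suc n"
  using assms
proof (cases rule: NI_mem_cases)
  case code
  then show ?thesis using number_of_LL by fastforce
next
  case last
  then show ?thesis using right_number_LL by blast
qed auto

lemma number_of_code_iff:
  assumes "NI (Suc n) a b"
  shows "number_of (Suc n) (pt (Suc n) a, pt (Suc n) b) \<in> {2, 3, 4} \<longleftrightarrow> b - 1 \<in> E (Suc n)"
  using assms
proof (cases rule: NI_mem_cases)
  case gap
  then show ?thesis using number_of_LL by fastforce
qed auto

lemma LL_level: "NI n a b \<Longrightarrow> triple_of n (pt n a, pt n b) \<in> LL \<Longrightarrow> n \<noteq> 0"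
  using number_of_LL[of n "(pt n a, pt n b)"] number_of_level_0
  by (cases "n = 0") (auto simp: NI_0_iff)

lemma is_child_pt:
  "is_child n (pt n a, pt n b) (pt (Suc n) a', pt (Suc n) b') \<longleftrightarrow>
    NI n a b \<and> NI (Suc n) a' b' \<and> 4 * a \<le> a' \<and> b' \<le> 4 * b"
proof (cases "NI (Suc n) a' b'")
  case True
  then have "a' < b'" by (simp add: NI_def)
  then show ?thesis
    using interval_of_subset_iff[of a' b' "Suc n" "4 * a" "4 * b"]
    by (auto simp: is_child_def interval_of_def[of "(pt n a, pt n b)"] pt_Suc)
qed (simp add: is_child_def)

lemma triple_edgeE:
  assumes "triple_edge t t'"
  obtains n a b a' b' where "NI n a b" "NI (Suc n) a' b'" "4 * a \<le> a'" "b' \<le> 4 * b"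
    "t = triple_of n (pt n a, pt n b)" "t' = triple_of (Suc n) (pt (Suc n) a', pt (Suc n) b')"
proof -
  obtain n \<Delta> \<Delta>' where *: "is_child n \<Delta> \<Delta>'" "triple_of n \<Delta> = t" "triple_of (Suc n) \<Delta>' = t'"
    using assms by (auto simp: triple_edge_def)
  then obtain a b a' b' where "\<Delta> = (pt n a, pt n b)" "\<Delta>' = (pt (Suc n) a', pt (Suc n) b')"
    unfolding is_child_def net_intervals_eq by blast
  with * that show thesis by (auto simp: is_child_pt)
qed

lemma triple_edgeI:
  assumes "NI n a b" "NI (Suc n) a' b'" "4 * a \<le> a'" "b' \<le> 4 * b"
  shows "triple_edge (triple_of n (pt n a, pt n b)) (triple_of (Suc n) (pt (Suc n) a', pt (Suc n) b'))"
  using assms unfolding triple_edge_def by (metis is_child_pt)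

text \<open>This is why a path that leaves the loop class never returns.\<close>

lemma code_closed:
  assumes "b - 1 \<in> E n" "4 * (b - 1) \<le> a'" "a' < b'" "b' \<le> 4 * b"
  shows "b' - 1 \<in> E (Suc n)"
proof -
  define c where "c = b - 1"
  have c: "c \<in> E n" "0 \<le> c" "c < 3 * 4 ^ n"
    using assms(1) E_range[of c n] by (simp_all add: c_def)
  have "b' - 1 = 4 * c \<or> b' - 1 = 4 * c + 1 \<or> b' - 1 = 4 * c + 2 \<or> b' - 1 = 4 * c + 3"
    using assms(2-4) unfolding c_def by presburger
  then show ?thesis using E_Suc_iff[OF c(2,3)] c(1) by metis
qed

text \<open>The numbers 2, 3, 4 are the vectors of length 1/3 with offset 0, so the interval is a
  single cell that is itself a code. By \<open>code_closed\<close> this is inherited by every child,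
  which makes these numbers a trap.\<close>

lemma edge_code:
  assumes "triple_edge t t'" "fst (snd t) \<in> {2, 3, 4}"
  shows "fst (snd t') \<in> {2, 3, 4}"
proof -
  obtain n a b a' b' where *: "NI n a b" "NI (Suc n) a' b'" "4 * a \<le> a'" "b' \<le> 4 * b"
    "t = triple_of n (pt n a, pt n b)" "t' = triple_of (Suc n) (pt (Suc n) a', pt (Suc n) b')"
    using triple_edgeE[OF assms(1)] .
  have "n \<noteq> 0" using *(1,5) assms(2) number_of_level_0 by (cases n) (auto simp: NI_0_iff)
  then obtain k where k: "n = Suc k" by (cases n) auto
  from *(1) k have "NI (Suc k) a b" by simp
  then have "b - 1 \<in> E n \<and> a = b - 1"
  proof (cases rule: NI_mem_cases)
    case gap
    then show ?thesis using assms(2) number_of_LL[of "Suc k"] unfolding *(5) k by fastforce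
  next
    case last
    then show ?thesis using assms(2) unfolding *(5) k by simp
  qed (simp add: k)
  then have "b' - 1 \<in> E (Suc n)" using code_closed[of b n a' b'] *(2-4) by (simp add: NI_def)
  then show ?thesis using number_of_code_iff[OF *(2)] *(6) by simp
qed

text \<open>A triple in \<open>LL\<close> keeps the right end of the interval strictly below 1, and
  children inherit this. So the case \<open>last\<close> of \<open>NI_mem_cases\<close> cannot
  arise, and only \<open>gap\<close> and \<open>code\<close> remain.\<close>

lemma edge_LL:
  assumes "triple_edge t t'" "t \<in> LL"
  shows "t' \<in> LL \<or> fst (snd t') \<in> {2, 3, 4}"
proof -
  obtain n a b a' b' where *: "NI n a b" "NI (Suc n) a' b'" "4 * a \<le> a'" "b' \<le> 4 * b"
    "t = triple_of n (pt n a, pt n b)" "t' = triple_of (Suc n) (pt (Suc n) a', pt (Suc n) b')"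
    using triple_edgeE[OF assms(1)] .
  have "n \<noteq> 0" using LL_level *(1,5) assms(2) by blast
  then obtain k where k: "n = Suc k" by (cases n) auto
  have "b < 3 * 4 ^ n" using triple_LL_iff[of k a b] assms(2) *(1,5) by (simp add: k)
  then have "b' < 3 * 4 ^ Suc n" using *(4) by simp
  with *(2) show ?thesis unfolding *(6) by (cases rule: NI_mem_cases) auto
qed

text \<open>The four edges form a cycle, which is all that strong connectivity needs. The witnesses
  are found below the unit cells 1 and 2 of level 0, the two that are not codes: only the
  predecessor of cell 1 is a code, which gives the triples with middle number 5 and 6, while cell 2
  gives the one with middle number 7.\<close>

lemma LL_edges:
  "triple_edge (Some 2, 7, Some 6) (Some 4, 5, Some 6)"
  "triple_edge (Some 4, 5, Some 6) (Some 5, 6, Some 2)"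
  "triple_edge (Some 5, 6, Some 2) (Some 7, 6, Some 2)"
  "triple_edge (Some 7, 6, Some 2) (Some 2, 7, Some 6)"
proof -
  have E1: "10 \<notin> E 1" "9 \<in> E 1" "7 \<notin> E 1" "6 \<notin> E 1"
    using E_Suc_iff[of 2 0] E_Suc_iff[of 1 0] by auto
  then have E2: "30 \<notin> E 2" "31 \<notin> E 2"
    using E_Suc_iff[of 7 1] by (auto simp: numeral_2_eq_2)
  show "triple_edge (Some 2, 7, Some 6) (Some 4, 5, Some 6)"
    using triple_edgeI[of 1 9 11 42 43] NI_children(5)[of 2 0] NI_children(4)[of 10 1]
      triple_of_children(7)[of 2 0] triple_of_children(5)[of 10 1] E1
    by simp
  show "triple_edge (Some 4, 5, Some 6) (Some 5, 6, Some 2)"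
    using triple_edgeI[of 1 6 7 27 28] NI_children(4)[of 1 0] NI_children(2)[of 6 1]
      triple_of_children(5)[of 1 0] triple_of_children(6)[of 6 1] E_Suc_iff[of 1 0] E1
    by simp
  show "triple_edge (Some 5, 6, Some 2) (Some 7, 6, Some 2)"
    using triple_edgeI[of 1 7 8 31 32] NI_children(2)[of 1 0] NI_children(2)[of 7 1]
      triple_of_children(6)[of 1 0] triple_of_children(8)[of 7 1] E_Suc_iff[of 1 0] E1
    by simp
  show "triple_edge (Some 7, 6, Some 2) (Some 2, 7, Some 6)"
    using triple_edgeI[of 2 31 32 125 127] NI_children(2)[of 7 1] NI_children(5)[of 31 2]
      triple_of_children(8)[of 7 1] triple_of_children(7)[of 31 2] E1 E2
    by (simp add: numeral_2_eq_2)
qed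

lemma loop_class_LL: "loop_class LL"
proof -
  define r where "r = (\<lambda>s s'. s \<in> LL \<and> s' \<in> LL \<and> triple_edge s s')"
  define t1 t2 t3 t4 :: triple where t: "t1 = (Some 2, 7, Some 6)" "t2 = (Some 4, 5, Some 6)"
    "t3 = (Some 5, 6, Some 2)" "t4 = (Some 7, 6, Some 2)"
  have LL: "LL = {t1, t2, t3, t4}" by (auto simp: LL_def t)
  have "r\<^sup>+\<^sup>+ t1 t2" "r\<^sup>+\<^sup>+ t2 t3" "r\<^sup>+\<^sup>+ t3 t4" "r\<^sup>+\<^sup>+ t4 t1"
    using LL_edges by (auto intro!: tranclp.r_into_trancl simp: r_def LL t)
  then have "r\<^sup>+\<^sup>+ s s'" if "s \<in> LL" "s' \<in> LL" for s s'
    using that tranclp_trans[of r] unfolding LL by blast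
  then show ?thesis unfolding loop_class_def r_def LL by blast
qed

text \<open>In a larger loop class some triple outside \<open>LL\<close> would be reachable from
  \<open>LL\<close>. By \<open>edge_LL\<close> it has fallen into the trap of
  \<open>edge_code\<close>, and so it cannot lead back to \<open>s0\<close>, whose number is
  7.\<close>

lemma maximal_loop_class_LL: "maximal_loop_class LL"
  unfolding maximal_loop_class_def
proof (intro conjI allI impI notI)
  fix L assume L: "loop_class L" "LL \<subset> L"
  then obtain t0 where t0: "t0 \<in> L" "t0 \<notin> LL" by blast
  define s0 :: triple where "s0 = (Some 2, 7, Some 6)"
  have s0: "s0 \<in> LL" "s0 \<in> L" using L(2) by (auto simp: LL_def s0_def)
  let ?r = "\<lambda>s s'. s \<in> L \<and> s' \<in> L \<and> triple_edge s s'"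
  have "?r\<^sup>+\<^sup>+ s0 t0" "?r\<^sup>+\<^sup>+ t0 s0" using L(1) t0 s0 unfolding loop_class_def by blast+
  from this(1) have "t0 \<in> LL \<or> fst (snd t0) \<in> {2, 3, 4}"
    by induction (use s0 edge_LL edge_code in blast)+
  with t0 have "fst (snd t0) \<in> {2, 3, 4}" by simp
  moreover from \<open>?r\<^sup>+\<^sup>+ t0 s0\<close> have "fst (snd t0) \<in> {2, 3, 4} \<longrightarrow> fst (snd s0) \<in> {2, 3, 4}"
    by induction (use edge_code in blast)+
  ultimately show False by (simp add: s0_def)
qed (rule loop_class_LL)

section \<open>Uniqueness of the essential class\<close>

lemma number_4_codes:
  assumes "NI n a b" "number_of n (pt n a, pt n b) = 4"
  shows "a \<in> E n" "a - 1 \<in> E n" "b = a + 1"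
proof -
  have "n \<noteq> 0" using assms number_of_level_0 by (cases n) (auto simp: NI_0_iff)
  then obtain k where k: "n = Suc k" by (cases n) auto
  from assms(1) k have NI: "NI (Suc k) a b" by simp
  obtain c where c: "0 \<le> c" "c < 3 * 4 ^ k" and alt:
    "(a = 4 * c \<and> b = 4 * c + 1) \<or> (a = 4 * c + 3 \<and> b = 4 * c + 4) \<or>
     ((c \<in> E k \<or> c - 1 \<in> E k) \<and> a = 4 * c + 1 \<and> b = 4 * c + 2) \<or>
     ((c \<in> E k \<or> c - 1 \<in> E k) \<and> a = 4 * c + 2 \<and> b = 4 * c + 3) \<or>
     (c \<notin> E k \<and> c - 1 \<notin> E k \<and> a = 4 * c + 1 \<and> b = 4 * c + 3)"
    using NI by (rule NI_cases)
  note N = number_of_children[OF c] and E = E_Suc_iff[OF c] E_Suc_pred[OF c]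
  have eqs: "4 * c + 1 - 1 = 4 * c" "4 * c + 2 - 1 = 4 * c + 1" "4 * c + 3 - 1 = 4 * c + 2"
    "4 * c + 1 + 1 = 4 * c + 2" "4 * c + 2 + 1 = 4 * c + 3" "4 * c + 3 + 1 = 4 * c + 4"
    by simp_all
  have num: "number_of (Suc k) (pt (Suc k) a, pt (Suc k) b) = 4" using assms(2) by (simp add: k)
  have "(a = 4 * c \<and> b = 4 * c + 1) \<or> (a = 4 * c + 3 \<and> b = 4 * c + 4) \<or>
     (a = 4 * c + 1 \<and> b = 4 * c + 2) \<or> (a = 4 * c + 2 \<and> b = 4 * c + 3) \<or>
     (a = 4 * c + 1 \<and> b = 4 * c + 3)"
    using alt by sat
  then have "a \<in> E (Suc k) \<and> a - 1 \<in> E (Suc k) \<and> b = a + 1"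
  proof (elim disjE conjE)
    assume ab: "a = 4 * c" "b = 4 * c + 1"
    show ?thesis using num N(1) E unfolding ab by (simp split: if_splits)
  next
    assume ab: "a = 4 * c + 3" "b = 4 * c + 4"
    show ?thesis using num N(4) E unfolding ab eqs by (simp split: if_splits)
  next
    assume ab: "a = 4 * c + 1" "b = 4 * c + 2"
    show ?thesis using num N(2) E unfolding ab eqs by (simp split: if_splits)
  next
    assume ab: "a = 4 * c + 2" "b = 4 * c + 3"
    show ?thesis using num N(3) E unfolding ab eqs by (simp split: if_splits)
  next
    assume ab: "a = 4 * c + 1" "b = 4 * c + 3"
    show ?thesis using num N(5) E unfolding ab eqs by simp
  qed
  then show "a \<in> E n" "a - 1 \<in> E n" "b = a + 1" by (simp_all add: k)
qed

text \<open>Number 4 alone says that both the cell and its predecessor are codes, and this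
  determines the triples of all children whatever the neighbours of the parent are.\<close>

lemma edge_from_4:
  assumes "triple_edge t t'" "fst (snd t) = 4"
  shows "t' = (Some 4, 4, Some 4)"
proof -
  obtain n a b a' b' where *: "NI n a b" "NI (Suc n) a' b'" "4 * a \<le> a'" "b' \<le> 4 * b"
    "t = triple_of n (pt n a, pt n b)" "t' = triple_of (Suc n) (pt (Suc n) a', pt (Suc n) b')"
    using triple_edgeE[OF assms(1)] .
  note a = number_4_codes[OF *(1)]
  have a: "a \<in> E n" "a - 1 \<in> E n" "b = a + 1" using assms(2) *(5) a by simp_all
  have r: "0 \<le> a" "a < 3 * 4 ^ n" using E_range[OF a(1)] by simp_all
  obtain c where c: "0 \<le> c" "c < 3 * 4 ^ n" and alt:
    "(a' = 4 * c \<and> b' = 4 * c + 1) \<or> (a' = 4 * c + 3 \<and> b' = 4 * c + 4) \<or>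
     ((c \<in> E n \<or> c - 1 \<in> E n) \<and> a' = 4 * c + 1 \<and> b' = 4 * c + 2) \<or>
     ((c \<in> E n \<or> c - 1 \<in> E n) \<and> a' = 4 * c + 2 \<and> b' = 4 * c + 3) \<or>
     (c \<notin> E n \<and> c - 1 \<notin> E n \<and> a' = 4 * c + 1 \<and> b' = 4 * c + 3)"
    using *(2) by (rule NI_cases)
  have "4 * c + 1 \<le> b'" "a' \<le> 4 * c + 3" using alt by (elim disjE conjE; linarith)+
  then have ca: "c = a" using *(3,4) a(3) by linarith
  note T = triple_of_children(1-4)[OF r a(1,2)]
  from alt show ?thesis
    unfolding *(6) ca by (elim disjE conjE) (use a(1) T in \<open>simp_all only: simp_thms\<close>)
qed

text \<open>Every net interval has a descendant with number 4 within two levels, and the first child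
  of that one has the essential triple. If the last cell is a code, its child at digit 2 has number
  4; if it is a non-code after a code, its child at digit 0 does; if neither is a code, the middle
  child of two units falls under the previous case.\<close>

lemma reaches_444:
  assumes closed: "\<And>s s'. s \<in> L \<Longrightarrow> triple_edge s s' \<Longrightarrow> s' \<in> L"
    and "NI n a b" "triple_of n (pt n a, pt n b) \<in> L"
  shows "(Some 4, 4, Some 4) \<in> L"
proof -
  have via4: "(Some 4, 4, Some 4) \<in> L"
    if 4: "NI k x y" "number_of k (pt k x, pt k y) = 4" "triple_of k (pt k x, pt k y) \<in> L" for k x y
  proof -
    note x = number_4_codes[OF 4(1,2)]
    have "0 \<le> x" "x < 3 * 4 ^ k" using E_range[OF x(1)] by simp_all
    from triple_edgeI[OF 4(1) NI_children(1)[OF this]] triple_of_children(1)[OF this x(1,2)]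
    have "triple_edge (triple_of k (pt k x, pt k y)) (Some 4, 4, Some 4)" using x(3) by simp
    then show ?thesis using closed 4(3) by blast
  qed
  have via_gap: "(Some 4, 4, Some 4) \<in> L"
    if 7: "NI k x y" "triple_of k (pt k x, pt k y) \<in> L" "x < y" "y - 1 \<notin> E k" "y - 2 \<in> E k"
    for k x y
  proof -
    define c where "c = y - 1"
    have r: "0 \<le> c" "c < 3 * 4 ^ k"
      using 7(1) P_range[of x k] P_range[of y k] by (auto simp: c_def NI_def)
    have "c - 1 \<in> E k" using 7(5) by (simp add: c_def algebra_simps)
    moreover have "triple_edge (triple_of k (pt k x, pt k y))
      (triple_of (Suc k) (pt (Suc k) (4 * c), pt (Suc k) (4 * c + 1)))"
      by (rule triple_edgeI[OF 7(1) NI_children(1)[OF r]]) (use 7(3) in \<open>auto simp: c_def\<close>)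
    ultimately show ?thesis
      using via4[OF NI_children(1)[OF r]] number_of_children(1)[OF r] closed[OF 7(2)] by simp
  qed
  have ab: "a < b" "0 \<le> b - 1" "b - 1 < 3 * 4 ^ n"
    using assms(2) P_range[of a n] P_range[of b n] by (auto simp: NI_def)
  consider "b - 1 \<in> E n" "a = b - 1" | "b - 1 \<notin> E n" "b - 2 \<in> E n"
    | "b - 1 \<notin> E n" "b - 2 \<notin> E n"
  proof (cases n)
    case 0
    then show ?thesis using that assms(2) by (auto simp: NI_0_iff)
  next
    case (Suc k)
    from assms(2)[unfolded Suc] show ?thesis
      by (cases rule: NI_mem_cases) (use that Suc in auto)
  qed
  then show ?thesis
  proof cases
    case 1
    define c where "c = b - 1"
    have r: "0 \<le> c" "c < 3 * 4 ^ n" using ab by (simp_all add: c_def)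
    have "triple_edge (triple_of n (pt n a, pt n b))
      (triple_of (Suc n) (pt (Suc n) (4 * c + 2), pt (Suc n) (4 * c + 3)))"
      using 1 by (intro triple_edgeI[OF assms(2) NI_children(4)[OF r]]) (auto simp: c_def)
    then show ?thesis
      using via4[OF NI_children(4)[OF r]] number_of_children(3)[OF r] closed[OF assms(3)] 1
      by (simp add: c_def)
  next
    case 2
    then show ?thesis using via_gap[OF assms(2,3)] ab by blast
  next
    case 3
    define c where "c = b - 1"
    have r: "0 \<le> c" "c < 3 * 4 ^ n" using ab by (simp_all add: c_def)
    have c: "c \<notin> E n" "c - 1 \<notin> E n" using 3 by (simp_all add: c_def algebra_simps)
    have "triple_edge (triple_of n (pt n a, pt n b))
      (triple_of (Suc n) (pt (Suc n) (4 * c + 1), pt (Suc n) (4 * c + 3)))"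
      by (rule triple_edgeI[OF assms(2) NI_children(5)[OF r c]]) (use ab in \<open>auto simp: c_def\<close>)
    moreover have "4 * c + 3 - 1 = 4 * c + 2" "4 * c + 3 - 2 = 4 * c + 1" by simp_all
    ultimately show ?thesis
      using via_gap[OF NI_children(5)[OF r c]] closed[OF assms(3)] E_Suc_iff[OF r] c by (simp add: add.commute)
  qed
qed

lemma essential_loop_class_iff: "essential_loop_class L \<longleftrightarrow> L = {(Some 4, 4, Some 4)}"
proof
  assume L: "essential_loop_class L"
  then have loop: "loop_class L" and closed: "\<And>s s'. s \<in> L \<Longrightarrow> triple_edge s s' \<Longrightarrow> s' \<in> L"
    unfolding essential_loop_class_def by blast+
  let ?r = "\<lambda>s s'. s \<in> L \<and> s' \<in> L \<and> triple_edge s s'"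
  obtain t where t: "t \<in> L" "?r\<^sup>+\<^sup>+ t t" using loop unfolding loop_class_def by blast
  from t(2) obtain t' where "triple_edge t t'" by (metis (no_types, lifting) tranclpD)
  then obtain n a b where "NI n a b" "t = triple_of n (pt n a, pt n b)"
    using triple_edgeE by metis
  with reaches_444[of L] closed t(1) have mem: "(Some 4, 4, Some 4) \<in> L" by blast
  have "s = (Some 4, 4, Some 4)" if "s \<in> L" for s
  proof -
    have "?r\<^sup>+\<^sup>+ (Some 4, 4, Some 4) s" using loop mem that unfolding loop_class_def by blast
    then show ?thesis by induction (use edge_from_4 in \<open>fastforce+\<close>)
  qed
  with mem show "L = {(Some 4, 4, Some 4)}" by blast
next
  assume L: "L = {(Some 4, 4, Some 4)}"
  \<comment> \<open>The cells 1 and 2 of level 1 are codes, hence \<open>[8, 9]\<close> at level 2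
    has the essential triple, and so has its first child \<open>[32, 33]\<close>.\<close>
  have E: "2 \<in> E 1" "1 \<in> E 1" "8 \<in> E 2" "7 \<in> E 2"
    using E_Suc_iff[of 0 0] E_Suc_iff[of 2 1] E_Suc_iff[of 1 1] by (auto simp: numeral_2_eq_2)
  have "triple_edge (Some 4, 4, Some 4) (Some 4, 4, Some 4)"
    using triple_edgeI[of 2 8 9 32 33] NI_children(1)[of 2 1] NI_children(1)[of 8 2]
      triple_of_children(1)[of 2 1] triple_of_children(1)[of 8 2] E
    by (simp add: numeral_2_eq_2)
  moreover have "t = (Some 4, 4, Some 4)" if "triple_edge (Some 4, 4, Some 4) t" for t
    using edge_from_4[OF that] by simp
  ultimately show "essential_loop_class L"
    unfolding essential_loop_class_def loop_class_def L by (auto intro: tranclp.r_into_trancl)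
qed

section \<open>Points in the loop class\<close>

text \<open>A nested sequence of net intervals is recorded by the last unit cell \<open>m n\<close>
  of each one instead of by the interval, which may be two units long. The recursion says that the
  digits after level \<open>N\<close> are 2 or 3.\<close>

definition gap_path :: "(nat \<Rightarrow> int) \<Rightarrow> nat \<Rightarrow> real \<Rightarrow> bool" where
  "gap_path m N x \<longleftrightarrow> (\<forall>n\<ge>N. 0 \<le> m n \<and> m n \<notin> E n \<and> m n + 1 < 3 * 4 ^ n \<and>
     (m (Suc n) = 4 * m n + 2 \<or> m (Suc n) = 4 * m n + 3) \<and> pt n (m n) \<le> x \<and> x \<le> pt n (m n + 1))"

lemma NI_left:
  assumes "NI (Suc n) a b"
  shows "a = b - 1 \<or> a = b - 2 \<and> a \<in> E (Suc n)"
proof -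
  obtain c where c: "0 \<le> c" "c < 3 * 4 ^ n" and alt:
    "(a = 4 * c \<and> b = 4 * c + 1) \<or> (a = 4 * c + 3 \<and> b = 4 * c + 4) \<or>
     ((c \<in> E n \<or> c - 1 \<in> E n) \<and> a = 4 * c + 1 \<and> b = 4 * c + 2) \<or>
     ((c \<in> E n \<or> c - 1 \<in> E n) \<and> a = 4 * c + 2 \<and> b = 4 * c + 3) \<or>
     (c \<notin> E n \<and> c - 1 \<notin> E n \<and> a = 4 * c + 1 \<and> b = 4 * c + 3)"
    using assms by (rule NI_cases)
  from alt show ?thesis
    by (elim disjE conjE) (use E_Suc_iff(2)[OF c] in simp_all)
qed

lemma not_code_Suc:
  assumes "0 \<le> m" "m < 3 * 4 ^ Suc n" "m \<notin> E (Suc n)"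
  obtains c where "0 \<le> c" "c < 3 * 4 ^ n" "c \<notin> E n" "m = 4 * c + 2 \<or> m = 4 * c + 3"
proof -
  define c where "c = m div 4"
  have c: "0 \<le> c" "c < 3 * 4 ^ n" using div4_range[of m n] assms by (simp_all add: c_def)
  have "m = 4 * c \<or> m = 4 * c + 1 \<or> m = 4 * c + 2 \<or> m = 4 * c + 3"
    unfolding c_def by presburger
  then have "c \<notin> E n \<and> (m = 4 * c + 2 \<or> m = 4 * c + 3)"
    by (elim disjE) (use E_Suc_iff[OF c] assms(3) in simp_all)
  then show thesis using c that by blast
qed

lemma parent_cell_bounds:
  fixes c k m' :: int
  assumes "m' = 4 * c + 2 \<or> m' = 4 * c + 3"
  shows "m' + 1 \<le> 4 * (k + 1) \<Longrightarrow> c \<le> k"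
    "4 * a \<le> a' \<Longrightarrow> a' < m' + 1 \<Longrightarrow> a \<le> c"
  using assms by presburger+

text \<open>The point to prove is that the last cell of the child lies in the last cell of the
  parent, although the parent may consist of two cells.\<close>

lemma in_loop_class_gap_path:
  assumes "in_loop_class x LL"
  obtains m N where "gap_path m N x"
proof -
  obtain \<Delta> where \<Delta>: "\<And>n. \<Delta> n \<in> net_intervals n" "\<And>n. x \<in> interval_of (\<Delta> n)"
    "\<And>n. interval_of (\<Delta> (Suc n)) \<subseteq> interval_of (\<Delta> n)"
    and "\<forall>\<^sub>F n in sequentially. triple_of n (\<Delta> n) \<in> LL"
    using assms unfolding in_loop_class_def by blast
  then obtain N where N: "\<And>n. n \<ge> N \<Longrightarrow> triple_of n (\<Delta> n) \<in> LL"
    unfolding eventually_sequentially by blast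
  have "\<forall>n. \<exists>ab. \<Delta> n = (pt n (fst ab), pt n (snd ab)) \<and> NI n (fst ab) (snd ab)"
  proof
    fix n
    obtain a b where "\<Delta> n = (pt n a, pt n b)" "NI n a b"
      using \<Delta>(1)[of n] unfolding net_intervals_eq by blast
    then show "\<exists>ab. \<Delta> n = (pt n (fst ab), pt n (snd ab)) \<and> NI n (fst ab) (snd ab)"
      by (intro exI[of _ "(a, b)"]) simp
  qed
  from choice[OF this] obtain ab where ab: "\<And>n. \<Delta> n = (pt n (fst (ab n)), pt n (snd (ab n)))"
    "\<And>n. NI n (fst (ab n)) (snd (ab n))" by blast
  define a b where "a n = fst (ab n)" and "b n = snd (ab n)" for n
  have D: "\<Delta> n = (pt n (a n), pt n (b n))" and NI: "NI n (a n) (b n)" for n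
    using ab by (simp_all add: a_def b_def)
  have x: "pt n (a n) \<le> x" "x \<le> pt n (b n)" for n
    using \<Delta>(2)[of n] unfolding D interval_of_def by simp_all
  have ge0: "0 \<le> a n" "a n < b n" for n
  proof -
    have "a n \<in> P n" "a n < b n" using NI[of n] unfolding NI_def by blast+
    then show "0 \<le> a n" "a n < b n" using P_range by blast+
  qed
  have nest: "4 * a n \<le> a (Suc n)" "b (Suc n) \<le> 4 * b n" for n
  proof -
    have "is_child n (\<Delta> n) (\<Delta> (Suc n))" using \<Delta>(1,3) unfolding is_child_def by blast
    then show "4 * a n \<le> a (Suc n)" "b (Suc n) \<le> 4 * b n" unfolding D is_child_pt by simp_all
  qed
  have gap: "b n - 1 \<notin> E n \<and> b n < 3 * 4 ^ n \<and> (a n = b n - 1 \<or> a n = b n - 2 \<and> a n \<in> E n)"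
    if "n \<ge> N" for n
  proof -
    have T: "triple_of n (pt n (a n), pt n (b n)) \<in> LL" using N[OF that] by (simp add: D)
    have "n \<noteq> 0" using LL_level[OF NI T] .
    then obtain k where k: "n = Suc k" by (cases n) simp_all
    show ?thesis
      using T triple_LL_iff[of k "a n" "b n"] NI_left[of k "a n" "b n"] NI[of n] unfolding k by blast
  qed
  define m where "m n = b n - 1" for n
  have b: "b k = m k + 1" for k by (simp add: m_def)
  have gap1: "m n \<notin> E n" if "n \<ge> N" for n using gap[OF that] unfolding m_def by blast
  have gap2: "m n + 1 < 3 * 4 ^ n" if "n \<ge> N" for n using gap[OF that] by (simp add: m_def)
  have gap3: "a n = m n \<or> a n = m n - 1 \<and> a n \<in> E n" if "n \<ge> N" for n
    using gap[OF that] by (auto simp: m_def)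
  have m0: "0 \<le> m n" for n using ge0[of n] unfolding b by linarith
  have "gap_path m N x"
    unfolding gap_path_def
  proof (intro allI impI)
    fix n assume n: "n \<ge> N"
    then have n': "Suc n \<ge> N" by simp
    have lt: "m (Suc n) < 3 * 4 ^ Suc n" using gap2[OF n'] by simp
    obtain c where c: "c \<notin> E n" "m (Suc n) = 4 * c + 2 \<or> m (Suc n) = 4 * c + 3"
      by (rule not_code_Suc[OF m0 lt gap1[OF n']])
    have le: "c \<le> m n"
      by (rule parent_cell_bounds(1)[OF c(2)]) (use nest(2)[of n] in \<open>simp only: b\<close>)
    have ge: "a n \<le> c"
      by (rule parent_cell_bounds(2)[OF c(2) nest(1)]) (use ge0(2)[of "Suc n"] in \<open>simp only: b\<close>)
    \<comment> \<open>If the interval has two cells, the first one is a code; the parent cell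
      \<open>c\<close> of a non-code is not, so \<open>c\<close> must be the last cell.\<close>
    from gap3[OF n] have "c = m n"
    proof
      assume a: "a n = m n - 1 \<and> a n \<in> E n"
      with c(1) have "c \<noteq> m n - 1" by metis
      with le ge a show ?thesis by linarith
    qed (use le ge in linarith)
    with c have ms: "m (Suc n) = 4 * m n + 2 \<or> m (Suc n) = 4 * m n + 3" by simp
    \<comment> \<open>The level \<open>n\<close> interval does not yet place \<open>x\<close> in the
      cell \<open>m n\<close>, as it may extend one cell further left. The next interval lies inside
      the cell: even when it has two units, it starts at \<open>4 * m n + 1\<close>.\<close>
    have "m (Suc n) - 1 \<le> a (Suc n)" using gap3[OF n'] by (elim disjE) simp_all
    moreover have "4 * m n + 2 \<le> m (Suc n)" using ms by (elim disjE) simp_all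
    ultimately have "4 * m n \<le> a (Suc n)" by linarith
    then have "pt (Suc n) (4 * m n) \<le> pt (Suc n) (a (Suc n))" by simp
    then have "pt n (m n) \<le> pt (Suc n) (a (Suc n))" unfolding pt_Suc .
    then have "pt n (m n) \<le> x" using x(1)[of "Suc n"] by (rule order_trans)
    moreover have "x \<le> pt n (m n + 1)" using x(2)[of n] by (simp add: b)
    ultimately show "0 \<le> m n \<and> m n \<notin> E n \<and> m n + 1 < 3 * 4 ^ n \<and>
     (m (Suc n) = 4 * m n + 2 \<or> m (Suc n) = 4 * m n + 3) \<and> pt n (m n) \<le> x \<and> x \<le> pt n (m n + 1)"
      using ms gap1[OF n] gap2[OF n] m0 by blast
  qed
  with that show thesis .
qed

text \<open>The interval is recovered from its last cell: it is a single cell at digit 3, and at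
  digit 2 it is single or double according to whether the cell before the parent is a code. Starting
  at level 0 is enough for the points constructed later.\<close>

lemma gap_path_in_loop_class:
  assumes "gap_path m 0 x"
  shows "in_loop_class x LL"
proof -
  have g: "0 \<le> m n" "m n \<notin> E n" "m n + 1 < 3 * 4 ^ n"
     "m (Suc n) = 4 * m n + 2 \<or> m (Suc n) = 4 * m n + 3" "pt n (m n) \<le> x" "x \<le> pt n (m n + 1)" for n
    using assms unfolding gap_path_def by blast+
  have "\<exists>a. m n - 1 \<le> a \<and> a \<le> m n \<and> NI n a (m n + 1)" if "n \<noteq> 0" for n
  proof -
    obtain k where k: "n = Suc k" using \<open>n \<noteq> 0\<close> by (cases n) simp_all
    define c where "c = m k"
    have c: "0 \<le> c" "c < 3 * 4 ^ k" "c \<notin> E k" using g(1-3)[of k] by (simp_all add: c_def)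
    note I = NI_children[OF c(1,2)]
    show ?thesis
    proof (cases "m n = 4 * c + 3")
      case True
      show ?thesis by (rule exI[of _ "4 * c + 3"]) (use I(2) True k in \<open>simp add: add.commute\<close>)
    next
      case False
      then have mn: "m n = 4 * c + 2" using g(4)[of k] k by (simp add: c_def)
      show ?thesis
      proof (cases "c - 1 \<in> E k")
        case True
        show ?thesis
          by (rule exI[of _ "4 * c + 2"]) (use I(4) True k mn in \<open>simp add: add.commute\<close>)
      next
        case False
        show ?thesis
          by (rule exI[of _ "4 * c + 1"]) (use I(5)[OF c(3) False] k mn in \<open>simp add: add.commute\<close>)
      qed
    qed
  qed
  then obtain a where a: "\<And>n. n \<noteq> 0 \<Longrightarrow> m n - 1 \<le> a n \<and> a n \<le> m n \<and> NI n (a n) (m n + 1)"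
    by metis
  \<comment> \<open>At level 0 the only net interval is \<open>[0, 3]\<close>, with number 1;
    membership in \<open>LL\<close> starts at level 1.\<close>
  define \<Delta> where "\<Delta> n = (if n = 0 then (pt 0 0, pt 0 3) else (pt n (a n), pt n (m n + 1)))" for n
  have "\<Delta> n \<in> net_intervals n" for n
    using a[of n] by (simp add: \<Delta>_def NI_0_iff)
  moreover have "x \<in> interval_of (\<Delta> n)" for n
  proof (cases "n = 0")
    case True
    have "pt 0 0 \<le> pt 0 (m 0)" "pt 0 (m 0 + 1) \<le> pt 0 3" using g(1,3)[of 0] by simp_all
    from order_trans[OF this(1) g(5)] order_trans[OF g(6) this(2)]
    show ?thesis using True by (simp add: \<Delta>_def interval_of_def)
  next
    case False
    have "pt n (a n) \<le> pt n (m n)" using a[OF False] by simp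
    from order_trans[OF this g(5)] show ?thesis using False g(6)[of n] by (simp add: \<Delta>_def interval_of_def)
  qed
  moreover have "interval_of (\<Delta> (Suc n)) \<subseteq> interval_of (\<Delta> n)" for n
  proof -
    have "is_child n (\<Delta> n) (\<Delta> (Suc n))"
    proof (cases "n = 0")
      case True
      then show ?thesis
        using a[of 1] g(1,3)[of 0] g(4)[of 0] by (auto simp: \<Delta>_def is_child_pt NI_0_iff)
    next
      case False
      then show ?thesis
        using a[of n] a[of "Suc n"] g(4)[of n] by (auto simp: \<Delta>_def is_child_pt)
    qed
    then show ?thesis by (simp add: is_child_def)
  qed
  moreover have "triple_of n (\<Delta> n) \<in> LL" if "n \<ge> 1" for n
  proof -
    obtain k where k: "n = Suc k" using \<open>n \<ge> 1\<close> by (cases n) simp_all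
    show ?thesis
      using triple_LL_iff[of k "a n" "m n + 1"] a[of n] g(2,3)[of n] k by (simp add: \<Delta>_def)
  qed
  ultimately show ?thesis
    unfolding in_loop_class_def eventually_sequentially by blast
qed

section \<open>Cylinder weights and the measure of balls\<close>

definition weight :: "nat list \<Rightarrow> real" where
  "weight \<sigma> = prod_list (map p \<sigma>)"

text \<open>Total weight of the words with code \<open>e\<close>. With the factor
  \<open>14 ^ n\<close> the letter 0 counts 7 and every other letter 1, so the recursion has integer
  coefficients.\<close>

definition W :: "nat \<Rightarrow> int \<Rightarrow> real" where
  "W n e = 14 ^ n * (\<Sum>\<sigma>\<in>words n. if code \<sigma> = e then weight \<sigma> else 0)"

lemma weight_pos: "0 < weight \<sigma>"
  by (induction \<sigma>) (auto simp: weight_def p_def)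

lemma sum_words_Suc:
  "(\<Sum>\<sigma>\<in>words (Suc n). f \<sigma>) = (\<Sum>\<sigma>\<in>words n. \<Sum>i<8. f (\<sigma> @ [i]))"
proof -
  have "inj_on (\<lambda>(\<sigma>, i). \<sigma> @ [i]) (words n \<times> {0..7::nat})" by (auto simp: inj_on_def)
  moreover have "{0..7} = {..<8::nat}" by auto
  ultimately show ?thesis
    by (simp add: words_Suc sum.reindex sum.cartesian_product case_prod_unfold)
qed

lemma W_zero: "e \<notin> E n \<Longrightarrow> W n e = 0"
  unfolding W_def code_image[symmetric] by (auto intro!: sum.neutral)

lemma W_nonneg: "0 \<le> W n e"
  unfolding W_def by (intro mult_nonneg_nonneg sum_nonneg) (auto simp: weight_pos less_imp_le)

lemma W_pos: "e \<in> E n \<Longrightarrow> 0 < W n e"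
proof -
  assume "e \<in> E n"
  then obtain \<sigma> where \<sigma>: "\<sigma> \<in> words n" "code \<sigma> = e" unfolding code_image[symmetric] by blast
  have "0 < (\<Sum>\<sigma>\<in>words n. if code \<sigma> = e then weight \<sigma> else 0)"
    by (rule sum_pos2[of _ \<sigma>]) (use \<sigma> weight_pos in \<open>auto simp: less_imp_le\<close>)
  then show ?thesis by (simp add: W_def)
qed

lemma W_0: "W 0 e = (if e = 0 then 1 else 0)"
  by (simp add: W_def words_0 code_def weight_def)

lemma sum_lessThan_8: "(\<Sum>i<8. f i) = f 0 + f 1 + f 2 + f 3 + f 4 + f 5 + f 6 + (f 7 :: real)"
  for f :: "nat \<Rightarrow> real"
  by (simp add: numeral_eq_Suc)

lemma weight_snoc: "weight (\<sigma> @ [i]) = weight \<sigma> * p i"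
  by (simp add: weight_def)

text \<open>A code \<open>4 * a + j\<close> arises from \<open>a\<close>, \<open>a - 1\<close>,
  \<open>a - 2\<close> through the translations 0, 4, 8 for \<open>j = 0\<close> and 1, 5, 9 for
  \<open>j = 1\<close>, but from \<open>a\<close> alone for \<open>j = 2, 3\<close>. The heavy
  letter 0 is felt only in the first formula.\<close>

lemma W_Suc:
  "W (Suc n) (4 * a) = 7 * W n a + W n (a - 1) + W n (a - 2)"
  "W (Suc n) (4 * a + 1) = W n a + W n (a - 1) + W n (a - 2)"
  "W (Suc n) (4 * a + 2) = W n a"
  "W (Suc n) (4 * a + 3) = W n a"
proof -
  define I where "I e \<sigma> = (if code \<sigma> = e then weight \<sigma> else 0)" for e \<sigma>
  have W: "W n e = 14 ^ n * (\<Sum>\<sigma>\<in>words n. I e \<sigma>)" for e by (simp add: W_def I_def)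
  have WS: "W (Suc n) e = 14 ^ Suc n * (\<Sum>\<sigma>\<in>words n. \<Sum>i<8. if 4 * code \<sigma> + D i = e then weight \<sigma> * p i else 0)"
    for e by (simp add: W_def sum_words_Suc code_snoc weight_snoc cong: if_cong)
  have D: "D 0 = 0" "D 1 = 1" "D 2 = 2" "D 3 = 3" "D 4 = 4" "D 5 = 5" "D 6 = 8" "D 7 = 9"
    by (simp_all add: D_def)
  have p: "p 0 = 1/2" "p 1 = 1/14" "p 2 = 1/14" "p 3 = 1/14" "p 4 = 1/14" "p 5 = 1/14" "p 6 = 1/14" "p 7 = 1/14"
    by (simp_all add: p_def)
  have s0: "(\<Sum>i<8. if 4 * c + D i = 4 * a then w * p i else 0) =
      (7 * (if c = a then w else 0) + (if c = a - 1 then w else 0) + (if c = a - 2 then w else 0)) / 14"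
    for c w
  proof -
    have "4 * c + 0 = 4 * a \<longleftrightarrow> c = a" "4 * c + 1 = 4 * a \<longleftrightarrow> False" "4 * c + 2 = 4 * a \<longleftrightarrow> False"
      "4 * c + 3 = 4 * a \<longleftrightarrow> False" "4 * c + 4 = 4 * a \<longleftrightarrow> c = a - 1" "4 * c + 5 = 4 * a \<longleftrightarrow> False"
      "4 * c + 8 = 4 * a \<longleftrightarrow> c = a - 2" "4 * c + 9 = 4 * a \<longleftrightarrow> False" by presburger+
    then show ?thesis unfolding sum_lessThan_8 D p by (simp only: if_False) simp
  qed
  have s1: "(\<Sum>i<8. if 4 * c + D i = 4 * a + 1 then w * p i else 0) =
      ((if c = a then w else 0) + (if c = a - 1 then w else 0) + (if c = a - 2 then w else 0)) / 14"
    for c w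
  proof -
    have "4 * c + 0 = 4 * a + 1 \<longleftrightarrow> False" "4 * c + 1 = 4 * a + 1 \<longleftrightarrow> c = a" "4 * c + 2 = 4 * a + 1 \<longleftrightarrow> False"
      "4 * c + 3 = 4 * a + 1 \<longleftrightarrow> False" "4 * c + 4 = 4 * a + 1 \<longleftrightarrow> False" "4 * c + 5 = 4 * a + 1 \<longleftrightarrow> c = a - 1"
      "4 * c + 8 = 4 * a + 1 \<longleftrightarrow> False" "4 * c + 9 = 4 * a + 1 \<longleftrightarrow> c = a - 2" by presburger+
    then show ?thesis unfolding sum_lessThan_8 D p by (simp only: if_False) simp
  qed
  have s2: "(\<Sum>i<8. if 4 * c + D i = 4 * a + 2 then w * p i else 0) = (if c = a then w else 0) / 14"
    for c w
  proof -
    have "4 * c + 0 = 4 * a + 2 \<longleftrightarrow> False" "4 * c + 1 = 4 * a + 2 \<longleftrightarrow> False" "4 * c + 2 = 4 * a + 2 \<longleftrightarrow> c = a"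
      "4 * c + 3 = 4 * a + 2 \<longleftrightarrow> False" "4 * c + 4 = 4 * a + 2 \<longleftrightarrow> False" "4 * c + 5 = 4 * a + 2 \<longleftrightarrow> False"
      "4 * c + 8 = 4 * a + 2 \<longleftrightarrow> False" "4 * c + 9 = 4 * a + 2 \<longleftrightarrow> False" by presburger+
    then show ?thesis unfolding sum_lessThan_8 D p by (simp only: if_False) simp
  qed
  have s3: "(\<Sum>i<8. if 4 * c + D i = 4 * a + 3 then w * p i else 0) = (if c = a then w else 0) / 14"
    for c w
  proof -
    have "4 * c + 0 = 4 * a + 3 \<longleftrightarrow> False" "4 * c + 1 = 4 * a + 3 \<longleftrightarrow> False" "4 * c + 2 = 4 * a + 3 \<longleftrightarrow> False"
      "4 * c + 3 = 4 * a + 3 \<longleftrightarrow> c = a" "4 * c + 4 = 4 * a + 3 \<longleftrightarrow> False" "4 * c + 5 = 4 * a + 3 \<longleftrightarrow> False"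
      "4 * c + 8 = 4 * a + 3 \<longleftrightarrow> False" "4 * c + 9 = 4 * a + 3 \<longleftrightarrow> False" by presburger+
    then show ?thesis unfolding sum_lessThan_8 D p by (simp only: if_False) simp
  qed
  note sums = I_def[symmetric] sum_divide_distrib[symmetric] sum.distrib sum_distrib_left[symmetric]
  show "W (Suc n) (4 * a) = 7 * W n a + W n (a - 1) + W n (a - 2)"
    unfolding WS s0 sums by (simp add: W algebra_simps)
  show "W (Suc n) (4 * a + 1) = W n a + W n (a - 1) + W n (a - 2)"
    unfolding WS s1 sums by (simp add: W algebra_simps)
  show "W (Suc n) (4 * a + 2) = W n a"
    unfolding WS s2 sums by (simp add: W)
  show "W (Suc n) (4 * a + 3) = W n a"
    unfolding WS s3 sums by (simp add: W)
qed

section \<open>From cylinder weights to measures of sets\<close>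

lemma S_measurable: "S i \<in> borel_measurable borel"
  unfolding S_def by measurable

lemma S_word_measurable: "S_word \<sigma> \<in> borel_measurable borel"
proof (induction \<sigma>)
  case Nil
  then show ?case by (simp add: S_word_def id_def)
next
  case (Cons i \<sigma>)
  then show ?case using measurable_comp[OF Cons S_measurable[of i]] by (simp add: S_word_def o_def)
qed

lemma borel_vimage: "f \<in> borel_measurable borel \<Longrightarrow> A \<in> sets borel \<Longrightarrow> f -` A \<in> sets borel"
  using measurable_sets[of f borel borel A] by simp

lemma measure_words:
  assumes "self_similar_measure \<mu>" "A \<in> sets borel"
  shows "measure \<mu> A = (\<Sum>\<sigma>\<in>words n. weight \<sigma> * measure \<mu> (S_word \<sigma> -` A))"
proof (induction n)
  case 0
  then show ?case by (simp add: words_0 S_word_def weight_def)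
next
  case (Suc n)
  have eq: "measure \<mu> (S_word \<sigma> -` A) = (\<Sum>i<8. p i * measure \<mu> (S_word (\<sigma> @ [i]) -` A))" for \<sigma>
  proof -
    have "S i -` (S_word \<sigma> -` A) = S_word (\<sigma> @ [i]) -` A" for i
      by (auto simp: S_word_def)
    then show ?thesis
      using assms borel_vimage[OF S_word_measurable assms(2), of \<sigma>]
      unfolding self_similar_measure_def by simp
  qed
  show ?case
    unfolding Suc sum_words_Suc
  proof (rule sum.cong[OF refl])
    show "weight \<sigma> * measure \<mu> (S_word \<sigma> -` A) =
      (\<Sum>i<8. weight (\<sigma> @ [i]) * measure \<mu> (S_word (\<sigma> @ [i]) -` A))" for \<sigma>
      by (subst eq) (simp add: weight_snoc sum_distrib_left mult.assoc)
  qed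
qed

lemma sum_p: "(\<Sum>i<8. p i) = 1"
  by (simp add: sum_lessThan_8 p_def)

text \<open>\<open>self_similar_measure\<close> does not mention the support, so it is derived here.
  The maps preserve [0, 1] and contract by 1/4, so the preimage of the set of points farther than
  \<open>R\<close> from [0, 1] lies farther than \<open>4 * R\<close> away. Iterating, the mass
  beyond \<open>R\<close> is at most the mass beyond \<open>4 ^ k * R\<close>, which tends to
  0.\<close>

lemma AE_in_unit_interval:
  assumes "self_similar_measure \<mu>"
  shows "AE y in \<mu>. y \<in> {0..1}"
proof -
  interpret prob_space \<mu> using assms by (simp add: self_similar_measure_def)
  have sets [simp]: "sets \<mu> = sets borel" using assms by (simp add: self_similar_measure_def)
  have space: "space \<mu> = UNIV" using sets_eq_imp_space_eq[OF sets] by simp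
  define B where "B R = - {- R..1 + R :: real}" for R
  have B_sets [simp]: "B R \<in> sets borel" for R by (simp add: B_def)
  have step: "measure \<mu> (B R) \<le> measure \<mu> (B (4 * R))" if "R > 0" for R
  proof -
    have "S i -` B R \<subseteq> B (4 * R)" if "i < 8" for i
    proof
      fix y assume "y \<in> S i -` B R"
      moreover have "0 \<le> d i" "d i \<le> 9"
        using \<open>i < 8\<close> by (auto simp: d_def numeral_eq_Suc less_Suc_eq)
      ultimately show "y \<in> B (4 * R)" by (auto simp: B_def S_def field_simps)
    qed
    then have "measure \<mu> (S i -` B R) \<le> measure \<mu> (B (4 * R))" if "i < 8" for i
      using that by (intro finite_measure_mono) auto
    then have "(\<Sum>i<8. p i * measure \<mu> (S i -` B R)) \<le> (\<Sum>i<8. p i * measure \<mu> (B (4 * R)))"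
      by (intro sum_mono mult_left_mono) (auto simp: p_def)
    also have "\<dots> = measure \<mu> (B (4 * R))" by (simp flip: sum_distrib_right add: sum_p)
    finally show ?thesis using assms by (simp add: self_similar_measure_def)
  qed
  have null: "measure \<mu> (B R) = 0" if "R > 0" for R
  proof -
    have pow: "measure \<mu> (B R) \<le> measure \<mu> (B (4 ^ k * R))" for k
    proof (induction k)
      case (Suc k)
      then show ?case using step[of "4 ^ k * R"] that by (simp add: mult.assoc)
    qed simp
    have "decseq (\<lambda>k. B (4 ^ k * R))"
    proof (rule decseq_SucI)
      fix k have "4 ^ k * R \<le> 4 ^ Suc k * R" using that by simp
      then show "B (4 ^ Suc k * R) \<subseteq> B (4 ^ k * R)" unfolding B_def by auto
    qed
    then have "(\<lambda>k. measure \<mu> (B (4 ^ k * R))) \<longlonglongrightarrow> measure \<mu> (\<Inter>k. B (4 ^ k * R))"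
      by (intro finite_Lim_measure_decseq) auto
    moreover have "(\<Inter>k. B (4 ^ k * R)) = {}"
    proof -
      have "\<exists>k. y \<notin> B (4 ^ k * R)" for y
      proof -
        obtain k where "\<bar>y\<bar> / R < 4 ^ k" using real_arch_pow[of 4 "\<bar>y\<bar> / R"] by auto
        then have "\<bar>y\<bar> < 4 ^ k * R" using that by (simp add: field_simps)
        then show ?thesis by (intro exI[of _ k]) (auto simp: B_def)
      qed
      then show ?thesis by blast
    qed
    ultimately have "measure \<mu> (B R) \<le> 0"
      using pow by (intro LIMSEQ_le_const[of "\<lambda>k. measure \<mu> (B (4 ^ k * R))" 0]) auto
    then show ?thesis by (simp add: measure_le_0_iff)
  qed
  have "AE y in \<mu>. y \<notin> B (1 / real (Suc k))" for k
    using null[of "1 / real (Suc k)"] by (intro AE_not_in) (simp add: null_sets_def emeasure_eq_measure)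
  then have "AE y in \<mu>. \<forall>k. y \<notin> B (1 / real (Suc k))" by (simp add: AE_all_countable)
  then show ?thesis
  proof (rule AE_mp, intro AE_I2 impI)
    fix y assume y: "\<forall>k. y \<notin> B (1 / real (Suc k))"
    then have "- (1 / real (Suc k)) \<le> y" "y - 1 \<le> 1 / real (Suc k)" for k
      by (auto simp: B_def algebra_simps)
    moreover have "(\<lambda>k. 1 / real (Suc k)) \<longlonglongrightarrow> 0" by (rule LIMSEQ_Suc[OF lim_1_over_n])
    ultimately have "y - 1 \<le> 0" "- 0 \<le> y"
      using LIMSEQ_le_const[of "\<lambda>k. 1 / real (Suc k)" 0 "y - 1"]
        LIMSEQ_le_const2[OF tendsto_minus[of "\<lambda>k. 1 / real (Suc k)" 0], of y] by auto
    then show "y \<in> {0..1}" by auto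
  qed
qed

lemma sum_W:
  assumes "finite J"
  shows "(\<Sum>\<sigma>\<in>words n. if code \<sigma> \<in> J then weight \<sigma> else 0) = (\<Sum>e\<in>J. W n e) / 14 ^ n"
proof -
  have "(\<Sum>e\<in>J. W n e) / 14 ^ n = (\<Sum>e\<in>J. \<Sum>\<sigma>\<in>words n. if code \<sigma> = e then weight \<sigma> else 0)"
    by (simp add: W_def flip: sum_distrib_left)
  also have "\<dots> = (\<Sum>\<sigma>\<in>words n. \<Sum>e\<in>J. if code \<sigma> = e then weight \<sigma> else 0)" by (rule sum.swap)
  also have "\<dots> = (\<Sum>\<sigma>\<in>words n. if code \<sigma> \<in> J then weight \<sigma> else 0)"
    using assms by (intro sum.cong refl) (simp add: sum.delta')
  finally show ?thesis by simp
qed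

text \<open>Together with \<open>W_le_measure\<close> this encloses the mass of \<open>A\<close>
  between the weight of cylinders inside \<open>A\<close> and that of cylinders meeting
  \<open>A\<close>. A preimage under \<open>S_word\<close> that misses [0, 1] has measure 0, one
  that contains [0, 1] has measure 1.\<close>

lemma measure_le_W:
  assumes "self_similar_measure \<mu>" "A \<in> sets borel" "finite J"
    and "\<And>\<sigma> y. \<sigma> \<in> words n \<Longrightarrow> y \<in> {0..1} \<Longrightarrow> S_word \<sigma> y \<in> A \<Longrightarrow> code \<sigma> \<in> J"
  shows "measure \<mu> A \<le> (\<Sum>e\<in>J. W n e) / 14 ^ n"
proof -
  interpret prob_space \<mu> using assms by (simp add: self_similar_measure_def)
  have sets [simp]: "sets \<mu> = sets borel" using assms by (simp add: self_similar_measure_def)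
  have "weight \<sigma> * measure \<mu> (S_word \<sigma> -` A) \<le> (if code \<sigma> \<in> J then weight \<sigma> else 0)"
    if "\<sigma> \<in> words n" for \<sigma>
  proof (cases "code \<sigma> \<in> J")
    case True
    then show ?thesis using weight_pos[of \<sigma>] by (simp add: mult_left_le)
  next
    case False
    have "AE y in \<mu>. y \<notin> S_word \<sigma> -` A"
      using AE_in_unit_interval[OF assms(1)] by eventually_elim (use assms(4) that False in auto)
    then have "measure \<mu> (S_word \<sigma> -` A) = 0"
      using borel_vimage[OF S_word_measurable assms(2), of \<sigma>] by (subst prob_eq_0) auto
    then show ?thesis using False by simp
  qed
  then show ?thesis
    unfolding measure_words[OF assms(1,2), of n] sum_W[OF assms(3), symmetric] by (rule sum_mono)
qed

lemma W_le_measure: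
  assumes "self_similar_measure \<mu>" "A \<in> sets borel" "finite J"
    and "\<And>\<sigma> y. \<sigma> \<in> words n \<Longrightarrow> y \<in> {0..1} \<Longrightarrow> code \<sigma> \<in> J \<Longrightarrow> S_word \<sigma> y \<in> A"
  shows "(\<Sum>e\<in>J. W n e) / 14 ^ n \<le> measure \<mu> A"
proof -
  interpret prob_space \<mu> using assms by (simp add: self_similar_measure_def)
  have sets [simp]: "sets \<mu> = sets borel" using assms by (simp add: self_similar_measure_def)
  have "(if code \<sigma> \<in> J then weight \<sigma> else 0) \<le> weight \<sigma> * measure \<mu> (S_word \<sigma> -` A)"
    if "\<sigma> \<in> words n" for \<sigma>
  proof (cases "code \<sigma> \<in> J")
    case True
    have "AE y in \<mu>. y \<in> S_word \<sigma> -` A"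
      using AE_in_unit_interval[OF assms(1)] by eventually_elim (use assms(4) that True in auto)
    then have "measure \<mu> (S_word \<sigma> -` A) = 1"
      using borel_vimage[OF S_word_measurable assms(2), of \<sigma>] by (subst prob_eq_1) auto
    then show ?thesis by (simp add: weight_pos less_imp_le)
  qed (simp add: weight_pos less_imp_le)
  then show ?thesis
    unfolding measure_words[OF assms(1,2), of n] sum_W[OF assms(3), symmetric] by (rule sum_mono)
qed

text \<open>The codes of the level \<open>n\<close> cylinders that meet a small ball around a point of the cell
  \<open>m\<close> lie in \<open>{m - 2..m + 1}\<close>.\<close>

definition F :: "(nat \<Rightarrow> int) \<Rightarrow> nat \<Rightarrow> real" where
  "F m n = (\<Sum>e\<in>{m n - 2..m n + 1}. W n e)"

lemma gap_path_ball:
  assumes "self_similar_measure \<mu>" "gap_path m N x" "n \<ge> N"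
  shows "measure \<mu> {x - 1 / (3 * 4 ^ Suc n)..x + 1 / (3 * 4 ^ Suc n)} \<le> F m n / 14 ^ n"
    "F m n / 14 ^ n \<le> measure \<mu> {x - 4 / (3 * 4 ^ n)..x + 4 / (3 * 4 ^ n)}"
proof -
  define X where "X = 3 * 4 ^ n * x"
  have "pt (Suc n) (m (Suc n)) \<le> x" "x \<le> pt n (m n + 1)" "4 * m n + 2 \<le> m (Suc n)"
    using assms(2,3) unfolding gap_path_def by (force, force, force)
  then have "of_int (m (Suc n)) \<le> 4 * X" "X \<le> of_int (m n) + 1" "real_of_int (4 * m n + 2) \<le> of_int (m (Suc n))"
    by (simp_all only: pt_def X_def of_int_le_iff) (simp_all add: field_simps)
  \<comment> \<open>In units of level \<open>n\<close> the point lies in the right half of its cell,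
    since the next digit is at least 2. Hence a ball of radius 1/4 cannot touch the cylinder
    \<open>[m n - 3, m n]\<close>, nor one starting at \<open>m n + 2\<close>; a ball of radius 4
    contains all of \<open>[m n - 2, m n + 4]\<close>.\<close>
  then have X: "of_int (m n) + 1 / 2 \<le> X" "X \<le> of_int (m n) + 1" by simp_all
  have ball: "S_word \<sigma> y \<in> {x - r / (3 * 4 ^ n)..x + r / (3 * 4 ^ n)} \<longleftrightarrow>
    X - r \<le> 3 * y + of_int (code \<sigma>) \<and> 3 * y + of_int (code \<sigma>) \<le> X + r" if "\<sigma> \<in> words n" for \<sigma> y r
  proof -
    have "x = X / (3 * 4 ^ n)" by (simp add: X_def)
    then have "x - r / (3 * 4 ^ n) = (X - r) / (3 * 4 ^ n)" "x + r / (3 * 4 ^ n) = (X + r) / (3 * 4 ^ n)"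
      by (simp_all add: diff_divide_distrib add_divide_distrib)
    then show ?thesis by (simp add: S_word_eq[OF that] divide_le_cancel)
  qed
  have quarter: "1 / (3 * 4 ^ Suc n) = (1 / 4) / (3 * 4 ^ n :: real)" by simp
  show "measure \<mu> {x - 1 / (3 * 4 ^ Suc n)..x + 1 / (3 * 4 ^ Suc n)} \<le> F m n / 14 ^ n"
    unfolding F_def quarter
  proof (rule measure_le_W[OF assms(1)])
    fix \<sigma> y assume \<sigma>: "\<sigma> \<in> words n" and y: "y \<in> {0..1}"
      and "S_word \<sigma> y \<in> {x - 1 / 4 / (3 * 4 ^ n)..x + 1 / 4 / (3 * 4 ^ n)}"
    then have "X - 1 / 4 \<le> 3 * y + of_int (code \<sigma>)" "3 * y + of_int (code \<sigma>) \<le> X + 1 / 4"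
      using ball[OF \<sigma>, of y "1 / 4"] by simp_all
    with X y have "of_int (m n) - 3 < real_of_int (code \<sigma>)" "real_of_int (code \<sigma>) < of_int (m n) + 2"
      by (simp_all)
    then show "code \<sigma> \<in> {m n - 2..m n + 1}" by simp
  qed auto
  show "F m n / 14 ^ n \<le> measure \<mu> {x - 4 / (3 * 4 ^ n)..x + 4 / (3 * 4 ^ n)}"
    unfolding F_def
  proof (rule W_le_measure[OF assms(1)])
    fix \<sigma> and y :: real
    assume \<sigma>: "\<sigma> \<in> words n" and y: "y \<in> {0..1}" and "code \<sigma> \<in> {m n - 2..m n + 1}"
    then have "real_of_int (m n) - 2 \<le> of_int (code \<sigma>)" "of_int (code \<sigma>) \<le> real_of_int (m n) + 1"
      by simp_all
    with X y show "S_word \<sigma> y \<in> {x - 4 / (3 * 4 ^ n)..x + 4 / (3 * 4 ^ n)}"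
      unfolding ball[OF \<sigma>] by auto
  qed auto
qed

section \<open>Local dimensions\<close>

text \<open>Weight of the cylinders covering the cell \<open>m n\<close>: when \<open>m n\<close> is
  not a code, only \<open>m n - 1\<close> and \<open>m n - 2\<close> can contribute.\<close>

definition Q :: "(nat \<Rightarrow> int) \<Rightarrow> nat \<Rightarrow> real" where
  "Q m n = W n (m n - 1) + W n (m n - 2)"

lemma F_eq: "F m n = Q m n + W n (m n) + W n (m n + 1)"
proof -
  have "{m n - 2..m n + 1} = {m n - 2, m n - 1, m n, m n + 1}" by auto
  then show ?thesis by (simp add: F_def Q_def)
qed

text \<open>The cells \<open>4 * m n\<close> and \<open>4 * m n + 1\<close>, now at distance 2 and 1
  to the left, each receive the full weight \<open>Q m n\<close>. The right neighbour
  \<open>4 * m n + 3\<close> descends from the non-code \<open>m n\<close> and has weight 0.\<close>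

lemma gap_step_2:
  assumes "m n \<notin> E n" "m (Suc n) = 4 * m n + 2"
  shows "Q m (Suc n) = 2 * Q m n" "F m (Suc n) = 2 * Q m n" "W (Suc n) (m (Suc n) - 1) = Q m n"
proof -
  have eqs: "m (Suc n) - 1 = 4 * m n + 1" "m (Suc n) - 2 = 4 * m n" "m (Suc n) + 1 = 4 * m n + 3"
    using assms(2) by simp_all
  note Ws = W_Suc[of n "m n"] W_zero[OF assms(1)]
  show A: "W (Suc n) (m (Suc n) - 1) = Q m n" using Ws unfolding Q_def eqs by simp
  show Q: "Q m (Suc n) = 2 * Q m n" using Ws unfolding Q_def eqs by simp
  have "W (Suc n) (m (Suc n)) = 0" using Ws unfolding assms(2) by simp
  then show "F m (Suc n) = 2 * Q m n" using Ws unfolding F_eq Q eqs by simp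
qed

text \<open>Of the two covering codes only \<open>4 * m n + 1\<close> is left, so \<open>Q\<close>
  stays. The right neighbour is \<open>4 * (m n + 1)\<close>, the position where the letter 0
  multiplies the weight of \<open>m n + 1\<close> by 7.\<close>

lemma gap_step_3:
  assumes "m n \<notin> E n" "m (Suc n) = 4 * m n + 3"
  shows "Q m (Suc n) = Q m n" "F m (Suc n) = Q m n + 7 * W n (m n + 1) + W n (m n - 1)"
    "W (Suc n) (m (Suc n) - 1) = 0" "W (Suc n) (m (Suc n) + 1) = 7 * W n (m n + 1) + W n (m n - 1)"
proof -
  have eqs: "m (Suc n) - 1 = 4 * m n + 2" "m (Suc n) - 2 = 4 * m n + 1" "m (Suc n) + 1 = 4 * (m n + 1)"
    using assms(2) by simp_all
  have eqs': "m n + 1 - 1 = m n" "m n + 1 - 2 = m n - 1" by simp_all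
  show Q: "Q m (Suc n) = Q m n"
    using W_Suc[of n "m n"] W_zero[OF assms(1)] unfolding Q_def eqs by simp
  show A: "W (Suc n) (m (Suc n) - 1) = 0" using W_Suc[of n "m n"] W_zero[OF assms(1)] unfolding eqs by simp
  show R: "W (Suc n) (m (Suc n) + 1) = 7 * W n (m n + 1) + W n (m n - 1)"
    using W_Suc(1)[of n "m n + 1"] W_zero[OF assms(1)] unfolding eqs eqs' by simp
  have "W (Suc n) (m (Suc n)) = 0" using W_Suc(4)[of n "m n"] W_zero[OF assms(1)] unfolding assms(2) by simp
  then show "F m (Suc n) = Q m n + 7 * W n (m n + 1) + W n (m n - 1)"
    unfolding F_eq Q R by simp
qed

lemma const_over_n: "(\<lambda>n. c / real n) \<longlonglongrightarrow> 0"
  by real_asymp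

context
  fixes m N x
  assumes path: "gap_path m N x"
begin

lemma gapD:
  assumes "n \<ge> N"
  shows "m n \<notin> E n" "0 \<le> m n" "m n + 1 < 3 * 4 ^ n"
    "m (Suc n) = 4 * m n + 2 \<or> m (Suc n) = 4 * m n + 3"
  using path assms unfolding gap_path_def by blast+

lemma Q_pos: "n \<ge> N \<Longrightarrow> 0 < Q m n"
proof -
  assume n: "n \<ge> N"
  have "m n - 1 \<in> E n \<or> m n - 2 \<in> E n" using E_cover[of "m n" n] gapD[OF n] by simp
  then show ?thesis
    unfolding Q_def using W_pos W_nonneg by (auto intro: add_pos_nonneg add_nonneg_pos)
qed

lemma Q_le_F: "Q m n \<le> F m n"
  unfolding F_eq using W_nonneg[of n "m n"] W_nonneg[of n "m n + 1"] by simp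

lemma F_pos: "n \<ge> N \<Longrightarrow> 0 < F m n"
  using Q_pos Q_le_F[of n] by force

lemma Q_Suc:
  assumes "n \<ge> N"
  shows "Q m n \<le> Q m (Suc n)" "Q m (Suc n) \<le> 2 * Q m n"
  using gapD(4)[OF assms] gap_step_2(1)[of m n] gap_step_3(1)[of m n] gapD(1)[OF assms] Q_pos[OF assms]
  by auto

text \<open>At a digit 3 the sum becomes at most \<open>2 * Q + 7 * R\<close>, with \<open>R\<close>
  the weight of the right neighbour, and at a digit 2 it is \<open>2 * Q\<close>. The factor 7 is
  what yields the lower bound 1/2 for the dimensions.\<close>

lemma F_Suc:
  assumes "n \<ge> N"
  shows "F m (Suc n) \<le> 7 * F m n"
proof -
  have "F m (Suc n) \<le> 7 * Q m n + 7 * W n (m n + 1)"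
    using gapD(4)[OF assms]
  proof
    assume "m (Suc n) = 4 * m n + 2"
    then show ?thesis
      using gap_step_2(2)[of m n, OF gapD(1)[OF assms]] Q_pos[OF assms] W_nonneg[of n "m n + 1"] by simp
  next
    assume "m (Suc n) = 4 * m n + 3"
    then have "F m (Suc n) = Q m n + 7 * W n (m n + 1) + W n (m n - 1)"
      using gap_step_3(2)[of m n, OF gapD(1)[OF assms]] by simp
    moreover have "W n (m n - 1) \<le> Q m n" using W_nonneg[of n "m n - 2"] by (simp add: Q_def)
    ultimately show ?thesis using Q_pos[OF assms] by simp
  qed
  then show ?thesis using W_nonneg[of n "m n"] by (simp add: F_eq)
qed

lemma Q_mono:
  assumes "N \<le> k" "k \<le> n"
  shows "Q m k \<le> Q m n"
  using assms(2)
proof (induction n rule: dec_induct)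
  case (step n)
  with assms(1) show ?case using Q_Suc(1)[of n] by force
qed simp

lemma Q_growth:
  assumes "N \<le> k" "k \<le> n"
  shows "Q m n \<le> 2 ^ (n - k) * Q m k"
  using assms(2)
proof (induction n rule: dec_induct)
  case (step n)
  with assms(1) show ?case using Q_Suc(2)[of n] by (simp add: Suc_diff_le)
qed simp

lemma F_growth:
  assumes "N \<le> k" "k \<le> n"
  shows "F m n \<le> 7 ^ (n - k) * F m k"
  using assms(2)
proof (induction n rule: dec_induct)
  case (step n)
  with assms(1) show ?case using F_Suc[of n] by (simp add: Suc_diff_le)
qed simp

text \<open>Right after a digit 2 the right neighbour contributes nothing, so at these levels
  \<open>F\<close> is controlled by the slower growth of \<open>Q\<close>.\<close>

lemma F_after_2: "N \<le> n \<Longrightarrow> m (Suc n) = 4 * m n + 2 \<Longrightarrow> F m (Suc n) = Q m (Suc n)"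
  using gap_step_2(1,2)[of m n] gapD(1)[of n] by simp

text \<open>This combination of weights is the one that a digit 3 multiplies by exactly 7.\<close>

lemma F_ge_run:
  assumes "N \<le> k" "k \<le> n" "\<And>i. k \<le> i \<Longrightarrow> i < n \<Longrightarrow> m (Suc i) = 4 * m i + 3"
  shows "7 ^ (n - k) * (W k (m k + 1) + W k (m k - 1) / 7) \<le> F m n"
proof -
  have "7 ^ (n - k) * (W k (m k + 1) + W k (m k - 1) / 7) = W n (m n + 1) + W n (m n - 1) / 7"
    using assms(2,3)
  proof (induction n rule: dec_induct)
    case (step n)
    have IH: "7 ^ (n - k) * (W k (m k + 1) + W k (m k - 1) / 7) = W n (m n + 1) + W n (m n - 1) / 7"
      using step by simp
    have "m n \<notin> E n" "m (Suc n) = 4 * m n + 3" using step gapD(1) assms(1) by simp_all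
    from gap_step_3(3,4)[OF this] IH step(1) show ?case by (simp add: Suc_diff_le)
  qed simp
  also have "\<dots> \<le> F m n"
    using W_nonneg[of n "m n - 1"] W_nonneg[of n "m n - 2"] W_nonneg[of n "m n"]
    by (simp add: F_eq Q_def)
  finally show ?thesis .
qed

section \<open>From growth rates of \<open>F\<close> to local dimensions\<close>

context
  fixes \<mu>
  assumes ss: "self_similar_measure \<mu>"
begin

definition dimseq :: "nat \<Rightarrow> real" where
  "dimseq n = - ln (F m n / 14 ^ n) / (real n * ln 4)"

lemma local_dims:
  "lower_local_dim \<mu> x = liminf (\<lambda>n. ereal (dimseq n))"
  "upper_local_dim \<mu> x = limsup (\<lambda>n. ereal (dimseq n))"
proof -
  interpret prob_space \<mu> using ss by (simp add: self_similar_measure_def)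
  have [simp]: "sets \<mu> = sets borel" using ss by (simp add: self_similar_measure_def)
  have mono: "measure \<mu> {x - r..x + r} \<le> measure \<mu> {x - s..x + s}" if "r \<le> s" for r s
    using that by (intro finite_measure_mono) auto
  note sc = scale_exponents[of "\<lambda>r. measure \<mu> {x - r..x + r}" N "\<lambda>n. F m n / 14 ^ n",
      OF mono prob_le_1 _ gap_path_ball(1)[OF ss path] gap_path_ball(2)[OF ss path]]
  show "lower_local_dim \<mu> x = liminf (\<lambda>n. ereal (dimseq n))"
    "upper_local_dim \<mu> x = limsup (\<lambda>n. ereal (dimseq n))"
    unfolding lower_local_dim_def upper_local_dim_def dimseq_def
    using sc F_pos by simp_all
qed

text \<open>If \<open>F\<close> is of size exp(\<open>s\<close> * n) up to a factor exp(o(n)), then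
  the mass \<open>F m n / 14 ^ n\<close> has exponent \<open>(ln 14 - s) / ln 4\<close>. Here
  \<open>\<phi>\<close> selects levels and \<open>e\<close> is the error.\<close>

lemma dimseq_tendsto:
  fixes \<phi> :: "nat \<Rightarrow> nat"
  assumes "filterlim \<phi> at_top sequentially" "(\<lambda>k. e k / real (\<phi> k)) \<longlonglongrightarrow> 0"
  shows "(\<lambda>k. ereal ((real (\<phi> k) * ln 14 - (s * real (\<phi> k) + e k)) / (real (\<phi> k) * ln 4)))
    \<longlonglongrightarrow> ereal ((ln 14 - s) / ln 4)"
proof -
  have "(\<lambda>k. (ln 14 - s) / ln 4 - e k / real (\<phi> k) / ln 4) \<longlonglongrightarrow> (ln 14 - s) / ln 4 - 0 / ln 4"
    by (intro tendsto_intros assms(2)) simp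
  moreover have "\<forall>\<^sub>F k in sequentially. (ln 14 - s) / ln 4 - e k / real (\<phi> k) / ln 4 =
      (real (\<phi> k) * ln 14 - (s * real (\<phi> k) + e k)) / (real (\<phi> k) * ln 4)"
    using eventually_compose_filterlim[OF eventually_gt_at_top[of 0] assms(1)]
    by eventually_elim (simp add: field_simps)
  ultimately show ?thesis by (simp add: Lim_transform_eventually)
qed

lemma dimseq_eq: "n \<ge> N \<Longrightarrow> dimseq n = (real n * ln 14 - ln (F m n)) / (real n * ln 4)"
  using F_pos[of n] by (simp add: dimseq_def ln_div ln_realpow)

lemma dimseq_ge:
  fixes \<phi> :: "nat \<Rightarrow> nat"
  assumes "filterlim \<phi> at_top sequentially" "(\<lambda>k. e k / real (\<phi> k)) \<longlonglongrightarrow> 0"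
    and "\<forall>\<^sub>F k in sequentially. ln (F m (\<phi> k)) \<le> s * real (\<phi> k) + e k"
  shows "ereal ((ln 14 - s) / ln 4) \<le> liminf (\<lambda>k. ereal (dimseq (\<phi> k)))"
proof -
  have "\<forall>\<^sub>F k in sequentially. ereal ((real (\<phi> k) * ln 14 - (s * real (\<phi> k) + e k)) / (real (\<phi> k) * ln 4))
      \<le> ereal (dimseq (\<phi> k))"
    using assms(3) eventually_compose_filterlim[OF eventually_ge_at_top[of N] assms(1)]
    by eventually_elim (simp add: dimseq_eq divide_right_mono)
  from Liminf_mono[OF this] show ?thesis
    using lim_imp_Liminf[OF _ dimseq_tendsto[OF assms(1,2), of s]] by simp
qed

lemma dimseq_le:
  fixes \<phi> :: "nat \<Rightarrow> nat"
  assumes "filterlim \<phi> at_top sequentially" "(\<lambda>k. e k / real (\<phi> k)) \<longlonglongrightarrow> 0"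
    and "\<forall>\<^sub>F k in sequentially. s * real (\<phi> k) + e k \<le> ln (F m (\<phi> k))"
  shows "limsup (\<lambda>k. ereal (dimseq (\<phi> k))) \<le> ereal ((ln 14 - s) / ln 4)"
proof -
  have "\<forall>\<^sub>F k in sequentially. ereal (dimseq (\<phi> k)) \<le>
      ereal ((real (\<phi> k) * ln 14 - (s * real (\<phi> k) + e k)) / (real (\<phi> k) * ln 4))"
    using assms(3) eventually_compose_filterlim[OF eventually_ge_at_top[of N] assms(1)]
    by eventually_elim (simp add: dimseq_eq divide_right_mono)
  from Limsup_mono[OF this] show ?thesis
    using lim_imp_Limsup[OF _ dimseq_tendsto[OF assms(1,2), of s]] by simp
qed

lemma lower_dim_ge:
  assumes "(\<lambda>n. e n / real n) \<longlonglongrightarrow> 0" "\<forall>\<^sub>F n in sequentially. ln (F m n) \<le> s * real n + e n"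
  shows "ereal ((ln 14 - s) / ln 4) \<le> lower_local_dim \<mu> x"
  unfolding local_dims using dimseq_ge[OF filterlim_ident assms] .

lemma upper_dim_le:
  assumes "(\<lambda>n. e n / real n) \<longlonglongrightarrow> 0" "\<forall>\<^sub>F n in sequentially. s * real n + e n \<le> ln (F m n)"
  shows "upper_local_dim \<mu> x \<le> ereal ((ln 14 - s) / ln 4)"
  unfolding local_dims using dimseq_le[OF filterlim_ident assms] .

text \<open>A limsup is bounded below along any one sequence of levels, and in
  \<open>lower_dim_le\<close> a liminf is bounded above in the same way; the two opposite bounds
  need all large levels.\<close>

lemma upper_dim_ge:
  assumes "filterlim \<phi> at_top sequentially" "(\<lambda>k. e k / real (\<phi> k)) \<longlonglongrightarrow> 0"
    and "\<forall>\<^sub>F k in sequentially. ln (F m (\<phi> k)) \<le> s * real (\<phi> k) + e k"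
  shows "ereal ((ln 14 - s) / ln 4) \<le> upper_local_dim \<mu> x"
  using dimseq_ge[OF assms] Liminf_le_Limsup[of sequentially "\<lambda>k. ereal (dimseq (\<phi> k))"]
    Limsup_ge_filterlim[OF assms(1), of "\<lambda>n. ereal (dimseq n)"]
  unfolding local_dims by (meson order_trans sequentially_bot)

lemma lower_dim_le:
  assumes "filterlim \<phi> at_top sequentially" "(\<lambda>k. e k / real (\<phi> k)) \<longlonglongrightarrow> 0"
    and "\<forall>\<^sub>F k in sequentially. s * real (\<phi> k) + e k \<le> ln (F m (\<phi> k))"
  shows "lower_local_dim \<mu> x \<le> ereal ((ln 14 - s) / ln 4)"
  using dimseq_le[OF assms] Liminf_le_Limsup[of sequentially "\<lambda>k. ereal (dimseq (\<phi> k))"]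
    Liminf_le_filterlim[OF assms(1), of "\<lambda>n. ereal (dimseq n)"]
  unfolding local_dims by (meson order_trans sequentially_bot)

lemma lower_le_upper: "lower_local_dim \<mu> x \<le> upper_local_dim \<mu> x"
  unfolding local_dims by (rule Liminf_le_Limsup) simp

lemma lower_dim_ge_half: "ereal (1 / 2) \<le> lower_local_dim \<mu> x"
proof -
  define C where "C = ln (F m N) - real N * ln 7"
  have bound: "ln (F m n) \<le> ln 7 * real n + C" if "n \<ge> N" for n
  proof -
    have "ln (F m n) \<le> ln (7 ^ (n - N) * F m N)"
      using F_growth[OF order_refl that] F_pos[OF that] by (intro ln_mono) (use F_pos[of N] in auto)
    also have "\<dots> = ln 7 * real n + C"
      using F_pos[of N] that by (simp add: ln_mult ln_realpow C_def of_nat_diff algebra_simps)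
    finally show ?thesis .
  qed
  have "\<forall>\<^sub>F n in sequentially. ln (F m n) \<le> ln 7 * real n + C"
    using eventually_ge_at_top[of N] by eventually_elim (rule bound)
  from lower_dim_ge[OF const_over_n this]
  have "ereal ((ln 14 - ln 7) / ln 4) \<le> lower_local_dim \<mu> x" .
  moreover have "(ln 14 - ln 7) / ln 4 = (1 / 2 :: real)"
    using ln_mult[of 2 "7::real"] ln_realpow[of 2 2] by simp
  ultimately show ?thesis by simp
qed

text \<open>\<open>Q\<close> never decreases, so \<open>F\<close> stays above a positive constant,
  which is growth rate 0.\<close>

lemma upper_dim_le_max: "upper_local_dim \<mu> x \<le> ereal (ln 14 / ln 4)"
proof -
  have bound: "ln (Q m N) \<le> ln (F m n)" if "n \<ge> N" for n
    using Q_mono[OF order_refl that] Q_le_F[of n] Q_pos[of N] by (intro ln_mono) auto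
  have "\<forall>\<^sub>F n in sequentially. 0 * real n + ln (Q m N) \<le> ln (F m n)"
    using eventually_ge_at_top[of N] by eventually_elim (simp add: bound)
  from upper_dim_le[OF const_over_n this] show ?thesis by simp
qed

text \<open>At the levels just after a digit 2, \<open>F = Q\<close> is at most a constant times
  \<open>2 ^ n\<close>. Growth rate ln 2 corresponds to (ln 14 - ln 2) / ln 4.\<close>

lemma upper_dim_ge_7:
  assumes "\<And>n. \<exists>k\<ge>n. m (Suc k) = 4 * m k + 2"
  shows "ereal (ln 7 / ln 4) \<le> upper_local_dim \<mu> x"
proof -
  obtain \<psi> where \<psi>: "\<And>n. \<psi> n \<ge> n + N" "\<And>n. m (Suc (\<psi> n)) = 4 * m (\<psi> n) + 2"
  proof -
    have "\<forall>n. \<exists>k. n + N \<le> k \<and> m (Suc k) = 4 * m k + 2" using assms by blast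
    from choice[OF this] show thesis using that by blast
  qed
  define \<phi> where "\<phi> n = Suc (\<psi> n)" for n
  have \<phi>: "n \<le> \<phi> n" "N \<le> \<phi> n" for n using \<psi>(1)[of n] by (simp_all add: \<phi>_def)
  have lim: "filterlim \<phi> at_top sequentially"
    by (rule filterlim_at_top_mono[OF filterlim_ident]) (simp add: \<phi>)
  define C where "C = ln (Q m N) - real N * ln 2"
  have "ln (F m (\<phi> n)) \<le> ln 2 * real (\<phi> n) + C" for n
  proof -
    have "F m (\<phi> n) = Q m (\<phi> n)"
      using F_after_2[of "\<psi> n"] \<psi>[of n] by (simp add: \<phi>_def)
    then have "ln (F m (\<phi> n)) \<le> ln (2 ^ (\<phi> n - N) * Q m N)"
      using Q_growth[OF order_refl \<phi>(2)] Q_pos[OF \<phi>(2)] Q_pos[of N] by (intro ln_mono) auto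
    also have "\<dots> = ln 2 * real (\<phi> n) + C"
      using Q_pos[of N] \<phi>(2)[of n] by (simp add: ln_mult ln_realpow C_def of_nat_diff algebra_simps)
    finally show ?thesis .
  qed
  then have "\<forall>\<^sub>F n in sequentially. ln (F m (\<phi> n)) \<le> ln 2 * real (\<phi> n) + C" by simp
  from upper_dim_ge[OF lim filterlim_compose[OF const_over_n lim] this]
  have "ereal ((ln 14 - ln 2) / ln 4) \<le> upper_local_dim \<mu> x" .
  moreover have "ln 14 - ln 2 = ln (7 :: real)" using ln_mult[of 2 "7::real"] by simp
  ultimately show ?thesis by simp
qed

lemma upper_dim_half:
  assumes "n0 \<ge> N" "\<And>k. k \<ge> n0 \<Longrightarrow> m (Suc k) = 4 * m k + 3"
  shows "upper_local_dim \<mu> x \<le> ereal (1 / 2)"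
proof -
  define k where "k = Suc n0"
  have k: "k \<ge> N" "k \<ge> n0" using assms(1) by (simp_all add: k_def)
  \<comment> \<open>One digit 3 makes the right neighbour a multiple of 4, hence a code of positive
    weight. From level \<open>k\<close> on this weight grows by the factor 7 at every digit.\<close>
  have "m k + 1 = 4 * (m n0 + 1)" using assms(2)[of n0] by (simp add: k_def)
  moreover have "4 * (m n0 + 1) \<in> E (Suc n0)"
    using gapD[OF assms(1)] by (intro E_Suc_iff(1)) simp_all
  ultimately have "m k + 1 \<in> E k" by (simp only: k_def)
  define H where "H = W k (m k + 1) + W k (m k - 1) / 7"
  have H: "0 < H"
    using W_pos[OF \<open>m k + 1 \<in> E k\<close>] W_nonneg[of k "m k - 1"] by (simp add: H_def add_pos_nonneg)
  define C where "C = ln H - real k * ln 7"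
  have bound: "ln 7 * real n + C \<le> ln (F m n)" if "n \<ge> k" for n
  proof -
    have "ln 7 * real n + C = ln (7 ^ (n - k) * H)"
      using H that by (simp add: ln_mult ln_realpow C_def of_nat_diff algebra_simps)
    also have "\<dots> \<le> ln (F m n)"
      using F_ge_run[OF k(1) that, folded H_def] assms(2) k(2) H by (intro ln_mono) auto
    finally show ?thesis .
  qed
  have "\<forall>\<^sub>F n in sequentially. ln 7 * real n + C \<le> ln (F m n)"
    using eventually_ge_at_top[of k] by eventually_elim (rule bound)
  from upper_dim_le[OF const_over_n this]
  have "upper_local_dim \<mu> x \<le> ereal ((ln 14 - ln 7) / ln 4)" .
  moreover have "(ln 14 - ln 7) / ln 4 = (1 / 2 :: real)"
    using ln_mult[of 2 "7::real"] ln_realpow[of 2 2] by simp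
  ultimately show ?thesis by simp
qed

lemma upper_dim_cases:
  "upper_local_dim \<mu> x = ereal (1 / 2) \<or>
   ereal (ln 7 / ln 4) \<le> upper_local_dim \<mu> x \<and> upper_local_dim \<mu> x \<le> ereal (ln 14 / ln 4)"
proof (cases "\<forall>n. \<exists>k\<ge>n. m (Suc k) = 4 * m k + 2")
  case True
  then show ?thesis using upper_dim_ge_7 upper_dim_le_max by blast
next
  case False
  then obtain n where n: "\<And>k. k \<ge> n \<Longrightarrow> m (Suc k) \<noteq> 4 * m k + 2" by blast
  then have "m (Suc k) = 4 * m k + 3" if "k \<ge> max n N" for k using gapD(4)[of k] that by force
  then have "upper_local_dim \<mu> x \<le> ereal (1 / 2)" by (intro upper_dim_half[of "max n N"]) auto
  then show ?thesis using lower_dim_ge_half lower_le_upper by (meson antisym order_trans)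
qed

end
end

section \<open>Construction of points with prescribed dimensions\<close>

text \<open>\<open>t n\<close> selects the digit 3, its failure the digit 2. The start is the middle
  cell of level 0, because cell 0 is a code and cell 2 is the last one.\<close>

primrec digit_path :: "(nat \<Rightarrow> bool) \<Rightarrow> nat \<Rightarrow> int" where
  "digit_path t 0 = 1"
| "digit_path t (Suc n) = 4 * digit_path t n + (if t n then 3 else 2)"

definition path_point :: "(nat \<Rightarrow> bool) \<Rightarrow> real" where
  "path_point t = (SUP n. pt n (digit_path t n))"

lemma digit_path_bounds: "1 \<le> digit_path t n \<and> digit_path t n + 1 \<le> 2 * 4 ^ n"
  by (induction n) auto

lemma digit_path_not_code: "digit_path t n \<notin> E n"
proof (induction n)
  case (Suc n)
  have "0 \<le> digit_path t n" "digit_path t n < 3 * 4 ^ n"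
    using digit_path_bounds[of t n] by auto
  from E_Suc_iff(3,4)[OF this] Suc show ?case by simp
qed simp

lemma path_point_bounds:
  "pt n (digit_path t n) \<le> path_point t" "path_point t \<le> pt n (digit_path t n + 1)"
proof -
  have inc: "incseq (\<lambda>n. pt n (digit_path t n))"
  proof (rule incseq_SucI)
    fix n
    have "pt n (digit_path t n) = pt (Suc n) (4 * digit_path t n)" by (simp only: pt_Suc)
    also have "\<dots> \<le> pt (Suc n) (digit_path t (Suc n))" by simp
    finally show "pt n (digit_path t n) \<le> pt (Suc n) (digit_path t (Suc n))" .
  qed
  have dec: "decseq (\<lambda>n. pt n (digit_path t n + 1))"
  proof (rule decseq_SucI)
    fix n
    have "pt (Suc n) (digit_path t (Suc n) + 1) \<le> pt (Suc n) (4 * (digit_path t n + 1))" by simp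
    also have "\<dots> = pt n (digit_path t n + 1)" by (simp only: pt_Suc)
    finally show "pt (Suc n) (digit_path t (Suc n) + 1) \<le> pt n (digit_path t n + 1)" .
  qed
  have le: "pt i (digit_path t i) \<le> pt j (digit_path t j + 1)" for i j
  proof -
    have "pt i (digit_path t i) \<le> pt (max i j) (digit_path t (max i j))"
      by (rule incseqD[OF inc]) simp
    also have "\<dots> \<le> pt (max i j) (digit_path t (max i j) + 1)" by simp
    also have "\<dots> \<le> pt j (digit_path t j + 1)" by (rule decseqD[OF dec]) simp
    finally show ?thesis .
  qed
  then have "bdd_above (range (\<lambda>n. pt n (digit_path t n)))" by (intro bdd_aboveI2)
  then show "pt n (digit_path t n) \<le> path_point t" "path_point t \<le> pt n (digit_path t n + 1)"
    unfolding path_point_def by (auto intro: cSUP_upper cSUP_least le)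
qed

lemma gap_path_digit_path: "gap_path (digit_path t) 0 (path_point t)"
  unfolding gap_path_def
proof (intro allI impI)
  fix n
  show "0 \<le> digit_path t n \<and> digit_path t n \<notin> E n \<and> digit_path t n + 1 < 3 * 4 ^ n \<and>
    (digit_path t (Suc n) = 4 * digit_path t n + 2 \<or> digit_path t (Suc n) = 4 * digit_path t n + 3) \<and>
    pt n (digit_path t n) \<le> path_point t \<and> path_point t \<le> pt n (digit_path t n + 1)"
  proof -
    have "(0::int) < 4 ^ n" by simp
    with digit_path_bounds[of t n]
    have "0 \<le> digit_path t n" "digit_path t n + 1 < 3 * 4 ^ n" by linarith+
    then show ?thesis using digit_path_not_code[of t n] path_point_bounds[where n = n and t = t] by simp
  qed
qed

lemma path_point_in:
  "path_point t \<in> {0..1}" "in_loop_class (path_point t) LL"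
proof -
  have "pt 0 (digit_path t 0) = 1 / 3" "pt 0 (digit_path t 0 + 1) = 2 / 3" by (simp_all add: pt_def)
  then show "path_point t \<in> {0..1}" using path_point_bounds[where n = 0 and t = t] by simp
qed (rule gap_path_in_loop_class[OF gap_path_digit_path])

lemma Q_digit_path:
  "Q (digit_path t) 0 = 1" "F (digit_path t) 0 = 1"
  "Q (digit_path t) (Suc n) = (if t n then 1 else 2) * Q (digit_path t) n"
proof -
  show Q0: "Q (digit_path t) 0 = 1" by (simp add: Q_def W_0)
  show "F (digit_path t) 0 = 1" by (simp add: F_eq Q0 W_0)
  show "Q (digit_path t) (Suc n) = (if t n then 1 else 2) * Q (digit_path t) n"
    using gap_step_2(1)[of "digit_path t" n] gap_step_3(1)[of "digit_path t" n]
      digit_path_not_code[of t n] by simp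
qed

lemma F_digit_path_after_2:
  assumes "n = 0 \<or> \<not> t (n - 1)"
  shows "F (digit_path t) n = Q (digit_path t) n"
proof (cases n)
  case 0
  then show ?thesis by (simp add: Q_digit_path)
next
  case (Suc k)
  then show ?thesis using F_after_2[OF gap_path_digit_path, of k t] assms by simp
qed

lemma sqrt_Suc_le: "sqrt (real (Suc n)) \<le> sqrt (real n) + 1"
  by (rule real_le_lsqrt) (simp_all add: power2_sum)

text \<open>The positions of the digits 2 are the jumps of an integer sequence of slope \<open>\<beta>\<close>; the square
  root term keeps the runs of 3 of length \<open>o(n)\<close> also when \<open>\<beta> = 0\<close>.\<close>

lemma density_path:
  assumes ss: "self_similar_measure \<mu>" and \<beta>: "0 \<le> \<beta>" "\<beta> \<le> 1"
  obtains x where "x \<in> {0..1}" "in_loop_class x LL"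
    "lower_local_dim \<mu> x = ereal ((ln 14 - \<beta> * ln 2) / ln 4)"
    "upper_local_dim \<mu> x = ereal ((ln 14 - \<beta> * ln 2) / ln 4)"
proof -
  define u where "u n = \<beta> * real n + (1 - \<beta>) * sqrt (real n)" for n :: nat
  define g where "g n = nat \<lfloor>u n\<rfloor>" for n
  \<comment> \<open>A jump of \<open>g\<close> becomes a digit 2, which doubles \<open>Q\<close>;
    therefore \<open>Q m n = 2 ^ g n\<close>.\<close>
  define t where "t n \<longleftrightarrow> g (Suc n) = g n" for n
  define m where "m = digit_path t"
  note path = gap_path_digit_path[of t, folded m_def]
  have u0: "0 \<le> u n" for n using \<beta> by (simp add: u_def)
  have u_mono: "u n \<le> u (Suc n)" for n
    unfolding u_def using \<beta> by (intro add_mono mult_left_mono) auto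
  have u_Suc: "u (Suc n) \<le> u n + 1" for n
  proof -
    have "(1 - \<beta>) * sqrt (real (Suc n)) \<le> (1 - \<beta>) * (sqrt (real n) + 1)"
      using \<beta> by (intro mult_left_mono sqrt_Suc_le) simp
    then show ?thesis by (simp add: u_def algebra_simps)
  qed
  have g: "real (g n) \<le> u n" "u n < real (g n) + 1" for n
    using u0[of n] unfolding g_def by linarith+
  have g_Suc: "g (Suc n) = g n \<or> g (Suc n) = Suc (g n)" for n
  proof -
    have "real (g (Suc n)) < real (g n) + 2" "real (g n) < real (g (Suc n)) + 1"
      using g[of n] g[of "Suc n"] u_mono[of n] u_Suc[of n] by linarith+
    then have "g (Suc n) < g n + 2" "g n < g (Suc n) + 1" by linarith+
    then show ?thesis by linarith
  qed
  have Q: "Q m n = 2 ^ g n" for n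
  proof (induction n)
    case 0
    then show ?case by (simp add: m_def Q_digit_path g_def u_def)
  next
    case (Suc n)
    then show ?case using g_Suc[of n] by (auto simp: m_def Q_digit_path t_def)
  qed
  have upper: "ln (F m n) \<le> (\<beta> * ln 2) * real n + sqrt (real n) * (2 * ln 7 + ln 2)" for n
  proof -
    \<comment> \<open>The first level at which \<open>g\<close> has its present value: it is 0 or
      comes right after a digit 2, so there \<open>F\<close> equals \<open>Q\<close>, and between
      \<open>q\<close> and \<open>n\<close> all digits are 3.\<close>
    define q where "q = (LEAST q. g q = g n)"
    have q: "g q = g n" "q \<le> n" unfolding q_def by (rule LeastI Least_le, rule refl)+
    have Fq: "F m q = 2 ^ g n"
    proof -
      have "q = 0 \<or> \<not> t (q - 1)"
      proof (rule disjCI)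
        assume "\<not> \<not> t (q - 1)"
        show "q = 0"
        proof (rule ccontr)
          assume "q \<noteq> 0"
          with \<open>\<not> \<not> t (q - 1)\<close> q(1) have "g (q - 1) = g n" by (simp add: t_def)
          then have "q \<le> q - 1" unfolding q_def by (rule Least_le)
          with \<open>q \<noteq> 0\<close> show False by simp
        qed
      qed
      from F_digit_path_after_2[of q t, OF this] show ?thesis using Q[of q] q(1) by (simp add: m_def)
    qed
    have gap: "real (n - q) \<le> 2 * sqrt (real n)"
    proof (cases "n = 0")
      case False
      \<comment> \<open>As \<open>g\<close> is constant from \<open>q\<close> to \<open>n\<close>,
        \<open>\<beta> * (n - q) + (1 - \<beta>) * \<delta> < 1\<close>. Multiplying by
        \<open>a \<ge> 1\<close> and using \<open>n - q \<le> \<delta> * a\<close> in the second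
        term bounds the run length by \<open>a\<close>.\<close>
      define a \<delta> where "a = 2 * sqrt (real n)" and "\<delta> = sqrt (real n) - sqrt (real q)"
      have a: "1 \<le> a" using False by (simp add: a_def) (smt (verit) real_sqrt_ge_one Suc_leI of_nat_1 of_nat_mono not_gr_zero One_nat_def)
      have \<delta>: "0 \<le> \<delta>" using q(2) by (simp add: \<delta>_def)
      have "real (n - q) = \<delta> * (sqrt (real n) + sqrt (real q))"
        using q(2) by (simp add: \<delta>_def algebra_simps of_nat_diff)
      also have "\<dots> \<le> \<delta> * a" using q(2) \<delta> by (intro mult_left_mono) (simp_all add: a_def)
      finally have D: "real (n - q) \<le> \<delta> * a" .
      have "u n - u q < 1" using g[of n] g[of q] q(1) by simp
      then have "\<beta> * real (n - q) + (1 - \<beta>) * \<delta> < 1"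
        using q(2) by (simp add: u_def \<delta>_def of_nat_diff algebra_simps)
      then have "a * (\<beta> * real (n - q) + (1 - \<beta>) * \<delta>) \<le> a * 1"
        using a by (intro mult_left_mono) simp_all
      moreover have "\<beta> * real (n - q) \<le> a * (\<beta> * real (n - q))"
        using a \<beta>(1) mult_right_mono[of 1 a "\<beta> * real (n - q)"] by simp
      moreover have "(1 - \<beta>) * real (n - q) \<le> (1 - \<beta>) * (\<delta> * a)"
        using D \<beta>(2) by (intro mult_left_mono) simp_all
      ultimately show ?thesis unfolding a_def[symmetric] by (simp add: algebra_simps)
    qed simp
    have "F m n \<le> 7 ^ (n - q) * 2 ^ g n"
      using F_growth[OF path _ q(2)] by (simp add: Fq)
    then have "ln (F m n) \<le> ln (7 ^ (n - q) * 2 ^ g n)"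
      using F_pos[OF path, of n] by (intro ln_mono) auto
    also have "\<dots> = real (n - q) * ln 7 + real (g n) * ln 2" by (simp add: ln_mult ln_realpow)
    also have "\<dots> \<le> (2 * sqrt (real n)) * ln 7 + (\<beta> * real n + sqrt (real n)) * ln 2"
    proof (intro add_mono mult_right_mono gap)
      have "(1 - \<beta>) * sqrt (real n) \<le> sqrt (real n)" using \<beta> by (intro mult_left_le_one_le) auto
      then show "real (g n) \<le> \<beta> * real n + sqrt (real n)" using g(1)[of n] by (simp add: u_def)
    qed simp_all
    finally show ?thesis by (simp add: algebra_simps)
  qed
  have lower: "(\<beta> * ln 2) * real n + - ln 2 \<le> ln (F m n)" for n
  proof -
    have "0 \<le> (1 - \<beta>) * sqrt (real n)" using \<beta> by simp
    then have "\<beta> * real n - 1 \<le> real (g n)" using g(2)[of n] by (simp add: u_def)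
    then have "(\<beta> * real n - 1) * ln 2 \<le> real (g n) * ln 2" by (intro mult_right_mono) auto
    also have "\<dots> = ln (Q m n)" by (simp add: Q ln_realpow)
    also have "\<dots> \<le> ln (F m n)" using Q_le_F[OF path, of n] by (intro ln_mono) (auto simp: Q)
    finally show ?thesis by (simp add: algebra_simps)
  qed
  have lim: "(\<lambda>n. sqrt (real n) * (2 * ln 7 + ln 2) / real n) \<longlonglongrightarrow> 0"
  proof -
    have "(\<lambda>n. sqrt (real n) * c / real n) \<longlonglongrightarrow> 0" for c :: real by real_asymp
    then show ?thesis .
  qed
  have 1: "ereal ((ln 14 - \<beta> * ln 2) / ln 4) \<le> lower_local_dim \<mu> (path_point t)"
    using lower_dim_ge[OF path ss lim always_eventually] upper by blast
  have 2: "upper_local_dim \<mu> (path_point t) \<le> ereal ((ln 14 - \<beta> * ln 2) / ln 4)"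
    by (rule upper_dim_le[OF path ss const_over_n always_eventually]) (rule allI, rule lower)
  have 3: "lower_local_dim \<mu> (path_point t) \<le> upper_local_dim \<mu> (path_point t)"
    by (rule lower_le_upper[OF path ss])
  show thesis
    by (rule that[OF path_point_in[of t] antisym[OF order_trans[OF 3 2] 1] antisym[OF 2 order_trans[OF 1 3]]])
qed

text \<open>Blocks of 3 on \<open>[(1 - \<theta>) N, N)\<close> for the rapidly increasing sequence \<open>N = (j + 1)!\<close>; the
  lower dimension is attained at the ends of the blocks.\<close>

lemma block_path:
  assumes ss: "self_similar_measure \<mu>" and \<theta>: "0 \<le> \<theta>" "\<theta> < 1"
  obtains x where "x \<in> {0..1}" "in_loop_class x LL"
    "lower_local_dim \<mu> x = ereal ((ln 14 - (\<theta> * ln 7 + (1 - \<theta>) * ln 2)) / ln 4)"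
proof -
  define s where "s = \<theta> * ln 7 + (1 - \<theta>) * ln (2::real)"
  \<comment> \<open>From \<open>J\<close> on the block number \<open>j\<close> starts at
    \<open>q j > fact j\<close>, that is, strictly after the end \<open>fact j\<close> of the
    preceding block, so digits 2 separate the blocks.\<close>
  obtain J :: nat where J: "1 / (1 - \<theta>) < real J" using reals_Archimedean2 by blast
  have J1: "1 < (1 - \<theta>) * real (Suc j)" if "j \<ge> J" for j
  proof -
    have "1 / (1 - \<theta>) < real (Suc j)" using J that by linarith
    then show ?thesis using \<theta> by (simp add: field_simps)
  qed
  define q where "q j = nat \<lceil>(1 - \<theta>) * fact (Suc j)\<rceil>" for j
  define t where "t i \<longleftrightarrow> (\<exists>j\<ge>J. q j \<le> i \<and> i < fact (Suc j))" for i
  define m where "m = digit_path t"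
  note path = gap_path_digit_path[of t, folded m_def]
  have q: "(1 - \<theta>) * fact (Suc j) \<le> real (q j)" "real (q j) < (1 - \<theta>) * fact (Suc j) + 1" for j
  proof -
    have "0 \<le> (1 - \<theta>) * (fact (Suc j) :: real)" using \<theta> by simp
    then show "(1 - \<theta>) * fact (Suc j) \<le> real (q j)" "real (q j) < (1 - \<theta>) * fact (Suc j) + 1"
      unfolding q_def by linarith+
  qed
  have q_le: "q j \<le> fact (Suc j)" for j
  proof -
    have "(1 - \<theta>) * fact (Suc j) \<le> 1 * (fact (Suc j) :: real)" using \<theta> by (intro mult_right_mono) simp_all
    then have "real (q j) < real (fact (Suc j)) + 1"
      using q(2)[of j] unfolding of_nat_fact by linarith
    then show ?thesis by linarith
  qed
  have q_gt: "fact j < q j" if "j \<ge> J" for j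
  proof -
    have "1 * (fact j :: real) < ((1 - \<theta>) * real (Suc j)) * fact j"
      using J1[OF that] by (intro mult_strict_right_mono) simp_all
    also have "\<dots> = (1 - \<theta>) * fact (Suc j)" by (simp add: mult.assoc)
    also have "\<dots> \<le> real (q j)" by (rule q)
    finally have "real (fact j) < real (q j)" unfolding of_nat_fact by simp
    then show ?thesis by (simp only: of_nat_less_iff)
  qed
  have not_t: "\<not> t i" if "j \<ge> J" "fact j \<le> i" "i < q j" for i j
  proof
    assume "t i"
    then obtain k where k: "k \<ge> J" "q k \<le> i" "i < fact (Suc k)" unfolding t_def by blast
    consider "k < j" | "k = j" | "j < k" by linarith
    then show False
    proof cases
      case 1
      then have "fact (Suc k) \<le> (fact j :: nat)" by (intro fact_mono_nat) simp
      with k that show False by linarith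
    next
      case 3
      then have "fact (Suc j) \<le> (fact k :: nat)" by (intro fact_mono_nat) simp
      with q_gt[OF k(1)] q_le[of j] k that show False by linarith
    qed (use k that in simp)
  qed
  have s: "ln 2 \<le> s"
  proof -
    have "\<theta> * ln 2 \<le> \<theta> * ln (7::real)" using \<theta> by (intro mult_left_mono) simp_all
    then show ?thesis by (simp add: s_def algebra_simps)
  qed
  have F_le_2: "F m n \<le> 2 ^ n" if "n = 0 \<or> \<not> t (n - 1)" for n
  proof -
    have "F m n = Q m n" using F_digit_path_after_2[of n t] that by (simp add: m_def)
    also have "\<dots> \<le> 2 ^ n"
      using Q_growth[OF path order_refl, of n] Q_digit_path(1)[of t] by (simp add: m_def)
    finally show ?thesis .
  qed
  have upper: "ln (F m n) \<le> s * real n + 0" for n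
  proof (cases "n = 0 \<or> \<not> t (n - 1)")
    case True
    have "ln (F m n) \<le> ln (2 ^ n)"
      using F_le_2[OF True] F_pos[OF path, of n] by (intro ln_mono) simp_all
    also have "\<dots> \<le> s * real n" using mult_right_mono[OF s, of "real n"] by (simp add: ln_realpow mult.commute)
    finally show ?thesis by simp
  next
    case False
    then obtain j where j: "j \<ge> J" "q j \<le> n - 1" "n - 1 < fact (Suc j)" "n \<noteq> 0" unfolding t_def by blast
    have n: "q j \<le> n" "n \<le> fact (Suc j)" using j by linarith+
    have "\<not> t (q j - 1)" using q_gt[OF j(1)] by (intro not_t[OF j(1)]) linarith+
    then have "F m (q j) \<le> 2 ^ q j" using F_le_2 by blast
    then have "7 ^ (n - q j) * F m (q j) \<le> 7 ^ (n - q j) * 2 ^ q j" by (intro mult_left_mono) simp_all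
    with F_growth[OF path le0 n(1)] have "F m n \<le> 7 ^ (n - q j) * 2 ^ q j" by (rule order_trans)
    then have "ln (F m n) \<le> ln (7 ^ (n - q j) * 2 ^ q j)"
      using F_pos[OF path, of n] by (intro ln_mono) simp_all
    also have "\<dots> = real n * ln 7 - real (q j) * (ln 7 - ln 2)"
      using n(1) by (simp add: ln_mult ln_realpow of_nat_diff algebra_simps)
    \<comment> \<open>Within the block \<open>n\<close> is at most its end, so its start satisfies
      \<open>q j \<ge> (1 - \<theta>) * n\<close>: the share of digits 3 in the block among the
      first \<open>n\<close> is at most \<open>\<theta>\<close>, with equality up to rounding at the
      end of the block.\<close>
    also have "\<dots> \<le> real n * ln 7 - (1 - \<theta>) * real n * (ln 7 - ln 2)"
    proof -
      have "real n \<le> fact (Suc j)" using n(2) by (metis of_nat_fact of_nat_le_iff)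
      then have "(1 - \<theta>) * real n \<le> (1 - \<theta>) * fact (Suc j)" using \<theta> by (intro mult_left_mono) simp_all
      also have "\<dots> \<le> real (q j)" by (rule q)
      finally show ?thesis by (intro diff_left_mono mult_right_mono) simp_all
    qed
    also have "\<dots> = s * real n" by (simp add: s_def algebra_simps)
    finally show ?thesis by simp
  qed
  define \<phi> where "\<phi> k = (fact (Suc (k + J)) :: nat)" for k
  \<comment> \<open>The losses are ln 7 - ln 2 for the rounding in \<open>q\<close>, ln 14 for the
    start of the run, and \<open>fact (k + J) * ln 2\<close> for the earlier levels, where only
    \<open>Q \<ge> 1\<close> is used. The last is negligible because it is smaller than
    \<open>\<phi> k\<close> by a factor of order \<open>k + J + 1\<close>.\<close>
  define e where "e k = - (ln 7 - ln 2 + ln 14) - fact (k + J) * ln (2::real)" for k :: nat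
  have lower: "s * real (\<phi> k) + e k \<le> ln (F m (\<phi> k))" for k
  proof -
    define j where "j = k + J"
    have j: "j \<ge> J" by (simp add: j_def)
    have gt: "fact j < q j" using q_gt[OF j] .
    define a where "a = q j - 1"
    have a: "q j = Suc a" "fact j \<le> a" using gt by (simp_all add: a_def)
    have pow: "2 ^ (i - fact j) \<le> Q m i" if "fact j \<le> i" "i \<le> q j" for i
      using that
    proof (induction i rule: dec_induct)
      case base
      show ?case using Q_mono[OF path, of 0 "fact j"] Q_digit_path(1)[of t] by (simp add: m_def)
    next
      case (step i)
      then have "\<not> t i" by (intro not_t[OF j]) simp_all
      then have "Q m (Suc i) = 2 * Q m i" by (simp add: m_def Q_digit_path)
      then show ?case using step by (simp add: Suc_diff_le)
    qed
    have "\<not> t a" using a by (intro not_t[OF j]) simp_all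
    then have dig: "m (Suc a) = 4 * m a + 2" by (simp add: m_def)
    have "m a \<notin> E a" by (simp add: m_def digit_path_not_code)
    note g = gap_step_2(1,3)[of m a, OF this dig]
    have run: "m (Suc i) = 4 * m i + 3" if "q j \<le> i" "i < fact (Suc j)" for i
    proof -
      have "t i" using that j unfolding t_def by blast
      then show ?thesis by (simp add: m_def)
    qed
    \<comment> \<open>At the start of the run the right neighbour has weight 0, so the growth by 7
      is seeded by the cell \<open>m (q j) - 1\<close>. After a digit 2 this cell carries half of
      \<open>Q\<close>, and \<open>F_ge_run\<close> divides it by 7.\<close>
    have "2 ^ (q j - fact j) / 14 \<le> Q m (q j) / 14" using pow[of "q j"] gt by simp
    also have "\<dots> = W (q j) (m (q j) - 1) / 7" using g by (simp add: a(1))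
    also have "\<dots> \<le> W (q j) (m (q j) + 1) + W (q j) (m (q j) - 1) / 7" by (simp add: W_nonneg)
    finally have "7 ^ (fact (Suc j) - q j) * (2 ^ (q j - fact j) / 14) \<le>
        7 ^ (fact (Suc j) - q j) * (W (q j) (m (q j) + 1) + W (q j) (m (q j) - 1) / 7)"
      by (intro mult_left_mono) simp_all
    also have "\<dots> \<le> F m (fact (Suc j))"
      by (rule F_ge_run[OF path _ q_le]) (use run in simp_all)
    finally have "ln (7 ^ (fact (Suc j) - q j) * (2 ^ (q j - fact j) / 14)) \<le> ln (F m (fact (Suc j)))"
      by (intro ln_mono) simp_all
    moreover have "ln (7 ^ (fact (Suc j) - q j) * (2 ^ (q j - fact j) / 14)) =
       (fact (Suc j) - real (q j)) * ln 7 + (real (q j) - fact j) * ln 2 - ln (14 :: real)"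
    proof -
      have "real (fact (Suc j) - q j) = fact (Suc j) - real (q j)" using q_le[of j] by (simp only: of_nat_diff of_nat_fact)
      moreover have "real (q j - fact j) = real (q j) - fact j" using gt by (simp only: of_nat_diff less_imp_le of_nat_fact)
      moreover have "ln (7 ^ (fact (Suc j) - q j) * (2 ^ (q j - fact j) / 14)) =
         real (fact (Suc j) - q j) * ln 7 + real (q j - fact j) * ln 2 - ln (14 :: real)"
        by (simp add: ln_mult ln_div ln_realpow)
      ultimately show ?thesis by simp
    qed
    moreover have "real (q j) * (ln 7 - ln 2) \<le> ((1 - \<theta>) * fact (Suc j) + 1) * (ln 7 - ln (2::real))"
      using q(2)[of j] by (intro mult_right_mono) simp_all
    moreover have "real (\<phi> k) = fact (Suc j)" by (simp only: \<phi>_def j_def of_nat_fact)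
    ultimately show ?thesis
      unfolding e_def \<phi>_def j_def[symmetric] s_def by (simp only: of_nat_fact) (simp only: algebra_simps)
  qed
  have \<phi>: "filterlim \<phi> at_top sequentially"
    by (rule filterlim_at_top_mono[OF filterlim_ident])
      (intro always_eventually allI, unfold \<phi>_def, rule order_trans[OF _ fact_ge_self], simp)
  have lim: "(\<lambda>k. e k / real (\<phi> k)) \<longlonglongrightarrow> 0"
  proof -
    have "(\<lambda>k. - (ln 7 - ln 2 + ln 14) / real (\<phi> k)) \<longlonglongrightarrow> 0"
      by (rule filterlim_compose[OF const_over_n \<phi>])
    moreover have "(\<lambda>k. ln 2 / real (Suc (k + J))) \<longlonglongrightarrow> 0"
    proof -
      have "filterlim (\<lambda>k. Suc (k + J)) at_top sequentially"
        by (rule filterlim_at_top_mono[OF filterlim_ident]) simp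
      then show ?thesis by (rule filterlim_compose[OF const_over_n])
    qed
    ultimately have "(\<lambda>k. - (ln 7 - ln 2 + ln 14) / real (\<phi> k) - ln 2 / real (Suc (k + J))) \<longlonglongrightarrow> 0 - 0"
      by (rule tendsto_diff)
    moreover have "e k / real (\<phi> k) = - (ln 7 - ln 2 + ln 14) / real (\<phi> k) - ln 2 / real (Suc (k + J))" for k
    proof -
      have "real (\<phi> k) = real (Suc (k + J)) * fact (k + J)" by (simp add: \<phi>_def algebra_simps)
      then have "fact (k + J) * ln 2 / real (\<phi> k) = ln 2 / real (Suc (k + J))" by simp
      then show ?thesis unfolding e_def diff_divide_distrib by simp
    qed
    ultimately show ?thesis by simp
  qed
  have 1: "ereal ((ln 14 - s) / ln 4) \<le> lower_local_dim \<mu> (path_point t)"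
    by (rule lower_dim_ge[OF path ss const_over_n always_eventually]) (rule allI, rule upper)
  have 2: "lower_local_dim \<mu> (path_point t) \<le> ereal ((ln 14 - s) / ln 4)"
    by (rule lower_dim_le[OF path ss \<phi> lim always_eventually]) (rule allI, rule lower)
  show thesis
    by (rule that[OF path_point_in[of t] antisym[OF 2 1, unfolded s_def]])
qed

lemma half_path:
  assumes ss: "self_similar_measure \<mu>"
  obtains x where "x \<in> {0..1}" "in_loop_class x LL"
    "lower_local_dim \<mu> x = ereal (1 / 2)" "upper_local_dim \<mu> x = ereal (1 / 2)"
proof -
  define t where "t = (\<lambda>i::nat. True)"
  note path = gap_path_digit_path[of t]
  note 1 = lower_dim_ge_half[OF path ss] and 3 = lower_le_upper[OF path ss]
  have 2: "upper_local_dim \<mu> (path_point t) \<le> ereal (1 / 2)"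
    by (rule upper_dim_half[OF path ss order_refl]) (simp add: t_def)
  show thesis
    by (rule that[OF path_point_in[of t] antisym[OF order_trans[OF 3 2] 1] antisym[OF 2 order_trans[OF 1 3]]])
qed

section \<open>The two sets of dimensions\<close>

lemma ln_facts: "ln 4 = 2 * ln (2::real)" "ln 14 = ln 2 + ln (7::real)" "0 < ln (2::real)" "ln 2 < ln (7::real)"
  using ln_realpow[of 2 2] ln_mult[of 2 "7::real"] by simp_all

lemma half_less: "1 / 2 < ln 7 / ln (4::real)"
  using ln_facts by (simp add: field_simps)

text \<open>The value 1/2 would need \<open>\<theta> = 1\<close>, which \<open>block_path\<close>
  excludes, so it gets the path with all digits 3. Values below ln 7 / ln 4 use
  \<open>block_path\<close>, the others \<open>density_path\<close>.\<close>

lemma lower_dims_eq: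
  assumes "self_similar_measure \<mu>"
  shows "{lower_local_dim \<mu> x |x. x \<in> {0..1} \<and> in_loop_class x LL} = ereal ` {1 / 2..ln 14 / ln 4}"
proof (intro equalityI subsetI)
  fix y assume "y \<in> {lower_local_dim \<mu> x |x. x \<in> {0..1} \<and> in_loop_class x LL}"
  then obtain x where x: "y = lower_local_dim \<mu> x" "in_loop_class x LL" by blast
  obtain m N where path: "gap_path m N x" using in_loop_class_gap_path[OF x(2)] .
  have b: "ereal (1 / 2) \<le> y" "y \<le> ereal (ln 14 / ln 4)"
    unfolding x(1) using lower_dim_ge_half[OF path assms] lower_le_upper[OF path assms]
      upper_dim_le_max[OF path assms] by (auto intro: order_trans)
  then obtain r where "y = ereal r" by (cases y) auto
  with b show "y \<in> ereal ` {1 / 2..ln 14 / ln 4}" by simp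
next
  fix y assume "y \<in> ereal ` {1 / 2..ln 14 / ln 4}"
  then obtain r where r: "y = ereal r" "1 / 2 \<le> r" "r \<le> ln 14 / ln 4" by auto
  consider "r = 1 / 2" | "1 / 2 < r" "r < ln 7 / ln 4" | "ln 7 / ln 4 \<le> r" using r by linarith
  then have "\<exists>x. x \<in> {0..1} \<and> in_loop_class x LL \<and> lower_local_dim \<mu> x = ereal r"
  proof cases
    case 1
    show ?thesis by (rule half_path[OF assms]) (use \<open>r = 1 / 2\<close> in blast)
  next
    case 2
    \<comment> \<open>Solution of
      \<open>\<theta> * ln 7 + (1 - \<theta>) * ln 2 = ln 14 - r * ln 4\<close>, the growth rate
      belonging to dimension \<open>r\<close>.\<close>
    define \<theta> where "\<theta> = (ln 7 - r * ln 4) / (ln 7 - ln (2::real))"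
    have "ln 2 < r * ln 4" "r * ln 4 < ln 7" using 2 ln_facts by (simp_all add: field_simps)
    then have \<theta>: "0 \<le> \<theta>" "\<theta> < 1" using ln_facts by (simp_all add: \<theta>_def)
    have "\<theta> * (ln 7 - ln 2) = ln 7 - r * ln 4" using ln_facts by (simp add: \<theta>_def)
    then have "ln 14 - (\<theta> * ln 7 + (1 - \<theta>) * ln 2) = r * ln 4" using ln_facts(2) by (simp add: algebra_simps)
    then have r_eq: "(ln 14 - (\<theta> * ln 7 + (1 - \<theta>) * ln 2)) / ln 4 = r" by simp
    show ?thesis by (rule block_path[OF assms \<theta>, unfolded r_eq]) blast
  next
    case 3
    define \<beta> where "\<beta> = (ln 14 - r * ln 4) / ln 2"
    have "ln 7 \<le> r * ln 4" "r * ln 4 \<le> ln 14" using 3 r by (simp_all add: field_simps)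
    then have \<beta>: "0 \<le> \<beta>" "\<beta> \<le> 1" using ln_facts by (simp_all add: \<beta>_def)
    have r_eq: "(ln 14 - \<beta> * ln 2) / ln 4 = r" using ln_facts(3) by (simp add: \<beta>_def)
    show ?thesis by (rule density_path[OF assms \<beta>, unfolded r_eq]) blast
  qed
  then show "y \<in> {lower_local_dim \<mu> x |x. x \<in> {0..1} \<and> in_loop_class x LL}" unfolding r(1) by force
qed

lemma upper_dims_eq:
  assumes "self_similar_measure \<mu>"
  shows "{upper_local_dim \<mu> x |x. x \<in> {0..1} \<and> in_loop_class x LL} =
    ereal ` ({1 / 2} \<union> {ln 7 / ln 4..ln 14 / ln 4})"
proof (intro equalityI subsetI)
  fix y assume "y \<in> {upper_local_dim \<mu> x |x. x \<in> {0..1} \<and> in_loop_class x LL}"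
  then obtain x where x: "y = upper_local_dim \<mu> x" "in_loop_class x LL" by blast
  obtain m N where path: "gap_path m N x" using in_loop_class_gap_path[OF x(2)] .
  from upper_dim_cases[OF path assms]
  show "y \<in> ereal ` ({1 / 2} \<union> {ln 7 / ln 4..ln 14 / ln 4})"
    unfolding x(1)[symmetric]
  proof
    assume b: "ereal (ln 7 / ln 4) \<le> y \<and> y \<le> ereal (ln 14 / ln 4)"
    then obtain r where "y = ereal r" by (cases y) simp_all
    with b show ?thesis by simp
  qed simp
next
  fix y assume "y \<in> ereal ` ({1 / 2} \<union> {ln 7 / ln 4..ln 14 / ln 4})"
  then obtain r where r0: "y = ereal r" "r \<in> {1 / 2} \<union> {ln 7 / ln 4..ln 14 / ln 4}" by (rule imageE)
  have r: "y = ereal r" "r = 1 / 2 \<or> ln 7 / ln 4 \<le> r \<and> r \<le> ln 14 / ln 4" using r0 by auto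
  from r(2) have "\<exists>x. x \<in> {0..1} \<and> in_loop_class x LL \<and> upper_local_dim \<mu> x = ereal r"
  proof
    assume "r = 1 / 2"
    show ?thesis by (rule half_path[OF assms]) (use \<open>r = 1 / 2\<close> in blast)
  next
    assume r: "ln 7 / ln 4 \<le> r \<and> r \<le> ln 14 / ln 4"
    define \<beta> where "\<beta> = (ln 14 - r * ln 4) / ln 2"
    have "ln 7 \<le> r * ln 4" "r * ln 4 \<le> ln 14" using r by (simp_all add: field_simps)
    then have \<beta>: "0 \<le> \<beta>" "\<beta> \<le> 1" using ln_facts by (simp_all add: \<beta>_def)
    have r_eq: "(ln 14 - \<beta> * ln 2) / ln 4 = r" using ln_facts(3) by (simp add: \<beta>_def)
    show ?thesis by (rule density_path[OF assms \<beta>, unfolded r_eq]) blast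
  qed
  then show "y \<in> {upper_local_dim \<mu> x |x. x \<in> {0..1} \<and> in_loop_class x LL}" unfolding r(1) by force
qed

lemma gap_not_interval: "\<not> is_interval ({1 / 2} \<union> {ln 7 / ln 4..ln 14 / ln (4::real)})"
proof
  define c where "c = ln 7 / ln (4::real)"
  have c: "c \<le> ln 14 / ln 4" "1 / 2 < c"
    using half_less by (simp_all add: c_def divide_right_mono)
  assume "is_interval ({1 / 2} \<union> {ln 7 / ln 4..ln 14 / ln (4::real)})"
  then have I: "is_interval ({1 / 2} \<union> {c..ln 14 / ln 4})" by (simp only: c_def)
  have "(1 / 2 + c) / 2 \<in> {1 / 2} \<union> {c..ln 14 / ln 4}"
    by (rule mem_is_interval_1_I[OF I, of "1 / 2" c]) (use c in simp_all)
  with \<open>1 / 2 < c\<close> show False by auto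
qed

theorem mainTheorem13:
  fixes \<mu> :: "real measure"
  assumes "self_similar_measure \<mu>"
  shows "maximal_loop_class LL \<and>
    {L. essential_loop_class L} = {{(Some 4, 4, Some 4)}} \<and>
    LL \<noteq> {(Some 4, 4, Some 4)} \<and>
    {lower_local_dim \<mu> x | x. x \<in> {0..1} \<and> in_loop_class x LL}
      = ereal ` {1 / 2..ln 14 / ln 4} \<and>
    {upper_local_dim \<mu> x | x. x \<in> {0..1} \<and> in_loop_class x LL}
      = ereal ` ({1 / 2} \<union> {ln 7 / ln 4..ln 14 / ln 4}) \<and>
    \<not> (\<exists>I :: real set. is_interval I \<and>
         {upper_local_dim \<mu> x | x. x \<in> {0..1} \<and> in_loop_class x LL} = ereal ` I)"
proof (intro conjI)
  show "{L. essential_loop_class L} = {{(Some 4, 4, Some 4)}}"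
    by (simp add: essential_loop_class_iff)
  show "LL \<noteq> {(Some 4, 4, Some 4)}" by (auto simp: LL_def)
  show "\<not> (\<exists>I :: real set. is_interval I \<and>
      {upper_local_dim \<mu> x | x. x \<in> {0..1} \<and> in_loop_class x LL} = ereal ` I)"
  proof
    assume "\<exists>I :: real set. is_interval I \<and>
      {upper_local_dim \<mu> x | x. x \<in> {0..1} \<and> in_loop_class x LL} = ereal ` I"
    then obtain I :: "real set" where I: "is_interval I"
      "ereal ` ({1 / 2} \<union> {ln 7 / ln 4..ln 14 / ln 4}) = ereal ` I"
      unfolding upper_dims_eq[OF assms] by blast
    have "inj ereal" by (simp add: inj_def)
    from I(2) have "I = {1 / 2} \<union> {ln 7 / ln 4..ln 14 / ln 4}"
      unfolding inj_image_eq_iff[OF \<open>inj ereal\<close>] by (rule sym)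
    with I(1) gap_not_interval show False by simp
  qed
qed (rule maximal_loop_class_LL lower_dims_eq[OF assms] upper_dims_eq[OF assms])+

end
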